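(* Let $n\ge2$, $1^*=n/(n-1)$, and let $w\in A_1^*$ on $\mathbb{R}^n$. Let $C_1>0$ be the constant in the Pérez–Rela weighted Gagliardo–Nirenberg–Sobolev inequality for the measure $d\mu=w\,dx$, i.e. a constant for which $$\lVert g\rVert_{L^{1^*}(\mathbb{R}^n;w)}\le C_1\lVert Dg\rVert_{L^1(\mathbb{R}^n;(Mw)^{1/1^*})}\quad\text{for all }g\in W^{1,1}(\mathbb{R}^n;w).$$ Then, for all $f\in BV(\mathbb{R}^n;w)$, $$\lVert f\rVert_{L^{1^*}(\mathbb{R}^n;w)}\le C_1[w]_{A_1}^{2/1^*}\lVert Df\rVert_{w^{1/1^*}}(\mathbb{R}^n).$$ If, in addition, $f$ is $w^{1/1^*}$-approximable, then $$\lVert f\rVert_{L^{1^*}(\mathbb{R}^n;w)}\le C_1[w]_{A_1}^{1/1^*}\lVert Df\rVert_{w^{1/1^*}}(\mathbb{R}^n).$$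
   Context: $A_1^*$ weights (everywhere version): $w:\mathbb{R}^n\to[0,\infty]$ belongs to $A_1$ if $w\in L^1_{\mathrm{loc}}(\mathbb{R}^n)$ and there is $C>0$ with $\frac{1}{|B|}\int_B w\,dx\le C\inf_{x\in B}w(x)$ (a true infimum) for all balls $B\subseteq\mathbb{R}^n$; $[w]_{A_1}$ is the smallest such $C$. $w\in A_1^*$ means $w\in A_1$ and $w$ is lower semicontinuous. The case $w\equiv0$ is excluded, so $w>0$ everywhere. For a measurable weight $v:\mathbb{R}^n\to(0,\infty]$ and $p\geq 1$, $\lVert f\rVert_{L^p(\mathbb{R}^n;v)}=(\int|f|^p v\,dx)^{1/p}$, and $$\lVert Df\rVert_v(\mathbb{R}^n):=\sup\left\{\int_{\mathbb{R}^n} f\operatorname{div}\varphi\,dx:\varphi\in\mathrm{Lip}_c(\mathbb{R}^n;\mathbb{R}^n),\ |\varphi|\le v\right\}\in[0,\infty],$$ where $\mathrm{Lip}_c$ denotes compactly supported Lipschitz maps. $BV(\mathbb{R}^n;w)$ is the space of $f\in L^1(\mathbb{R}^n;w)$ with $\lVert Df\rVert_w(\mathbb{R}^n)<\infty$. $W^{1,1}(\mathbb{R}^n;w)$ is the space of $f\in L^1(\mathbb{R}^n;w)$ with weak gradient $Df$ satisfying $|Df|\in L^1(\mathbb{R}^n;w)$. $M$ is the uncentered Hardy–Littlewood maximal operator over balls. The Pérez–Rela theorem states: if $\mu$ is a locally finite Borel measure on $\mathbb{R}^n$ with $M\mu<\infty$ a.e., then there is a constant $C_1>0$ such that $\lVert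 g\rVert_{L^{1^*}(\mathbb{R}^n;\mu)}\le C_1\lVert Dg\rVert_{L^1(\mathbb{R}^n;(M\mu)^{1/1^*})}$ for all $g\in W^{1,1}(\mathbb{R}^n;\mu)$; it applies to $d\mu=w\,dx$ with $w\in A_1$, where $M\mu=Mw$. Every $f\in BV(\mathbb{R}^n;w)$ lies in the classical space $BV_{\mathrm{loc}}(\mathbb{R}^n)$, and $\lVert Df\rVert$ denotes its classical (unweighted) total variation Radon measure. For a weight $v$, $f$ is called $v$-approximable if $$\lim_{\varepsilon\to0}\frac{1}{|B(x,\varepsilon)|}\int_{B(x,\varepsilon)}|v(y)-v(x)|\,dy=0\quad\text{for }\lVert Df\rVert\text{-a.e. }x.$$ *)

theory Defs
  imports "HOL-Analysis.Analysis"
begin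

text \<open>
  Weights take values in \<open>ennreal\<close>; functions are everywhere-defined
  representatives that are measurable for \<open>lebesgue\<close>.
\<close>

text \<open>Intended for \<open>p > 0\<close> only.\<close>
definition epowr :: "ennreal \<Rightarrow> real \<Rightarrow> ennreal" where
  "epowr x p = (if x = top then top else ennreal (enn2real x powr p))"

text \<open>The exponent \<open>1\<^sup>*\<close> in dimension \<open>n \<ge> 2\<close>.\<close>
definition sobolev_conj :: "nat \<Rightarrow> real" where
  "sobolev_conj n = real n / (real n - 1)"

definition ball_average :: "('a::euclidean_space \<Rightarrow> ennreal) \<Rightarrow> 'a \<Rightarrow> real \<Rightarrow> ennreal" where
  "ball_average u x r = (\<integral>\<^sup>+y\<in>ball x r. u y \<partial>lebesgue) / emeasure lebesgue (ball x r)"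

definition maximal_fun :: "('a::euclidean_space \<Rightarrow> ennreal) \<Rightarrow> 'a \<Rightarrow> ennreal" where
  "maximal_fun u x = (SUP (y, r) \<in> {(y, r). 0 < r \<and> x \<in> ball y r}. ball_average u y r)"

subsection \<open>Muckenhoupt weights\<close>

definition locally_integrable_weight :: "('a::euclidean_space \<Rightarrow> ennreal) \<Rightarrow> bool" where
  "locally_integrable_weight w \<longleftrightarrow> w \<in> borel_measurable lebesgue \<and>
     (\<forall>K. compact K \<longrightarrow> (\<integral>\<^sup>+x\<in>K. w x \<partial>lebesgue) < \<infinity>)"

definition A1_bound :: "('a::euclidean_space \<Rightarrow> ennreal) \<Rightarrow> real \<Rightarrow> bool" where
  "A1_bound w C \<longleftrightarrow> 0 < C \<and>
     (\<forall>x r. 0 < r \<longrightarrow> ball_average w x r \<le> ennreal C * (INF y\<in>ball x r. w y))"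

definition A1 :: "('a::euclidean_space \<Rightarrow> ennreal) \<Rightarrow> bool" where
  "A1 w \<longleftrightarrow> locally_integrable_weight w \<and> (\<exists>C. A1_bound w C)"

definition A1_const :: "('a::euclidean_space \<Rightarrow> ennreal) \<Rightarrow> real" where
  "A1_const w = Inf {C. A1_bound w C}"

definition lower_semicontinuous :: "('a::topological_space \<Rightarrow> 'b::linorder) \<Rightarrow> bool" where
  "lower_semicontinuous u \<longleftrightarrow> (\<forall>a. open {x. a < u x})"

definition A1_star :: "('a::euclidean_space \<Rightarrow> ennreal) \<Rightarrow> bool" where
  "A1_star w \<longleftrightarrow> A1 w \<and> lower_semicontinuous w \<and> w \<noteq> (\<lambda>x. 0)"

subsection \<open>Weighted Lebesgue spaces\<close>

definition wLp_norm ::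
  "real \<Rightarrow> ('a::euclidean_space \<Rightarrow> ennreal) \<Rightarrow> ('a \<Rightarrow> 'b::real_normed_vector) \<Rightarrow> ennreal" where
  "wLp_norm p v f = epowr (\<integral>\<^sup>+x. ennreal (norm (f x) powr p) * v x \<partial>lebesgue) (1 / p)"

definition wL1 ::
  "('a::euclidean_space \<Rightarrow> ennreal) \<Rightarrow> ('a \<Rightarrow> 'b::euclidean_space) set" where
  "wL1 v = {f. f \<in> borel_measurable lebesgue \<and> wLp_norm 1 v f < \<infinity>}"

definition locally_integrable :: "('a::euclidean_space \<Rightarrow> 'b::euclidean_space) \<Rightarrow> bool" where
  "locally_integrable f \<longleftrightarrow> (\<forall>K. compact K \<longrightarrow> set_integrable lebesgue K f)"

subsection \<open>Test functions and weak gradients\<close>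

definition compact_support_in ::
  "('a::topological_space \<Rightarrow> 'b::real_vector) \<Rightarrow> 'a set \<Rightarrow> bool" where
  "compact_support_in \<phi> U \<longleftrightarrow>
     compact (closure {x. \<phi> x \<noteq> 0}) \<and> closure {x. \<phi> x \<noteq> 0} \<subseteq> U"

primrec Ck :: "nat \<Rightarrow> ('a::euclidean_space \<Rightarrow> 'b::euclidean_space) \<Rightarrow> bool" where
  "Ck 0 f \<longleftrightarrow> continuous_on UNIV f"
| "Ck (Suc k) f \<longleftrightarrow> (\<forall>x. f differentiable (at x)) \<and>
     (\<forall>v. Ck k (\<lambda>x. frechet_derivative f (at x) v))"

definition has_weak_gradient ::
  "('a::euclidean_space \<Rightarrow> real) \<Rightarrow> ('a \<Rightarrow> 'a) \<Rightarrow> bool" where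
  "has_weak_gradient g G \<longleftrightarrow> locally_integrable g \<and> locally_integrable G \<and>
     (\<forall>\<phi> :: 'a \<Rightarrow> real. \<forall>b\<in>Basis. (\<forall>k. Ck k \<phi>) \<and> compact_support_in \<phi> UNIV \<longrightarrow>
        (LINT x|lebesgue. g x * frechet_derivative \<phi> (at x) b)
          = - (LINT x|lebesgue. (G x \<bullet> b) * \<phi> x))"

definition W11 :: "('a::euclidean_space \<Rightarrow> ennreal) \<Rightarrow> ('a \<Rightarrow> real) set" where
  "W11 w = {g \<in> wL1 w. \<exists>G \<in> wL1 w. has_weak_gradient g G}"

subsection \<open>Variation\<close>

text \<open>
  The divergence of a Lipschitz field is defined almost everywhere (Rademacher);
  the value \<open>0\<close> at points of non-differentiability is arbitrary.
\<close>
definition divergence :: "('a::euclidean_space \<Rightarrow> 'a) \<Rightarrow> 'a \<Rightarrow> real" where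
  "divergence \<phi> x =
     (if \<phi> differentiable (at x)
      then \<Sum>b\<in>Basis. frechet_derivative \<phi> (at x) b \<bullet> b else 0)"

text \<open>
  The coercion \<open>ennreal\<close> truncates negative integrals to \<open>0\<close>. This does not change
  the suprema below, because the zero field is always admissible.
\<close>
definition weighted_variation ::
  "('a::euclidean_space \<Rightarrow> ennreal) \<Rightarrow> ('a \<Rightarrow> real) \<Rightarrow> ennreal" where
  "weighted_variation v f =
     (SUP \<phi> \<in> {\<phi> :: 'a \<Rightarrow> 'a. (\<exists>L. L-lipschitz_on UNIV \<phi>) \<and> compact_support_in \<phi> UNIV \<and>
                (\<forall>x. ennreal (norm (\<phi> x)) \<le> v x)}.
        ennreal (LINT x|lebesgue. f x * divergence \<phi> x))"

definition BV :: "('a::euclidean_space \<Rightarrow> ennreal) \<Rightarrow> ('a \<Rightarrow> real) set" where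
  "BV w = {f \<in> wL1 w. weighted_variation w f < \<infinity>}"

definition classical_variation :: "('a::euclidean_space \<Rightarrow> real) \<Rightarrow> 'a set \<Rightarrow> ennreal" where
  "classical_variation f U =
     (SUP \<phi> \<in> {\<phi> :: 'a \<Rightarrow> 'a. Ck 1 \<phi> \<and> compact_support_in \<phi> U \<and> (\<forall>x. norm (\<phi> x) \<le> 1)}.
        ennreal (LINT x|lebesgue. f x * divergence \<phi> x))"

text \<open>
  The total variation measure is the Borel measure that extends the variation on open
  sets by outer regularity. For \<open>f\<close> locally of bounded variation this set function is
  countably additive on Borel sets (De Giorgi--Letta), so that \<open>measure_of\<close> does not
  fall back to the zero measure.
\<close>
definition variation_measure :: "('a::euclidean_space \<Rightarrow> real) \<Rightarrow> 'a measure" where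
  "variation_measure f =
     measure_of UNIV (sets borel)
       (\<lambda>A. INF U \<in> {U. open U \<and> A \<subseteq> U}. classical_variation f U)"

text \<open>
  Subtraction on \<open>ennreal\<close> is truncated at \<open>0\<close>, so the sum of the two differences is
  \<open>\<bar>v y - v x\<bar>\<close>; it is infinite if \<open>v x\<close> or \<open>v y\<close> is.
\<close>
definition approximable ::
  "('a::euclidean_space \<Rightarrow> ennreal) \<Rightarrow> ('a \<Rightarrow> real) \<Rightarrow> bool" where
  "approximable v f \<longleftrightarrow>
     (AE x in variation_measure f.
        ((\<lambda>\<epsilon>. ball_average (\<lambda>y. (v y - v x) + (v x - v y)) x \<epsilon>) \<longlongrightarrow> 0) (at_right 0))"

end

theory Submission
  imports Defs
begin

text \<open>
  Write \<open>v = w\<^sup>1\<^sup>/\<^sup>p\<close>, \<open>K\<close> for the \<open>A\<^sub>1\<close> constant of \<open>w\<close>, and \<open>f\<^sub>\<epsilon> = \<rho>\<^sub>\<epsilon> * f\<close> for the convolution of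
  \<open>f\<close> with a radially decreasing mollifier. The plan is to apply the Gagliardo--Nirenberg--Sobolev
  hypothesis to \<open>f\<^sub>\<epsilon>\<close>, which lies in \<open>W\<^sup>1\<^sup>,\<^sup>1(w)\<close>, and to let \<open>\<epsilon>\<close> tend to \<open>0\<close>. The \<open>A\<^sub>1\<close> condition
  gives \<open>M w \<le> K w\<close> everywhere (\<open>maximal_fun_le\<close>), so the right-hand side of the hypothesis is at
  most \<open>C\<^sub>1 K\<^sup>1\<^sup>/\<^sup>p \<integral> \<bar>\<nabla>f\<^sub>\<epsilon>\<bar> v\<close>. Since \<open>f\<^sub>\<epsilon> \<rightarrow> f\<close> in \<open>L\<^sup>1\<close> on balls (\<open>conv_tendsto_L1_loc\<close>), a subsequence
  converges almost everywhere and Fatou's lemma bounds the left-hand side from below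
  (\<open>wLp_norm_le_of_mollified\<close>). What remains is to bound \<open>\<integral> \<bar>\<nabla>f\<^sub>\<epsilon>\<bar> v\<close> by the variation of \<open>f\<close>.

  This is done by duality. Testing \<open>\<nabla>f\<^sub>\<epsilon>\<close> against a bounded field \<open>\<psi>\<close> with \<open>\<bar>\<psi>\<bar> \<le> v\<close> equals, up to
  sign, testing \<open>f\<close> against the divergence of \<open>\<Phi> = \<rho>\<^sub>\<epsilon> * \<psi>\<close>, and \<open>\<bar>\<Phi>\<bar> \<le> \<rho>\<^sub>\<epsilon> * v\<close> pointwise. Hence
  \<open>\<integral> \<bar>\<nabla>f\<^sub>\<epsilon>\<bar> v\<close> is at most the supremum of \<open>\<integral> f div \<Phi>\<close> over \<open>C\<^sup>1\<close> fields with compact support that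
  are dominated by \<open>\<rho>\<^sub>\<epsilon> * v\<close> (\<open>mollified_gradient_duality\<close>).

  For the first inequality, \<open>v\<close> satisfies the \<open>A\<^sub>1\<close> condition with constant \<open>K\<^sup>1\<^sup>/\<^sup>p\<close> by concavity of
  the power (\<open>ball_integral_epowr_A1\<close>), and \<open>\<rho>\<^sub>\<epsilon>\<close> is a superposition of indicators of balls, so
  \<open>\<rho>\<^sub>\<epsilon> * v \<le> K\<^sup>1\<^sup>/\<^sup>p v\<close> (\<open>mollified_le_of_ball_bound\<close>). The fields \<open>K\<^sup>-\<^sup>1\<^sup>/\<^sup>p \<Phi>\<close> are therefore admissible in
  the weighted variation, which costs the second factor \<open>K\<^sup>1\<^sup>/\<^sup>p\<close>.

  For an approximable \<open>f\<close> this loss is avoided by means of the total variation measure \<open>\<mu>\<close> of \<open>f\<close>.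
  For compactly supported \<open>C\<^sup>1\<close> fields \<open>\<integral> f div \<Phi> \<le> \<integral> \<bar>\<Phi>\<bar> d\<mu>\<close> (\<open>pairing_le_nn_integral_variation\<close>), hence
  \<open>\<integral> \<bar>\<nabla>f\<^sub>\<epsilon>\<bar> v \<le> \<integral> \<rho>\<^sub>\<epsilon> * v d\<mu>\<close>. Approximability says that \<open>\<rho>\<^sub>\<epsilon> * v \<rightarrow> v\<close> almost everywhere for \<open>\<mu>\<close>, with the
  dominating function \<open>K\<^sup>1\<^sup>/\<^sup>p v\<close>. For lower semicontinuous \<open>v\<close> the integral \<open>\<integral> v d\<mu>\<close> is at most the weighted
  variation (\<open>nn_integral_variation_le_weighted_variation\<close>), which may be assumed finite, so the
  right-hand side tends to \<open>\<integral> v d\<mu>\<close> by dominated convergence. Both inequalities for \<open>\<mu>\<close> are proved by cutting the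
  integrand into horizontal layers of small height. That \<open>\<mu>\<close> is a Borel measure whose value on an
  open set is the variation there (\<open>emeasure_variation_measure\<close>) follows from Caratheodory's
  construction; subadditivity on open sets comes from the localisation estimate
  \<open>pairing_le_sum_variations\<close>.
\<close>

section \<open>A radially decreasing mollifier\<close>

text \<open>
  The normalised square of the positive part of \<open>e\<^sup>2 - \<bar>z\<bar>\<^sup>2\<close>. The square makes it \<open>C\<^sup>1\<close> with Lipschitz
  gradient, and its nonempty superlevel sets at levels \<open>t \<ge> 0\<close> are balls; the formula makes both explicit.
\<close>

definition mollifier :: "real \<Rightarrow> 'a::euclidean_space \<Rightarrow> real" where
  "mollifier e z = (max 0 (e\<^sup>2 - (norm z)\<^sup>2))\<^sup>2 / (LINT y|(lborel::'a measure). (max 0 (e\<^sup>2 - (norm y)\<^sup>2))\<^sup>2)"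

definition mollifier_grad :: "real \<Rightarrow> 'a::euclidean_space \<Rightarrow> 'a" where
  "mollifier_grad e z =
     (- 4 * max 0 (e\<^sup>2 - (norm z)\<^sup>2) / (LINT y|(lborel::'a measure). (max 0 (e\<^sup>2 - (norm y)\<^sup>2))\<^sup>2)) *\<^sub>R z"

lemma continuous_vanishing_integrable:
  fixes k :: "'a::euclidean_space \<Rightarrow> 'b::euclidean_space"
  assumes "continuous_on UNIV k" "\<And>z. norm z \<ge> r \<Longrightarrow> k z = 0"
  shows "integrable lborel k"
proof -
  have "integrable lborel (\<lambda>x. indicator (cball 0 r) x *\<^sub>R k x)"
    by (rule borel_integrable_compact) (auto intro: continuous_on_subset[OF assms(1)])
  also have "(\<lambda>x. indicator (cball 0 r) x *\<^sub>R k x) = k"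
  proof
    fix x show "indicator (cball 0 r) x *\<^sub>R k x = k x"
      using assms(2)[of x] by (auto simp: indicator_def)
  qed
  finally show ?thesis .
qed

lemma continuous_vanishing_bounded:
  fixes k :: "'a::euclidean_space \<Rightarrow> 'b::euclidean_space"
  assumes "continuous_on UNIV k" "\<And>z. norm z \<ge> r \<Longrightarrow> k z = 0"
  obtains M where "0 \<le> M" "\<And>z. norm (k z) \<le> M"
proof -
  have "bounded (k ` cball 0 r)"
    by (intro compact_imp_bounded compact_continuous_image continuous_on_subset[OF assms(1)]) auto
  then obtain M where M: "0 < M" "\<And>z. z \<in> cball 0 r \<Longrightarrow> norm (k z) \<le> M"
    unfolding bounded_pos by auto
  have "norm (k z) \<le> M" for z
    using M assms(2)[of z] by (cases "norm z \<le> r") auto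
  then show thesis using that[of M] M by auto
qed

lemma bump_vanishes: "norm z \<ge> e \<Longrightarrow> e > 0 \<Longrightarrow> max 0 (e\<^sup>2 - (norm z)\<^sup>2) = (0::real)"
  by (simp add: max_def power_mono)

lemma ball_measure_half:
  assumes "0 < e"
  shows "measure lborel (ball (0::'a::euclidean_space) e)
     = 2 ^ DIM('a) * measure lborel (ball (0::'a) (e/2))"
  using assms by (simp add: content_ball power_divide)

text \<open>
  On the ball of half the radius the paraboloid is at least \<open>3/4 e\<^sup>2\<close>, which bounds the mass from
  below and so the normalised mollifier from above.
\<close>

lemma bump_mass:
  fixes e :: real
  assumes "0 < e"
  shows "(9/16) * e^4 * measure lborel (ball (0::'a) (e/2))
            \<le> (LINT y|(lborel::'a::euclidean_space measure). (max 0 (e\<^sup>2 - (norm y)\<^sup>2))\<^sup>2)" (is "_ \<le> ?I")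
    and "0 < (LINT y|(lborel::'a::euclidean_space measure). (max 0 (e\<^sup>2 - (norm y)\<^sup>2))\<^sup>2)"
proof -
  have int: "integrable lborel (\<lambda>y::'a. (max 0 (e\<^sup>2 - (norm y)\<^sup>2))\<^sup>2)"
    by (rule continuous_vanishing_integrable[of _ e])
       (auto intro!: continuous_intros simp: bump_vanishes assms)
  have "(9/16) * e^4 * measure lborel (ball (0::'a) (e/2))
      = (LINT y|lborel. (9/16) * e^4 * indicator (ball (0::'a) (e/2)) y)"
    by simp
  also have "\<dots> \<le> ?I"
  proof (rule integral_mono[OF _ int])
    show "integrable lborel (\<lambda>y. (9/16) * e^4 * indicator (ball (0::'a) (e/2)) y)"
      by (intro integrable_mult_right integrable_real_indicator) (use emeasure_bounded_finite[OF bounded_ball] in \<open>auto simp: less_top\<close>)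
    fix y :: 'a
    show "(9/16) * e^4 * indicator (ball (0::'a) (e/2)) y \<le> (max 0 (e\<^sup>2 - (norm y)\<^sup>2))\<^sup>2"
    proof (cases "norm y < e/2")
      case True
      then have "(norm y)\<^sup>2 \<le> (e/2)\<^sup>2" by (intro power_mono) auto
      then have "3/4 * e\<^sup>2 \<le> e\<^sup>2 - (norm y)\<^sup>2" by (simp add: power_divide)
      then have "3/4 * e\<^sup>2 \<le> max 0 (e\<^sup>2 - (norm y)\<^sup>2)" by linarith
      then have "(3/4 * e\<^sup>2)\<^sup>2 \<le> (max 0 (e\<^sup>2 - (norm y)\<^sup>2))\<^sup>2"
        by (intro power_mono) auto
      then show ?thesis using True
        by (simp add: power_mult_distrib power_divide indicator_def)
    qed (simp add: indicator_def)
  qed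
  finally show *: "(9/16) * e^4 * measure lborel (ball (0::'a) (e/2)) \<le> ?I" .
  have "0 < measure lborel (ball (0::'a) (e/2))"
    using assms by (simp add: content_ball)
  then have "0 < (9/16) * e^4 * measure lborel (ball (0::'a) (e/2))" using assms by simp
  with * show "0 < ?I" by linarith
qed

lemma mollifier_nonneg: "0 \<le> mollifier e z"
  unfolding mollifier_def by (simp add: integral_nonneg_AE)

lemma mollifier_eq_0: "0 < e \<Longrightarrow> e \<le> norm z \<Longrightarrow> mollifier e z = 0"
  by (simp add: mollifier_def bump_vanishes)

lemma mollifier_grad_eq_0: "0 < e \<Longrightarrow> e \<le> norm z \<Longrightarrow> mollifier_grad e z = 0"
  by (simp add: mollifier_grad_def bump_vanishes)

lemma mollifier_grad_minus: "mollifier_grad e (- z) = - mollifier_grad e z"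
  by (simp add: mollifier_grad_def)

lemma mollifier_norm_cong: "norm (y::'a::euclidean_space) = norm (z::'a) \<Longrightarrow> mollifier e y = mollifier e z"
  by (simp add: mollifier_def)

lemma continuous_mollifier: "continuous_on S (mollifier e)"
proof -
  have "continuous_on S (\<lambda>z::'a. (max 0 (e\<^sup>2 - (norm z)\<^sup>2))\<^sup>2 * inverse (LINT y|(lborel::'a measure). (max 0 (e\<^sup>2 - (norm y)\<^sup>2))\<^sup>2))"
    by (intro continuous_intros)
  then show ?thesis unfolding mollifier_def[abs_def] divide_inverse .
qed

lemma continuous_mollifier_grad: "continuous_on S (mollifier_grad e)"
proof -
  have "continuous_on S (\<lambda>z::'a. (- 4 * max 0 (e\<^sup>2 - (norm z)\<^sup>2) * inverse (LINT y|(lborel::'a measure). (max 0 (e\<^sup>2 - (norm y)\<^sup>2))\<^sup>2)) *\<^sub>R z)"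
    by (intro continuous_intros)
  then show ?thesis unfolding mollifier_grad_def[abs_def] divide_inverse .
qed

lemma measurable_mollifier [measurable]: "mollifier e \<in> borel_measurable borel"
  by (intro borel_measurable_continuous_onI continuous_mollifier)

lemma measurable_mollifier_grad [measurable]: "mollifier_grad e \<in> borel_measurable borel"
  by (intro borel_measurable_continuous_onI continuous_mollifier_grad)

lemma integrable_mollifier: "0 < e \<Longrightarrow> integrable lborel (mollifier e)"
  by (rule continuous_vanishing_integrable[of _ e]) (auto intro: continuous_mollifier mollifier_eq_0)

lemma integral_mollifier:
  assumes "0 < e" shows "(LINT z|lborel. mollifier e (z::'a::euclidean_space)) = 1"
  using bump_mass(2)[OF assms, where 'a='a] unfolding mollifier_def by simp

lemma nn_integral_mollifier:
  assumes "0 < e" shows "(\<integral>\<^sup>+z. ennreal (mollifier e (z::'a::euclidean_space)) \<partial>lborel) = 1"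
  using nn_integral_eq_integral[OF integrable_mollifier[OF assms, where 'a='a]]
  by (simp add: mollifier_nonneg integral_mollifier[OF assms])

text \<open>
  The constant only has to be independent of \<open>e\<close>: it compares mollified values with ball averages
  at points of approximability.
\<close>

lemma mollifier_le:
  fixes z :: "'a::euclidean_space"
  assumes e: "0 < e"
  shows "mollifier e z \<le> 2 * 2 ^ DIM('a) / measure lborel (ball (0::'a) e)"
proof -
  let ?I = "LINT y|(lborel::'a measure). (max 0 (e\<^sup>2 - (norm y)\<^sup>2))\<^sup>2"
  let ?m = "measure lborel (ball (0::'a) (e/2))"
  have m: "0 < ?m" using e by (simp add: content_ball)
  have "(max 0 (e\<^sup>2 - (norm z)\<^sup>2))\<^sup>2 \<le> (e\<^sup>2)\<^sup>2"
    by (intro power_mono) auto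
  then have "(max 0 (e\<^sup>2 - (norm z)\<^sup>2))\<^sup>2 \<le> e^4" by simp
  then have "mollifier e z \<le> e^4 / ?I"
    unfolding mollifier_def using bump_mass(2)[OF e, where 'a='a] by (simp add: divide_right_mono)
  also have "\<dots> \<le> e^4 / ((9/16) * e^4 * ?m)"
    using bump_mass[OF e, where 'a='a] m e by (intro divide_left_mono) auto
  also have "\<dots> = (16/9) / ?m" using e m by (simp add: field_simps)
  also have "\<dots> \<le> 2 / ?m" using m by (intro divide_right_mono) auto
  also have "\<dots> = 2 * 2 ^ DIM('a) / measure lborel (ball (0::'a) e)"
    unfolding ball_measure_half[OF e] by simp
  finally show ?thesis .
qed

text \<open>
  The derivative \<open>2 max 0 s\<close> of the squared positive part is \<open>2\<close>-Lipschitz.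
\<close>

lemma pos_part_square_taylor:
  fixes s t :: real
  shows "\<bar>(max 0 t)\<^sup>2 - (max 0 s)\<^sup>2 - 2 * max 0 s * (t - s)\<bar> \<le> (t - s)\<^sup>2"
proof (cases "0 \<le> s"; cases "0 \<le> t")
  assume "0 \<le> s" "0 \<le> t"
  then have "(max 0 t)\<^sup>2 - (max 0 s)\<^sup>2 - 2 * max 0 s * (t - s) = (t - s)\<^sup>2"
    by (simp add: power2_eq_square algebra_simps)
  then show ?thesis by simp
next
  assume st: "0 \<le> s" "\<not> 0 \<le> t"
  then have "0 \<le> s * (-t)" by (intro mult_nonneg_nonneg) auto
  moreover have "(max 0 t)\<^sup>2 - (max 0 s)\<^sup>2 - 2 * max 0 s * (t - s) = s * s + 2 * (s * (-t))"
    using st by (simp add: power2_eq_square algebra_simps)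
  moreover have "(t - s)\<^sup>2 = t * t + s * s + 2 * (s * (-t))"
    by (simp add: power2_eq_square algebra_simps)
  moreover have "0 \<le> s * s" "0 \<le> t * t" by simp_all
  ultimately show ?thesis by (simp only: abs_le_iff) linarith
next
  assume st: "\<not> 0 \<le> s" "0 \<le> t"
  then have "t\<^sup>2 \<le> (t-s)\<^sup>2" by (intro power_mono) auto
  then show ?thesis using st by simp
qed simp

text \<open>
  A uniform quadratic remainder allows differentiation under the convolution integral for every
  locally integrable function. It comes from \<open>pos_part_square_taylor\<close> with \<open>s = e\<^sup>2 - \<bar>z\<bar>\<^sup>2\<close> and
  \<open>t = e\<^sup>2 - \<bar>z + h\<bar>\<^sup>2\<close>; far from the support all three terms vanish.
\<close>

lemma mollifier_taylor:
  assumes e: "0 < e"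
  obtains L where "0 \<le> L" "\<And>z h::'a::euclidean_space. norm h \<le> e \<Longrightarrow>
    \<bar>mollifier e (z + h) - mollifier e z - mollifier_grad e z \<bullet> h\<bar> \<le> L * (norm h)\<^sup>2"
proof -
  let ?I = "LINT y|(lborel::'a measure). (max 0 (e\<^sup>2 - (norm y)\<^sup>2))\<^sup>2"
  have I: "0 < ?I" using bump_mass(2)[OF e] .
  have *: "\<bar>mollifier e (z + h) - mollifier e z - mollifier_grad e z \<bullet> h\<bar> \<le> (27 * e\<^sup>2 / ?I) * (norm h)\<^sup>2"
    if h: "norm h \<le> e" for z h :: 'a
  proof (cases "norm z < 2 * e")
    case True
    define s where "s = e\<^sup>2 - (norm z)\<^sup>2"
    define t where "t = e\<^sup>2 - (norm (z + h))\<^sup>2"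
    have ts: "t - s = - 2 * (z \<bullet> h) - (norm h)\<^sup>2"
      unfolding s_def t_def power2_norm_eq_inner by (simp add: algebra_simps inner_commute)
    have zh: "\<bar>z \<bullet> h\<bar> \<le> (2 * e) * norm h"
      using Cauchy_Schwarz_ineq2[of z h] True
      by (smt (verit) mult_right_mono norm_ge_zero)
    have hh: "(norm h)\<^sup>2 \<le> e * norm h" using h by (simp add: power2_eq_square mult_right_mono)
    have "\<bar>t - s\<bar> \<le> 5 * e * norm h" using zh hh zero_le_power2[of "norm h"] unfolding ts abs_le_iff by linarith
    then have 1: "(t - s)\<^sup>2 \<le> 25 * e\<^sup>2 * (norm h)\<^sup>2"
      using power_mono[of "\<bar>t - s\<bar>" "5 * e * norm h" 2] by (simp add: power_mult_distrib)
    have s: "0 \<le> max 0 s" "max 0 s \<le> e\<^sup>2" by (auto simp: s_def)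
    then have 2: "\<bar>2 * max 0 s * (norm h)\<^sup>2\<bar> \<le> 2 * e\<^sup>2 * (norm h)\<^sup>2"
      by (auto intro!: mult_right_mono simp: abs_mult)
    have "(max 0 t)\<^sup>2 - (max 0 s)\<^sup>2 + 4 * max 0 s * (z \<bullet> h)
        = ((max 0 t)\<^sup>2 - (max 0 s)\<^sup>2 - 2 * max 0 s * (t - s)) - 2 * max 0 s * (norm h)\<^sup>2"
      unfolding ts by (simp add: algebra_simps)
    also have "\<bar>\<dots>\<bar> \<le> 27 * e\<^sup>2 * (norm h)\<^sup>2"
      using pos_part_square_taylor[of t s] 1 2 by linarith
    finally have "\<bar>(max 0 t)\<^sup>2 - (max 0 s)\<^sup>2 + 4 * max 0 s * (z \<bullet> h)\<bar> \<le> 27 * e\<^sup>2 * (norm h)\<^sup>2" .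
    then have "\<bar>(max 0 t)\<^sup>2 - (max 0 s)\<^sup>2 + 4 * max 0 s * (z \<bullet> h)\<bar> / ?I \<le> 27 * e\<^sup>2 * (norm h)\<^sup>2 / ?I"
      using I by (intro divide_right_mono) auto
    moreover have "mollifier e (z + h) - mollifier e z - mollifier_grad e z \<bullet> h
        = ((max 0 t)\<^sup>2 - (max 0 s)\<^sup>2 + 4 * max 0 s * (z \<bullet> h)) / ?I"
      unfolding mollifier_def mollifier_grad_def s_def t_def by (simp add: diff_divide_distrib add_divide_distrib)
    ultimately show ?thesis using I by simp
  next
    case False
    have "norm (z + h) \<ge> norm z - norm h" by (simp add: norm_diff_ineq)
    then show ?thesis using False h e I
      by (simp add: mollifier_eq_0 mollifier_grad_eq_0)
  qed
  show thesis
    by (rule that[OF _ *]) (use I in auto)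
qed

section \<open>Convolution with the mollifier\<close>

lemma lborel_distr_reflect: "distr lborel borel (\<lambda>y. x - y) = (lborel :: 'a::euclidean_space measure)"
  by (subst (2) lborel_affine[of "-1" x]) (simp_all add: density_1 one_ennreal_def[symmetric])

lemma nn_integral_reflect:
  fixes k :: "'a::euclidean_space \<Rightarrow> ennreal"
  assumes [measurable]: "k \<in> borel_measurable borel"
  shows "(\<integral>\<^sup>+y. k (x - y) \<partial>lborel) = (\<integral>\<^sup>+y. k y \<partial>lborel)"
  by (subst (2) lborel_distr_reflect[of x, symmetric]) (simp add: nn_integral_distr)

lemma integral_reflect:
  fixes k :: "'a::euclidean_space \<Rightarrow> 'b::euclidean_space"
  assumes [measurable]: "k \<in> borel_measurable borel"
  shows "(LINT y|lborel. k (x - y)) = (LINT y|lborel. k y)"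
  by (subst (2) lborel_distr_reflect[of x, symmetric]) (simp add: integral_distr)

definition loc_int :: "('a::euclidean_space \<Rightarrow> 'b::euclidean_space) \<Rightarrow> bool" where
  "loc_int \<psi> \<longleftrightarrow> \<psi> \<in> borel_measurable borel \<and>
     (\<forall>r. integrable lborel (\<lambda>y. indicator (cball 0 r) y *\<^sub>R \<psi> y))"

lemma loc_int_measurable: "loc_int \<psi> \<Longrightarrow> \<psi> \<in> borel_measurable borel"
  by (simp add: loc_int_def)

lemma loc_int_integrable_cball:
  assumes "loc_int \<psi>" shows "integrable lborel (\<lambda>y. indicator (cball x r) y *\<^sub>R \<psi> y)"
proof -
  note [measurable] = loc_int_measurable[OF assms]
  have "integrable lborel (\<lambda>y. indicator (cball 0 (norm x + r)) y *\<^sub>R \<psi> y)"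
    using assms by (simp add: loc_int_def)
  then show ?thesis
  proof (rule Bochner_Integration.integrable_bound)
    have "norm y \<le> norm x + r" if "dist x y \<le> r" for y
      using that norm_triangle_ineq2[of y x] by (simp add: dist_norm norm_minus_commute)
    then show "AE y in lborel. norm (indicat_real (cball x r) y *\<^sub>R \<psi> y)
        \<le> norm (indicat_real (cball 0 (norm x + r)) y *\<^sub>R \<psi> y)"
      by (auto simp: indicator_def)
    show "(\<lambda>y. indicat_real (cball x r) y *\<^sub>R \<psi> y) \<in> borel_measurable lborel"
      by (intro borel_measurable_scaleR borel_measurable_indicator)
         (simp_all add: loc_int_measurable[OF assms])
  qed
qed

text \<open>
  The common shape of all integrands below: a locally integrable function times a bounded kernel
  that vanishes outside a ball around \<open>x\<close>.
\<close>

lemma loc_int_dominated: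
  fixes \<psi> :: "'a::euclidean_space \<Rightarrow> 'b::euclidean_space" and F :: "'a \<Rightarrow> 'c::euclidean_space"
  assumes "loc_int \<psi>" and [measurable]: "F \<in> borel_measurable borel"
    and "\<And>y. norm (F y) \<le> M * norm (\<psi> y)" "\<And>y. dist x y > r \<Longrightarrow> F y = 0"
  shows "integrable lborel F"
    and "norm (LINT y|lborel. F y) \<le> M * (LINT y|lborel. norm (indicator (cball x r) y *\<^sub>R \<psi> y))"
proof -
  let ?G = "\<lambda>y. M * norm (indicator (cball x r) y *\<^sub>R \<psi> y)"
  have G: "integrable lborel ?G"
    using loc_int_integrable_cball[OF assms(1)] by (intro integrable_mult_right integrable_norm)
  have FG: "norm (F y) \<le> ?G y" for y
    using assms(3)[of y] assms(4)[of y] by (cases "dist x y \<le> r") auto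
  show F: "integrable lborel F"
    by (rule Bochner_Integration.integrable_bound[OF G])
       (auto intro!: AE_I2 order_trans[OF FG] simp del: norm_scaleR)
  have "norm (LINT y|lborel. F y) \<le> (LINT y|lborel. ?G y)"
    by (rule Bochner_Integration.integral_norm_bound_integral[OF F G FG])
  then show "norm (LINT y|lborel. F y) \<le> M * (LINT y|lborel. norm (indicator (cball x r) y *\<^sub>R \<psi> y))"
    by simp
qed

definition conv :: "('a::euclidean_space \<Rightarrow> real) \<Rightarrow> ('a \<Rightarrow> 'b::euclidean_space) \<Rightarrow> 'a \<Rightarrow> 'b" where
  "conv k \<psi> x = (LINT y|lborel. k (x - y) *\<^sub>R \<psi> y)"

text \<open>
  Kernels may be vector valued, so that the mollifier and the inner products with its gradient
  are treated alike.
\<close>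

definition kernel :: "('a::euclidean_space \<Rightarrow> 'b::euclidean_space) \<Rightarrow> real \<Rightarrow> bool" where
  "kernel k e \<longleftrightarrow> continuous_on UNIV k \<and> (\<forall>z. e \<le> norm z \<longrightarrow> k z = 0)"

lemma kernel_measurable: "kernel k e \<Longrightarrow> k \<in> borel_measurable borel"
  by (simp add: kernel_def borel_measurable_continuous_onI)

lemma kernel_mollifier: "0 < e \<Longrightarrow> kernel (mollifier e) e"
  by (simp add: kernel_def continuous_mollifier mollifier_eq_0)

lemma kernel_mollifier_grad_inner: "0 < e \<Longrightarrow> kernel (\<lambda>z. mollifier_grad e z \<bullet> h) e"
  by (auto simp: kernel_def mollifier_grad_eq_0 intro!: continuous_intros continuous_mollifier_grad)

lemma kernel_integrable:
  assumes "kernel k e" "loc_int \<psi>"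
  shows "integrable lborel (\<lambda>y. k (x - y) *\<^sub>R \<psi> y)"
proof -
  obtain M where M: "0 \<le> M" "\<And>z. norm (k z) \<le> M"
    using continuous_vanishing_bounded[of k e] assms by (auto simp: kernel_def)
  note [measurable] = kernel_measurable[OF assms(1)] loc_int_measurable[OF assms(2)]
  show ?thesis
    by (rule loc_int_dominated(1)[OF assms(2), where M=M and r=e and x=x])
       (use M assms(1) in \<open>auto intro!: mult_right_mono simp: kernel_def dist_norm\<close>)
qed

lemma continuous_conv:
  fixes \<psi> :: "'a::euclidean_space \<Rightarrow> 'b::euclidean_space"
  assumes k: "kernel k e" and \<psi>: "loc_int \<psi>"
  shows "continuous_on UNIV (conv k \<psi>)"
  unfolding continuous_on_sequentially o_def
proof (intro ballI allI impI)
  fix X :: "nat \<Rightarrow> 'a" and a assume "(\<forall>n. X n \<in> UNIV) \<and> X \<longlonglongrightarrow> a"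
  then have X: "X \<longlonglongrightarrow> a" by simp
  obtain M where M: "0 \<le> M" "\<And>z. norm (k z) \<le> M"
    using continuous_vanishing_bounded[of k e] k by (auto simp: kernel_def)
  obtain B where B: "\<And>n. norm (X n) \<le> B"
    using convergent_imp_bounded[OF X] by (auto simp: bounded_iff)
  note [measurable] = kernel_measurable[OF k] loc_int_measurable[OF \<psi>]
  show "(\<lambda>n. conv k \<psi> (X n)) \<longlonglongrightarrow> conv k \<psi> a"
    unfolding conv_def
  proof (rule integral_dominated_convergence)
    show "integrable lborel (\<lambda>y. M * norm (indicator (cball 0 (B + e)) y *\<^sub>R \<psi> y))"
      by (intro integrable_mult_right integrable_norm loc_int_integrable_cball \<psi>)
    have "isCont k (a - y)" for y
      using k by (simp add: kernel_def continuous_on_eq_continuous_at)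
    then have "(\<lambda>n. k (X n - y)) \<longlonglongrightarrow> k (a - y)" for y
      using X by (intro isCont_tendsto_compose[where g=k] tendsto_intros)
    then show "AE y in lborel. (\<lambda>n. k (X n - y) *\<^sub>R \<psi> y) \<longlonglongrightarrow> k (a - y) *\<^sub>R \<psi> y"
      by (intro AE_I2 tendsto_intros)
    fix n
    show "AE y in lborel. norm (k (X n - y) *\<^sub>R \<psi> y) \<le> M * norm (indicator (cball 0 (B + e)) y *\<^sub>R \<psi> y)"
    proof (intro AE_I2)
      fix y show "norm (k (X n - y) *\<^sub>R \<psi> y) \<le> M * norm (indicator (cball 0 (B + e)) y *\<^sub>R \<psi> y)"
      proof (cases "norm (X n - y) \<ge> e")
        case True then show ?thesis using k M by (simp add: kernel_def)
      next
        case False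
        then have "norm y \<le> B + e" using B[of n] norm_triangle_ineq2[of y "X n"]
          by (simp add: norm_minus_commute)
        then show ?thesis using M by (simp add: mult_right_mono)
      qed
    qed
  qed measurable
qed

lemma conv_add_kernel:
  assumes "kernel k e" "kernel l e" "loc_int \<psi>"
  shows "conv (\<lambda>z. k z + l z) \<psi> x = conv k \<psi> x + conv l \<psi> x"
  unfolding conv_def scaleR_add_left
  by (rule Bochner_Integration.integral_add[OF kernel_integrable[OF assms(1,3)] kernel_integrable[OF assms(2,3)]])

lemma conv_scale_kernel:
  shows "conv (\<lambda>z. c * k z) \<psi> x = c *\<^sub>R conv k \<psi> x"
  unfolding conv_def by (simp flip: scaleR_scaleR)

text \<open>
  The remainder \<open>\<rho>(z + h) - \<rho>(z) - \<nabla>\<rho>(z) \<bullet> h\<close> is of order \<open>\<bar>h\<bar>\<^sup>2\<close> and, for \<open>\<bar>h\<bar> < e\<close>, supported in the ball of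
  radius \<open>2e\<close>, so its convolution with \<open>\<psi>\<close> is of order \<open>\<bar>h\<bar>\<^sup>2\<close> as well.
\<close>

theorem conv_has_derivative:
  fixes \<psi> :: "'a::euclidean_space \<Rightarrow> 'b::euclidean_space"
  assumes e: "0 < e" and \<psi>: "loc_int \<psi>"
  shows "(conv (mollifier e) \<psi> has_derivative (\<lambda>h. conv (\<lambda>z. mollifier_grad e z \<bullet> h) \<psi> x)) (at x)"
proof -
  obtain L where L: "0 \<le> L" "\<And>z h::'a. norm h \<le> e \<Longrightarrow>
      \<bar>mollifier e (z + h) - mollifier e z - mollifier_grad e z \<bullet> h\<bar> \<le> L * (norm h)\<^sup>2"
    using mollifier_taylor[OF e, where 'a='a] by blast
  note ker = kernel_integrable[OF kernel_mollifier[OF e] \<psi>]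
    kernel_integrable[OF kernel_mollifier_grad_inner[OF e] \<psi>]
  note [measurable] = loc_int_measurable[OF \<psi>]
  define K where "K = (LINT y|lborel. norm (indicator (cball x (2*e)) y *\<^sub>R \<psi> y))"
  let ?D = "\<lambda>h. conv (\<lambda>z. mollifier_grad e z \<bullet> h) \<psi> x"
  \<comment> \<open>the quadratic remainder, divided by the norm of the increment\<close>
  have est: "norm (conv (mollifier e) \<psi> y - conv (mollifier e) \<psi> x - ?D (y - x)) / norm (y - x)
        \<le> (L * K) * norm (y - x)" if "y \<noteq> x" "dist y x < e" for y
  proof -
    define h where "h = y - x"
    have h: "norm h < e" "y = x + h" "h \<noteq> 0" using that by (auto simp: h_def dist_norm)
    have "conv (mollifier e) \<psi> y - conv (mollifier e) \<psi> x - ?D h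
      = (LINT t|lborel. (mollifier e (x - t + h) - mollifier e (x - t) - mollifier_grad e (x - t) \<bullet> h) *\<^sub>R \<psi> t)"
    proof -
      have "(LINT t|lborel. mollifier e (y - t) *\<^sub>R \<psi> t - mollifier e (x - t) *\<^sub>R \<psi> t - (mollifier_grad e (x - t) \<bullet> h) *\<^sub>R \<psi> t)
        = conv (mollifier e) \<psi> y - conv (mollifier e) \<psi> x - ?D h"
        unfolding conv_def Bochner_Integration.integral_diff[OF Bochner_Integration.integrable_diff[OF ker(1) ker(1)] ker(2)]
          Bochner_Integration.integral_diff[OF ker(1) ker(1)] by (rule refl)
      moreover have "y - t = x - t + h" for t by (simp add: h(2))
      ultimately show ?thesis by (simp only: scaleR_diff_left)
    qed
    also have "norm \<dots> \<le> (L * (norm h)\<^sup>2) * (LINT y|lborel. norm (indicator (cball x (2*e)) y *\<^sub>R \<psi> y))"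
    proof (rule loc_int_dominated(2)[OF \<psi>])
      fix t
      show "norm ((mollifier e (x - t + h) - mollifier e (x - t) - mollifier_grad e (x - t) \<bullet> h) *\<^sub>R \<psi> t)
          \<le> L * (norm h)\<^sup>2 * norm (\<psi> t)"
        using L(2)[of h "x - t"] h by (auto intro!: mult_right_mono)
      assume "2 * e < dist x t"
      then have t: "2 * e < norm (x - t)" by (simp add: dist_norm)
      moreover have "norm (x - t) - norm h \<le> norm (x - t + h)" by (simp add: norm_diff_ineq)
      ultimately have "e \<le> norm (x - t)" "e \<le> norm (x - t + h)" using h e by auto
      then show "(mollifier e (x - t + h) - mollifier e (x - t) - mollifier_grad e (x - t) \<bullet> h) *\<^sub>R \<psi> t = 0"
        using e by (simp add: mollifier_eq_0 mollifier_grad_eq_0)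
    qed measurable
    finally have "norm (conv (mollifier e) \<psi> y - conv (mollifier e) \<psi> x - ?D h) \<le> (L * K * norm h) * norm h"
      by (simp add: K_def power2_eq_square mult_ac)
    then show ?thesis using h by (simp add: h_def[symmetric] divide_le_eq)
  qed
  have lin: "bounded_linear ?D"
  proof -
    have "linear ?D"
    proof (rule linearI)
      fix a b :: 'a
      show "?D (a + b) = ?D a + ?D b"
        unfolding inner_add_right
        by (rule conv_add_kernel[OF kernel_mollifier_grad_inner[OF e] kernel_mollifier_grad_inner[OF e] \<psi>])
    next
      fix c and a :: 'a
      show "?D (c *\<^sub>R a) = c *\<^sub>R ?D a"
        unfolding inner_scaleR_right by (rule conv_scale_kernel)
    qed
    then show ?thesis by (simp add: linear_conv_bounded_linear)
  qed
  show ?thesis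
  proof (rule has_derivativeI_sandwich[OF e lin])
    show "norm (conv (mollifier e) \<psi> y - conv (mollifier e) \<psi> x - ?D (y - x)) / norm (y - x)
        \<le> (L * K) * norm (y - x)" if "y \<noteq> x" "dist y x < e" for y by (rule est[OF that])
    have "((\<lambda>y. (L * K) * norm (y - x)) \<longlongrightarrow> (L * K) * norm (x - x)) (at x)"
      by (intro tendsto_intros)
    then show "((\<lambda>y. (L * K) * norm (y - x)) \<longlongrightarrow> 0) (at x)" by simp
  qed
qed

lemma conv_differentiable:
  assumes "0 < e" "loc_int \<psi>" shows "conv (mollifier e) \<psi> differentiable (at x)"
  using conv_has_derivative[OF assms] by (rule differentiableI)

lemma frechet_derivative_conv:
  assumes "0 < e" "loc_int \<psi>"
  shows "frechet_derivative (conv (mollifier e) \<psi>) (at x) h = conv (\<lambda>z. mollifier_grad e z \<bullet> h) \<psi> x"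
  by (simp flip: frechet_derivative_at[OF conv_has_derivative[OF assms], of x])

lemma Ck1_conv:
  assumes "0 < e" "loc_int \<psi>" shows "Ck 1 (conv (mollifier e) \<psi>)"
  unfolding One_nat_def Ck.simps frechet_derivative_conv[OF assms]
  using conv_differentiable[OF assms] continuous_conv[OF kernel_mollifier_grad_inner[OF assms(1)] assms(2)]
  by simp

lemma divergence_conv:
  fixes \<psi> :: "'a::euclidean_space \<Rightarrow> 'a"
  assumes e: "0 < e" and \<psi>: "loc_int \<psi>"
  shows "divergence (conv (mollifier e) \<psi>) x = (LINT y|lborel. mollifier_grad e (x - y) \<bullet> \<psi> y)"
proof -
  have int: "integrable lborel (\<lambda>y. (mollifier_grad e (x - y) \<bullet> b) *\<^sub>R \<psi> y)" for b
    by (rule kernel_integrable[OF kernel_mollifier_grad_inner[OF e] \<psi>])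
  have "divergence (conv (mollifier e) \<psi>) x = (\<Sum>b\<in>Basis. conv (\<lambda>z. mollifier_grad e z \<bullet> b) \<psi> x \<bullet> b)"
    using conv_differentiable[OF assms] by (simp add: divergence_def frechet_derivative_conv[OF assms])
  also have "\<dots> = (\<Sum>b\<in>Basis. LINT y|lborel. (mollifier_grad e (x - y) \<bullet> b) * (\<psi> y \<bullet> b))"
    unfolding conv_def
    by (intro sum.cong refl, subst integral_inner_left[symmetric]) (use int in simp_all)
  also have "\<dots> = (LINT y|lborel. (\<Sum>b\<in>Basis. (mollifier_grad e (x - y) \<bullet> b) * (\<psi> y \<bullet> b)))"
    by (rule Bochner_Integration.integral_sum[symmetric])
       (use integrable_inner_left[OF int] in simp)
  also have "\<dots> = (LINT y|lborel. mollifier_grad e (x - y) \<bullet> \<psi> y)"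
    by (simp only: euclidean_inner[symmetric])
  finally show ?thesis .
qed

text \<open>
  The gradient of the mollified scalar function, written as a vector-valued integral.
\<close>

definition moll_gradient :: "real \<Rightarrow> ('a::euclidean_space \<Rightarrow> real) \<Rightarrow> 'a \<Rightarrow> 'a" where
  "moll_gradient e f x = (LINT y|lborel. f y *\<^sub>R mollifier_grad e (x - y))"

lemma moll_gradient_integrable:
  assumes e: "0 < e" and f: "loc_int f"
  shows "integrable lborel (\<lambda>y. f y *\<^sub>R mollifier_grad e (x - y))"
proof -
  obtain M where M: "0 \<le> M" "\<And>z::'a. norm (mollifier_grad e z) \<le> M"
    using continuous_vanishing_bounded[of "mollifier_grad e :: 'a \<Rightarrow> 'a" e, OF continuous_mollifier_grad mollifier_grad_eq_0[OF e]]
    by blast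
  note [measurable] = loc_int_measurable[OF f]
  show ?thesis
  proof (rule loc_int_dominated(1)[OF f, where M=M and r=e and x=x])
    fix y
    show "norm (f y *\<^sub>R mollifier_grad e (x - y)) \<le> M * norm (f y)"
      using mult_right_mono[OF M(2)[of "x - y"], of "norm (f y)"] by (simp add: mult.commute)
    show "e < dist x y \<Longrightarrow> f y *\<^sub>R mollifier_grad e (x - y) = 0"
      using e by (simp add: mollifier_grad_eq_0 dist_norm)
  qed measurable
qed

lemma moll_gradient_inner:
  assumes e: "0 < e" and f: "loc_int f"
  shows "moll_gradient e f x \<bullet> h = conv (\<lambda>z. mollifier_grad e z \<bullet> h) f x"
  unfolding moll_gradient_def conv_def
  by (subst integral_inner_left[symmetric]) (use moll_gradient_integrable[OF assms, of x] in \<open>simp_all add: mult.commute\<close>)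

lemma conv_has_derivative_moll_gradient:
  assumes "0 < e" "loc_int f"
  shows "(conv (mollifier e) f has_derivative (\<lambda>h. moll_gradient e f x \<bullet> h)) (at x)"
  unfolding moll_gradient_inner[OF assms] by (rule conv_has_derivative[OF assms])

lemma continuous_moll_gradient:
  assumes "0 < e" "loc_int f" shows "continuous_on UNIV (moll_gradient e f)"
  by (subst continuous_on_componentwise)
     (simp add: moll_gradient_inner[OF assms] continuous_conv[OF kernel_mollifier_grad_inner[OF assms(1)] assms(2)])

text \<open>
  The pointwise domination \<open>\<bar>\<rho> * \<psi>\<bar> \<le> \<rho> * u\<close>, with an extended real right-hand side because weights
  may take the value \<open>\<infinity>\<close>.
\<close>

lemma conv_norm_bound:
  assumes [measurable]: "\<psi> \<in> borel_measurable borel" "u \<in> borel_measurable borel"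
    and "0 < e" "loc_int \<psi>" "\<And>y. ennreal (norm (\<psi> y)) \<le> u y"
  shows "ennreal (norm (conv (mollifier e) \<psi> x)) \<le> (\<integral>\<^sup>+y. ennreal (mollifier e (x - y)) * u y \<partial>lborel)"
proof -
  have "ennreal (norm (conv (mollifier e) \<psi> x)) \<le> (\<integral>\<^sup>+y. norm (mollifier e (x - y) *\<^sub>R \<psi> y) \<partial>lborel)"
    unfolding conv_def
    by (rule integral_norm_bound_ennreal) (intro kernel_integrable[OF kernel_mollifier[OF assms(3)] assms(4)])
  also have "\<dots> \<le> (\<integral>\<^sup>+y. ennreal (mollifier e (x - y)) * u y \<partial>lborel)"
    using assms(5) by (intro nn_integral_mono) (auto simp: ennreal_mult' mollifier_nonneg intro!: mult_left_mono)
  finally show ?thesis .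
qed

lemma nn_integral_mollifier_reflect:
  assumes "0 < e" shows "(\<integral>\<^sup>+y. ennreal (mollifier e (x - y)) \<partial>lborel) = 1"
  using nn_integral_reflect[of "\<lambda>z. ennreal (mollifier e z)" x] nn_integral_mollifier[OF assms]
  by simp

lemma conv_norm_le_const:
  assumes "0 < e" "loc_int \<psi>" "\<And>y. norm (\<psi> y) \<le> c"
  shows "norm (conv (mollifier e) \<psi> x) \<le> c"
proof -
  have c: "0 \<le> c" using assms(3) norm_ge_zero order_trans by blast
  have "ennreal (norm (conv (mollifier e) \<psi> x)) \<le> (\<integral>\<^sup>+y. ennreal (mollifier e (x - y)) * ennreal c \<partial>lborel)"
    by (rule conv_norm_bound) (use assms in \<open>auto simp: loc_int_def ennreal_leI\<close>)
  also have "\<dots> = ennreal c"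
    by (subst nn_integral_multc) (simp_all add: nn_integral_mollifier_reflect[OF assms(1)])
  finally show ?thesis using c by simp
qed

lemma conv_eq_0:
  assumes "0 < e" "\<And>y. \<psi> y \<noteq> 0 \<Longrightarrow> y \<in> K" "x \<notin> (\<Union>y\<in>K. ball y e)"
  shows "conv (mollifier e) \<psi> x = 0"
proof -
  have "mollifier e (x - y) *\<^sub>R \<psi> y = 0" for y
    using assms(2)[of y] assms(3) mollifier_eq_0[OF assms(1), of "x - y"]
    by (cases "\<psi> y = 0") (auto simp: dist_norm norm_minus_commute not_less)
  then show ?thesis by (simp only: conv_def Bochner_Integration.integral_zero)
qed

lemma compact_support_in_conv:
  fixes \<psi> :: "'a::euclidean_space \<Rightarrow> 'b::euclidean_space"
  assumes K: "compact K" "\<And>y. \<psi> y \<noteq> 0 \<Longrightarrow> y \<in> K" and e: "0 < e" "(\<Union>y\<in>K. cball y e) \<subseteq> U"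
  shows "compact_support_in (conv (mollifier e) \<psi>) U"
proof -
  let ?T = "{y + z |y z. y \<in> K \<and> z \<in> cball (0::'a) e}"
  have T: "compact ?T" by (intro compact_sums K compact_cball)
  have "{x. conv (mollifier e) \<psi> x \<noteq> 0} \<subseteq> ?T"
  proof
    fix x assume "x \<in> {x. conv (mollifier e) \<psi> x \<noteq> 0}"
    then obtain y where y: "y \<in> K" "x \<in> ball y e"
      using conv_eq_0[OF e(1), of \<psi> K x] K(2) by auto
    then have "x = y + (x - y)" "x - y \<in> cball 0 e" by (auto simp: dist_norm norm_minus_commute)
    then show "x \<in> ?T" using y(1) by blast
  qed
  then have sub: "closure {x. conv (mollifier e) \<psi> x \<noteq> 0} \<subseteq> ?T"
    using T by (intro closure_minimal compact_imp_closed)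
  have "?T \<subseteq> (\<Union>y\<in>K. cball y e)" by (force simp: dist_norm)
  then have "?T \<subseteq> U" using e(2) by (rule order_trans)
  moreover have "compact (closure {x. conv (mollifier e) \<psi> x \<noteq> 0})"
    using bounded_subset[OF compact_imp_bounded[OF T] sub] by (simp add: compact_eq_bounded_closed)
  ultimately show ?thesis using sub by (auto simp: compact_support_in_def)
qed

lemma loc_int_bounded_measurable:
  fixes \<psi> :: "'a::euclidean_space \<Rightarrow> 'b::euclidean_space"
  assumes [measurable]: "\<psi> \<in> borel_measurable borel" and "\<And>y. norm (\<psi> y) \<le> M"
  shows "loc_int \<psi>"
  unfolding loc_int_def
proof (intro conjI allI assms(1))
  fix r
  have "integrable lborel (\<lambda>y. M * indicator (cball (0::'a) r) y)"
    by (intro integrable_mult_right integrable_real_indicator) (use emeasure_bounded_finite[OF bounded_cball] in \<open>auto simp: less_top\<close>)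
  then show "integrable lborel (\<lambda>y. indicator (cball 0 r) y *\<^sub>R \<psi> y)"
    by (rule Bochner_Integration.integrable_bound)
       (use order_trans[OF assms(2) abs_ge_self] in \<open>auto simp: indicator_def\<close>)
qed

lemma loc_int_continuous:
  fixes \<psi> :: "'a::euclidean_space \<Rightarrow> 'b::euclidean_space"
  assumes "continuous_on UNIV \<psi>"
  shows "loc_int \<psi>"
  unfolding loc_int_def
  by (auto intro!: borel_measurable_continuous_onI assms borel_integrable_compact continuous_on_subset[OF assms])

section \<open>Convergence of mollifications in the mean\<close>

text \<open>
  Membership in the \<open>L\<^sup>1\<close> closure of the continuous integrable functions.
\<close>

definition L1_approximable :: "('a::euclidean_space \<Rightarrow> real) \<Rightarrow> bool" where
  "L1_approximable h \<longleftrightarrow> (\<forall>\<eta>>0. \<exists>g. continuous_on UNIV g \<and> integrable lborel g \<and>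
     (\<integral>\<^sup>+x. norm (h x - g x) \<partial>lborel) < ennreal \<eta>)"

text \<open>
  Squeeze the set between a closed and an open set whose difference has small measure, and take a
  Urysohn function for this pair.
\<close>

lemma L1_approximable_indicator:
  fixes A :: "'a::euclidean_space set"
  assumes A: "A \<in> sets borel" "emeasure lborel A < \<infinity>"
  shows "L1_approximable (\<lambda>x. indicator A x *\<^sub>R c)"
  unfolding L1_approximable_def
proof (intro allI impI)
  fix \<eta> :: real assume \<eta>: "0 < \<eta>"
  \<comment> \<open>the error will be at most \<open>2 \<bar>c\<bar> \<delta> < \<eta>\<close>, also for \<open>c = 0\<close>\<close>
  define \<delta> where "\<delta> = \<eta> / (2 * (\<bar>c\<bar> + 1))"
  have \<delta>: "0 < \<delta>" using \<eta> by (simp add: \<delta>_def)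
  obtain U where U: "open U" "A \<subseteq> U" "emeasure lborel (U - A) < \<delta>"
    using outer_regular_lborel[OF A(1) \<delta>] .
  have "- A \<in> sets borel" using A(1) by auto
  from outer_regular_lborel[OF this \<delta>]
  obtain V where V: "open V" "- A \<subseteq> V" "emeasure lborel (V - - A) < \<delta>" .
  have [measurable]: "U \<in> sets borel" "V \<in> sets borel" "A \<in> sets borel" using U V A by auto
  obtain g :: "'a \<Rightarrow> real" where g: "continuous_on UNIV g" "\<And>x. g x \<in> closed_segment 0 1"
      "\<And>x. x \<in> - U \<Longrightarrow> g x = 0" "\<And>x. x \<in> - V \<Longrightarrow> g x = 1"
    using Urysohn[of "- U" "- V" "0::real" 1] U V by blast
  then have g01: "0 \<le> g x" "g x \<le> 1" for x by (auto simp: closed_segment_eq_real_ivl split: if_splits)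
  have [measurable]: "g \<in> borel_measurable borel" by (intro borel_measurable_continuous_onI g(1))
  have *: "norm (indicator A x *\<^sub>R c - c * g x) \<le> \<bar>c\<bar> * (indicator (U - A) x + indicator (V - - A) x)" for x
  proof -
    have "\<bar>indicator A x - g x\<bar> \<le> indicator (U - A) x + indicator (V - - A) x"
      using g01[of x] g(3,4)[of x] U(2) V(2) by (auto simp: indicator_def)
    then have "\<bar>c\<bar> * \<bar>indicator A x - g x\<bar> \<le> \<bar>c\<bar> * (indicator (U - A) x + indicator (V - - A) x)"
      by (intro mult_left_mono) auto
    then show ?thesis by (simp add: abs_mult[symmetric] algebra_simps)
  qed
  have "emeasure lborel U = emeasure lborel (A \<union> (U - A))" using U(2) by (simp add: Un_absorb1)
  also have "\<dots> \<le> emeasure lborel A + emeasure lborel (U - A)" by (rule emeasure_subadditive) auto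
  also have "\<dots> < \<infinity>" using A(2) U(3) by (simp add: less_top order_less_trans[OF _ ennreal_less_top])
  finally have fin: "emeasure lborel U < \<infinity>" .
  have int: "integrable lborel g"
  proof (rule Bochner_Integration.integrable_bound)
    show "integrable lborel (indicator U :: 'a \<Rightarrow> real)" using fin by (intro integrable_real_indicator) auto
    show "AE x in lborel. norm (g x) \<le> norm (indicator U x :: real)"
      using g01 g(3) by (auto simp: indicator_def)
  qed simp
  have "(\<integral>\<^sup>+x. norm (indicator A x *\<^sub>R c - c * g x) \<partial>lborel)
     \<le> (\<integral>\<^sup>+x. ennreal \<bar>c\<bar> * (indicator (U - A) x + indicator (V - - A) x) \<partial>lborel)"
  proof (rule nn_integral_mono)
    fix x
    have "ennreal \<bar>c\<bar> * (indicator (U - A) x + indicator (V - - A) x) = ennreal (\<bar>c\<bar> * (indicator (U - A) x + indicator (V - - A) x))"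
      by (auto simp: indicator_def ennreal_mult'' simp flip: ennreal_plus)
    then show "ennreal (norm (indicator A x *\<^sub>R c - c * g x)) \<le> ennreal \<bar>c\<bar> * (indicator (U - A) x + indicator (V - - A) x)"
      using ennreal_leI[OF *[of x]] by simp
  qed
  also have "\<dots> = ennreal \<bar>c\<bar> * (emeasure lborel (U - A) + emeasure lborel (V - - A))"
    by (subst nn_integral_cmult) (auto simp: nn_integral_add)
  also have "\<dots> \<le> ennreal \<bar>c\<bar> * (ennreal \<delta> + ennreal \<delta>)"
    using U(3) V(3) by (intro mult_left_mono add_mono) auto
  also have "\<dots> = ennreal (\<bar>c\<bar> * (2 * \<delta>))" using \<delta> by (simp add: ennreal_mult flip: ennreal_plus)
  also have "\<dots> < ennreal \<eta>"
  proof (rule ennreal_lessI[OF \<eta>])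
    have "\<bar>c\<bar> * (2 * \<delta>) = \<eta> * (\<bar>c\<bar> / (\<bar>c\<bar> + 1))" by (simp add: \<delta>_def field_simps)
    also have "\<dots> < \<eta> * 1" using \<eta> by (intro mult_strict_left_mono) (auto simp: field_simps)
    finally show "\<bar>c\<bar> * (2 * \<delta>) < \<eta>" by simp
  qed
  finally show "\<exists>g. continuous_on UNIV g \<and> integrable lborel g \<and> (\<integral>\<^sup>+x. norm (indicator A x *\<^sub>R c - g x) \<partial>lborel) < ennreal \<eta>"
    using int g(1) by (intro exI[of _ "\<lambda>x. c * g x"]) (auto intro!: continuous_intros)
qed

lemma L1_approximable_near:
  fixes h :: "'a::euclidean_space \<Rightarrow> real"
  assumes [measurable]: "h \<in> borel_measurable borel"
    and "\<And>\<eta>::real. 0 < \<eta> \<Longrightarrow> \<exists>k. k \<in> borel_measurable borel \<and> L1_approximable k \<and>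
       (\<integral>\<^sup>+x. norm (h x - k x) \<partial>lborel) < ennreal \<eta>"
  shows "L1_approximable h"
  unfolding L1_approximable_def
proof (intro allI impI)
  fix \<eta> :: real assume \<eta>: "0 < \<eta>"
  obtain k where k[measurable]: "k \<in> borel_measurable borel" and "L1_approximable k"
    and hk: "(\<integral>\<^sup>+x. norm (h x - k x) \<partial>lborel) < ennreal (\<eta>/2)"
    using assms(2)[of "\<eta>/2"] \<eta> by auto
  then obtain g where g: "continuous_on UNIV g" "integrable lborel g"
     and kg: "(\<integral>\<^sup>+x. norm (k x - g x) \<partial>lborel) < ennreal (\<eta>/2)"
    unfolding L1_approximable_def using \<eta> by (meson half_gt_zero)
  have [measurable]: "g \<in> borel_measurable borel" by (intro borel_measurable_continuous_onI g(1))
  have "(\<integral>\<^sup>+x. norm (h x - g x) \<partial>lborel) \<le> (\<integral>\<^sup>+x. ennreal (norm (h x - k x)) + ennreal (norm (k x - g x)) \<partial>lborel)"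
    by (intro nn_integral_mono) (auto simp flip: ennreal_plus intro!: ennreal_leI)
  also have "\<dots> = (\<integral>\<^sup>+x. norm (h x - k x) \<partial>lborel) + (\<integral>\<^sup>+x. norm (k x - g x) \<partial>lborel)"
    by (rule nn_integral_add) auto
  also have "\<dots> < ennreal (\<eta>/2) + ennreal (\<eta>/2)"
    by (rule add_strict_mono[OF hk kg])
  also have "\<dots> = ennreal \<eta>" using \<eta> by (simp flip: ennreal_plus)
  finally show "\<exists>g. continuous_on UNIV g \<and> integrable lborel g \<and> (\<integral>\<^sup>+x. norm (h x - g x) \<partial>lborel) < ennreal \<eta>"
    using g by blast
qed

lemma integrable_L1_approximable:
  fixes h :: "'a::euclidean_space \<Rightarrow> real"
  assumes "integrable lborel h" shows "L1_approximable h"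
  using assms
proof (induction rule: integrable_induct)
  case (base A c)
  then show ?case by (intro L1_approximable_indicator) auto
next
  case (add f g)
  then have [measurable]: "f \<in> borel_measurable borel" "g \<in> borel_measurable borel"
    using borel_measurable_integrable[OF add.hyps(1)] borel_measurable_integrable[OF add.hyps(2)] by simp_all
  show ?case unfolding L1_approximable_def
  proof (intro allI impI)
    fix \<eta> :: real assume \<eta>: "0 < \<eta>"
    then have "0 < \<eta>/2" by simp
    then obtain f' g' where f': "continuous_on UNIV f'" "integrable lborel f'" "(\<integral>\<^sup>+x. norm (f x - f' x) \<partial>lborel) < ennreal (\<eta>/2)"
      and g': "continuous_on UNIV g'" "integrable lborel g'" "(\<integral>\<^sup>+x. norm (g x - g' x) \<partial>lborel) < ennreal (\<eta>/2)"
      using add.IH unfolding L1_approximable_def by meson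
    have [measurable]: "f' \<in> borel_measurable borel" "g' \<in> borel_measurable borel"
      by (intro borel_measurable_continuous_onI f'(1) g'(1))+
    have "(\<integral>\<^sup>+x. norm (f x + g x - (f' x + g' x)) \<partial>lborel) \<le> (\<integral>\<^sup>+x. ennreal (norm (f x - f' x)) + ennreal (norm (g x - g' x)) \<partial>lborel)"
      by (intro nn_integral_mono) (auto simp flip: ennreal_plus intro!: ennreal_leI)
    also have "\<dots> = (\<integral>\<^sup>+x. norm (f x - f' x) \<partial>lborel) + (\<integral>\<^sup>+x. norm (g x - g' x) \<partial>lborel)"
      by (rule nn_integral_add) auto
    also have "\<dots> < ennreal (\<eta>/2) + ennreal (\<eta>/2)"
      by (rule add_strict_mono[OF f'(3) g'(3)])
    also have "\<dots> = ennreal \<eta>" using \<eta> by (simp flip: ennreal_plus)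
    finally show "\<exists>k. continuous_on UNIV k \<and> integrable lborel k \<and> (\<integral>\<^sup>+x. norm (f x + g x - k x) \<partial>lborel) < ennreal \<eta>"
      using f' g' by (intro exI[of _ "\<lambda>x. f' x + g' x"]) (auto intro!: continuous_intros)
  qed
next
  case (lim f s)
  have [measurable]: "f \<in> borel_measurable borel" "\<And>i. s i \<in> borel_measurable borel"
    using borel_measurable_integrable[OF lim.hyps(4)] borel_measurable_integrable[OF lim.hyps(1)] by simp_all
  have "(\<lambda>i. \<integral>\<^sup>+x. norm (f x - s i x) \<partial>lborel) \<longlonglongrightarrow> 0"
  proof (rule nn_integral_dominated_convergence_norm)
    show "AE x in lborel. norm (s j x) \<le> 2 * norm (f x)" for j using lim.hyps(3) by (intro AE_I2) simp
    show "(\<integral>\<^sup>+x. ennreal (2 * norm (f x)) \<partial>lborel) < \<infinity>"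
      using lim.hyps(4) unfolding integrable_iff_bounded
      by (simp add: ennreal_mult nn_integral_cmult ennreal_mult_less_top)
    show "AE x in lborel. (\<lambda>i. s i x) \<longlonglongrightarrow> f x" using lim.hyps(2) by (intro AE_I2) simp
  qed auto
  then have "\<forall>\<^sub>F i in sequentially. (\<integral>\<^sup>+x. norm (f x - s i x) \<partial>lborel) < ennreal \<eta>" if "0 < \<eta>" for \<eta>
    using that by (intro order_tendstoD) auto
  then have "\<exists>i. (\<integral>\<^sup>+x. norm (f x - s i x) \<partial>lborel) < ennreal \<eta>" if "0 < \<eta>" for \<eta>
    using eventually_happens'[OF sequentially_bot] that by blast
  then have "\<exists>k. k \<in> borel_measurable borel \<and> L1_approximable k \<and> (\<integral>\<^sup>+x. norm (f x - k x) \<partial>lborel) < ennreal \<eta>"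
    if "0 < \<eta>" for \<eta> using that lim.IH \<open>\<And>i. s i \<in> borel_measurable borel\<close> by blast
  then show ?case by (rule L1_approximable_near[OF \<open>f \<in> borel_measurable borel\<close>])
qed

lemma conv_diff:
  assumes "kernel k e" "loc_int \<psi>" "loc_int \<phi>"
  shows "conv k (\<lambda>y. \<psi> y - \<phi> y) x = conv k \<psi> x - conv k \<phi> x"
  unfolding conv_def scaleR_diff_right
  by (rule Bochner_Integration.integral_diff[OF kernel_integrable[OF assms(1,2)] kernel_integrable[OF assms(1,3)]])

lemma conv_const:
  assumes "0 < e" shows "conv (mollifier e) (\<lambda>y. c) x = c"
proof -
  have "conv (mollifier e) (\<lambda>y. c) x = (LINT y|lborel. mollifier e (x - y)) *\<^sub>R c"
    unfolding conv_def
    by (rule integral_scaleR_left)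
       (use kernel_integrable[OF kernel_mollifier[OF assms] loc_int_continuous[of "\<lambda>_. 1::real"], of x] in auto)
  also have "(LINT y|lborel. mollifier e (x - y)) = 1"
    using integral_reflect[of "mollifier e" x] integral_mollifier[OF assms] by simp
  finally show ?thesis by simp
qed

lemma conv_cong_local:
  assumes "0 < e" "\<And>y. dist x y < e \<Longrightarrow> \<psi> y = \<phi> y"
  shows "conv (mollifier e) \<psi> x = conv (mollifier e) \<phi> x"
proof -
  have "mollifier e (x - y) *\<^sub>R \<psi> y = mollifier e (x - y) *\<^sub>R \<phi> y" for y
    using assms(2)[of y] mollifier_eq_0[OF assms(1), of "x - y"]
    by (cases "dist x y < e") (auto simp: dist_norm)
  then show ?thesis by (simp only: conv_def)
qed

text \<open>
  Since the mollifier has integral \<open>1\<close>, \<open>\<rho> * g - g(x)\<close> at \<open>x\<close> is the mollification of \<open>g - g(x)\<close>,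
  which only sees the ball of radius \<open>e\<close>.
\<close>

lemma conv_near:
  fixes g :: "'a::euclidean_space \<Rightarrow> 'b::euclidean_space"
  assumes e: "0 < e" and g: "loc_int g" and c: "\<And>y. dist x y < e \<Longrightarrow> norm (g y - g x) \<le> c"
  shows "norm (conv (mollifier e) g x - g x) \<le> c"
proof -
  note [measurable] = loc_int_measurable[OF g]
  have c0: "0 \<le> c" using c[of x] e by simp
  have cst: "loc_int (\<lambda>y. g x)" by (intro loc_int_continuous) auto
  let ?\<psi> = "\<lambda>y. indicator (ball x e) y *\<^sub>R (g y - g x)"
  have b: "norm (?\<psi> y) \<le> c" for y using c[of y] c0 by (simp add: indicator_def)
  have "ball x e \<in> sets borel" by simp
  then have "loc_int ?\<psi>"
    using b by (intro loc_int_bounded_measurable[where M=c] borel_measurable_scaleR borel_measurable_indicator) auto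
  have "conv (mollifier e) g x - g x = conv (mollifier e) (\<lambda>y. g y - g x) x"
    using conv_diff[OF kernel_mollifier[OF e] g cst] conv_const[OF e, of "g x" x] by simp
  also have "\<dots> = conv (mollifier e) ?\<psi> x"
    by (rule conv_cong_local[OF e]) simp
  finally show ?thesis
    using conv_norm_le_const[OF e \<open>loc_int ?\<psi>\<close> b, of x] by simp
qed

lemma loc_int_integrable:
  assumes "integrable lborel h" shows "loc_int h"
proof -
  have "h \<in> borel_measurable borel" using borel_measurable_integrable[OF assms] by simp
  moreover have "integrable lborel (\<lambda>y. indicator (cball 0 r) y *\<^sub>R h y)" for r
    using assms by (intro integrable_mult_indicator) auto
  ultimately show ?thesis by (simp add: loc_int_def)
qed

lemma conv_L1_contraction:
  fixes h :: "'a::euclidean_space \<Rightarrow> 'b::euclidean_space"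
  assumes e: "0 < e" and h: "loc_int h"
  shows "(\<integral>\<^sup>+x. norm (conv (mollifier e) h x) \<partial>lborel) \<le> (\<integral>\<^sup>+y. norm (h y) \<partial>lborel)"
proof -
  note [measurable] = loc_int_measurable[OF h]
  have "(\<integral>\<^sup>+x. norm (conv (mollifier e) h x) \<partial>lborel)
     \<le> (\<integral>\<^sup>+x. (\<integral>\<^sup>+y. ennreal (mollifier e (x - y)) * norm (h y) \<partial>lborel) \<partial>lborel)"
    by (intro nn_integral_mono conv_norm_bound e h) auto
  also have "\<dots> = (\<integral>\<^sup>+y. (\<integral>\<^sup>+x. ennreal (mollifier e (x - y)) * norm (h y) \<partial>lborel) \<partial>lborel)"
    by (rule lborel_pair.Fubini') simp
  also have "\<dots> = (\<integral>\<^sup>+y. norm (h y) \<partial>lborel)"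
  proof (rule nn_integral_cong)
    fix y :: 'a
    have "(\<integral>\<^sup>+x. ennreal (mollifier e (x - y)) * norm (h y) \<partial>lborel)
        = (\<integral>\<^sup>+x. ennreal (mollifier e (y - x)) \<partial>lborel) * norm (h y)"
      by (subst nn_integral_multc[symmetric])
         (auto intro!: nn_integral_cong simp: mollifier_norm_cong[OF norm_minus_commute])
    then show "(\<integral>\<^sup>+x. ennreal (mollifier e (x - y)) * norm (h y) \<partial>lborel) = norm (h y)"
      by (simp add: nn_integral_mollifier_reflect[OF e])
  qed
  finally show ?thesis .
qed

text \<open>
  For parameters below \<open>1\<close>, on the ball of radius \<open>R\<close> only the values of \<open>f\<close> on the ball of radius
  \<open>R + 1\<close> matter. There \<open>f\<close> is
  approximated in \<open>L\<^sup>1\<close> by a continuous \<open>g\<close>; mollification does not increase the \<open>L\<^sup>1\<close> distance, and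
  \<open>g\<close> is uniformly continuous on the larger ball.
\<close>

theorem conv_tendsto_L1_loc:
  fixes f :: "'a::euclidean_space \<Rightarrow> real"
  assumes f: "loc_int f" and e: "\<And>m. 0 < e m" "e \<longlonglongrightarrow> 0"
  shows "(\<lambda>m. \<integral>\<^sup>+x\<in>cball 0 R. norm (conv (mollifier (e m)) f x - f x) \<partial>lborel) \<longlonglongrightarrow> 0"
proof (rule tendsto_zero_ennreal)
  fix \<eta> :: real assume \<eta>: "0 < \<eta>"
  let ?h = "\<lambda>x. indicator (cball 0 (R + 1)) x *\<^sub>R f x"
  have h: "integrable lborel ?h" by (rule loc_int_integrable_cball[OF f])
  obtain g where g: "continuous_on UNIV g" "integrable lborel g"
      and hg: "(\<integral>\<^sup>+x. norm (?h x - g x) \<partial>lborel) < ennreal (\<eta>/3)"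
    using integrable_L1_approximable[OF h] \<eta> unfolding L1_approximable_def
    by (metis divide_pos_pos zero_less_numeral)
  have gl: "loc_int g" and hl: "loc_int ?h" by (rule loc_int_integrable[OF g(2)], rule loc_int_integrable[OF h])
  note [measurable] = loc_int_measurable[OF gl] loc_int_measurable[OF hl] loc_int_measurable[OF f]
  have [measurable]: "conv (mollifier d) k \<in> borel_measurable borel" if "0 < d" "loc_int k" for d and k :: "'a \<Rightarrow> real"
    by (intro borel_measurable_continuous_onI continuous_conv[OF kernel_mollifier] that)
  have [measurable]: "cball (0::'a) R \<in> sets borel" by simp
  define V where "V = measure lborel (cball (0::'a) R)"
  have V: "emeasure lborel (cball (0::'a) R) = ennreal V" "0 \<le> V"
    unfolding V_def using emeasure_bounded_finite[OF bounded_cball, of "0::'a" R]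
    by (simp_all add: emeasure_eq_ennreal_measure)
  define A where "A = (\<integral>\<^sup>+x. norm (?h x - g x) \<partial>lborel)"
  obtain a where a: "0 \<le> a" "A = ennreal a" "a < \<eta>/3"
    using hg \<eta> unfolding A_def[symmetric] by (cases A) (auto simp: ennreal_less_iff)
  \<comment> \<open>a uniform error \<open>c\<close> on the ball of volume \<open>V\<close> contributes at most \<open>\<eta>/3\<close>\<close>
  define c where "c = \<eta> / (3 * (V + 1))"
  have c: "0 < c" using \<eta> V by (simp add: c_def)
  have "uniformly_continuous_on (cball 0 (R+1)) g"
    by (intro compact_uniformly_continuous continuous_on_subset[OF g(1)]) auto
  then obtain d where d: "0 < d" "\<And>x y. x \<in> cball 0 (R+1) \<Longrightarrow> y \<in> cball 0 (R+1) \<Longrightarrow> dist y x < d \<Longrightarrow> dist (g y) (g x) < c"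
    unfolding uniformly_continuous_on_def using c by metis
  have "\<forall>\<^sub>F m in sequentially. e m < min d 1"
    using e(2) d(1) by (intro order_tendstoD) auto
  then show "\<forall>\<^sub>F m in sequentially. (\<integral>\<^sup>+x\<in>cball 0 R. norm (conv (mollifier (e m)) f x - f x) \<partial>lborel) < ennreal \<eta>"
  proof eventually_elim
    case (elim m)
    let ?C = "conv (mollifier (e m))"
    have pt: "ennreal (norm (?C f x - f x)) * indicator (cball 0 R) x
       \<le> ennreal (norm (?C (\<lambda>y. ?h y - g y) x)) + (ennreal c * indicator (cball 0 R) x + ennreal (norm (?h x - g x)))" for x
    proof (cases "x \<in> cball 0 R")
      case True
      have near: "y \<in> cball 0 (R+1)" if "dist x y < e m" for y
        using True that elim norm_triangle_ineq2[of y x] by (auto simp: dist_norm norm_minus_commute)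
      have xin: "x \<in> cball 0 (R+1)" using True by auto
      have 1: "?C f x = ?C ?h x"
        by (rule conv_cong_local[OF e(1)]) (use near in auto)
      have 2: "norm (?C g x - g x) \<le> c"
        by (rule conv_near[OF e(1) gl]) (use d(2)[OF xin near] elim in \<open>force simp: dist_norm norm_minus_commute intro: less_imp_le\<close>)
      have 3: "?C (\<lambda>y. ?h y - g y) x = ?C ?h x - ?C g x"
        by (rule conv_diff[OF kernel_mollifier[OF e(1)] hl gl])
      have "norm (?C f x - f x) \<le> norm (?C (\<lambda>y. ?h y - g y) x) + (c + norm (?h x - g x))"
        using 2 xin unfolding 1 3 by (simp add: abs_if split: if_splits)
      then have "ennreal (norm (?C f x - f x)) \<le> ennreal (norm (?C (\<lambda>y. ?h y - g y) x) + (c + norm (?h x - g x)))"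
        by (rule ennreal_leI)
      also have "\<dots> = ennreal (norm (?C (\<lambda>y. ?h y - g y) x)) + (ennreal c + ennreal (norm (?h x - g x)))"
        using c by (subst ennreal_plus; (subst ennreal_plus)?; simp)
      finally show ?thesis using True by simp
    qed simp
    have hgl: "loc_int (\<lambda>y. ?h y - g y)" by (intro loc_int_integrable Bochner_Integration.integrable_diff h g(2))
    have "(\<integral>\<^sup>+x\<in>cball 0 R. norm (?C f x - f x) \<partial>lborel)
      \<le> (\<integral>\<^sup>+x. ennreal (norm (?C (\<lambda>y. ?h y - g y) x)) + (ennreal c * indicator (cball 0 R) x + ennreal (norm (?h x - g x))) \<partial>lborel)"
      by (intro nn_integral_mono pt)
    also have "\<dots> = (\<integral>\<^sup>+x. norm (?C (\<lambda>y. ?h y - g y) x) \<partial>lborel) + (ennreal c * ennreal V + (\<integral>\<^sup>+x. norm (?h x - g x) \<partial>lborel))"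
    proof -
      have [measurable]: "?C (\<lambda>y. ?h y - g y) \<in> borel_measurable borel"
        using hgl e(1)[of m] by (intro borel_measurable_continuous_onI continuous_conv[OF kernel_mollifier])
      show ?thesis
        by (subst nn_integral_add, measurable, subst nn_integral_add, measurable, subst nn_integral_cmult)
           (simp_all add: V)
    qed
    also have "\<dots> \<le> A + (ennreal c * ennreal V + A)"
      unfolding A_def by (intro add_right_mono conv_L1_contraction e(1) hgl)
    also have "\<dots> = ennreal (a + (c * V + a))"
      using a c V by (simp flip: ennreal_mult ennreal_plus)
    also have "\<dots> < ennreal \<eta>"
    proof (rule ennreal_lessI[OF \<eta>])
      have "c * V = \<eta>/3 * (V / (V + 1))" by (simp add: c_def field_simps)
      also have "\<dots> \<le> \<eta>/3 * 1" using \<eta> V by (intro mult_left_mono) auto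
      finally show "a + (c * V + a) < \<eta>" using a by linarith
    qed
    finally show ?case .
  qed
qed

section \<open>Integration by parts\<close>

lemma derivative_eq_0_outside:
  fixes g :: "'a::euclidean_space \<Rightarrow> real"
  assumes "\<And>x. (g has_derivative D x) (at x)" "\<And>x. R \<le> norm x \<Longrightarrow> g x = 0" "R < norm x"
  shows "D x = (\<lambda>h. 0)"
proof -
  have "open {x::'a. R < norm x}" by (intro open_Collect_less continuous_intros)
  then have "((\<lambda>x. 0) has_derivative D x) (at x)"
    by (rule has_derivative_transform_within_open[OF assms(1)]) (use assms in auto)
  then show ?thesis using has_derivative_unique[OF _ has_derivative_const] by blast
qed

text \<open>
  By translation invariance every difference quotient of \<open>g\<close> in direction \<open>b\<close> has integral \<open>0\<close>. The
  quotients are values of the derivative by the mean value theorem, hence uniformly bounded with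
  common bounded support, and dominated convergence applies.
\<close>

lemma integral_derivative_eq_0:
  fixes g :: "'a::euclidean_space \<Rightarrow> real"
  assumes g: "\<And>x. (g has_derivative D x) (at x)" and cont: "continuous_on UNIV (\<lambda>x. D x b)"
    and zero: "\<And>x. R \<le> norm x \<Longrightarrow> g x = 0"
  shows "(LINT x|lborel. D x b) = 0"
proof -
  have cg: "continuous_on UNIV g"
    using has_derivative_continuous[OF g] by (simp add: continuous_on_eq_continuous_at)
  have D0: "D x b = 0" if x: "R + 1 \<le> norm x" for x
  proof -
    have "D x = (\<lambda>h. 0)" by (rule derivative_eq_0_outside[where R=R, OF g]) (use zero x in auto)
    then show ?thesis by simp
  qed
  obtain M where M: "0 \<le> M" "\<And>x. norm (D x b) \<le> M"
    using continuous_vanishing_bounded[OF cont, where r="R+1"] D0 by blast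
  define t where "t n = inverse (real (Suc n))" for n
  have t: "0 < t n" "t n \<le> 1" for n by (auto simp: t_def field_simps)
  have t0: "t \<longlonglongrightarrow> 0" unfolding t_def by (rule LIMSEQ_inverse_real_of_nat)
  define q where "q n x = (g (x + t n *\<^sub>R b) - g x) / t n" for n x
  have line: "((\<lambda>s. g (x + s *\<^sub>R b)) has_real_derivative D (x + s *\<^sub>R b) b) (at s)" for x s
  proof -
    have "((\<lambda>s. g (x + s *\<^sub>R b)) has_derivative (\<lambda>h. D (x + s *\<^sub>R b) (h *\<^sub>R b))) (at s)"
      by (rule has_derivative_compose[OF _ g]) (auto intro!: derivative_eq_intros)
    moreover have "linear (D (x + s *\<^sub>R b))" using g has_derivative_linear by blast
    ultimately show ?thesis
      by (simp add: has_field_derivative_def linear_scale mult.commute[of _ "D _ b"])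
  qed
  have q: "\<exists>z. 0 < z \<and> z < t n \<and> q n x = D (x + z *\<^sub>R b) b" for n x
    using MVT2[OF t(1)[of n] line[of x]] t(1)[of n] by (fastforce simp: q_def)
  have qM: "norm (q n x) \<le> M" for n x using q[of n x] M(2) by force
  have q0: "q n x = 0" if "R + norm b + 1 \<le> norm x" for n x
  proof -
    obtain z where z: "0 < z" "z < t n" "q n x = D (x + z *\<^sub>R b) b" using q by blast
    have "norm (z *\<^sub>R b) \<le> 1 * norm b" using z t(2)[of n] unfolding norm_scaleR by (intro mult_right_mono) auto
    moreover have "norm x - norm (z *\<^sub>R b) \<le> norm (x + z *\<^sub>R b)" by (rule norm_diff_ineq)
    ultimately show ?thesis using D0 z(3) that by simp
  qed
  have gint: "integrable lborel g" by (rule continuous_vanishing_integrable[OF cg zero])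
  have qint: "(LINT x|lborel. q n x) = 0" for n
  proof -
    have [measurable]: "g \<in> borel_measurable borel" by (intro borel_measurable_continuous_onI cg)
    have "(LINT x|lborel. g (x + t n *\<^sub>R b)) = (LINT x|distr lborel borel ((+) (t n *\<^sub>R b)). g x)"
      by (subst integral_distr) (auto simp: add.commute)
    also have "\<dots> = (LINT x|lborel. g x)" unfolding lborel_distr_plus ..
    finally have "(LINT x|lborel. g (x + t n *\<^sub>R b)) = (LINT x|lborel. g x)" .
    moreover have "integrable lborel (\<lambda>x. g (x + t n *\<^sub>R b))"
    proof (rule continuous_vanishing_integrable)
      show "continuous_on UNIV (\<lambda>x. g (x + t n *\<^sub>R b))"
        by (intro continuous_on_compose2[OF cg] continuous_intros) auto
      fix x :: 'a assume *: "R + norm (t n *\<^sub>R b) \<le> norm x"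
      have "norm x - norm (t n *\<^sub>R b) \<le> norm (x + t n *\<^sub>R b)" by (rule norm_diff_ineq)
      then show "g (x + t n *\<^sub>R b) = 0" using * zero by simp
    qed
    ultimately show ?thesis using gint by (simp add: q_def)
  qed
  have "(\<lambda>n. LINT x|lborel. q n x) \<longlonglongrightarrow> (LINT x|lborel. D x b)"
  proof (rule integral_dominated_convergence)
    have [measurable]: "g \<in> borel_measurable borel" by (intro borel_measurable_continuous_onI cg)
    show "(\<lambda>x. D x b) \<in> borel_measurable lborel" using borel_measurable_continuous_onI[OF cont] by simp
    show "q n \<in> borel_measurable lborel" for n unfolding q_def[abs_def] by measurable
    show "integrable lborel (\<lambda>x. M * indicator (cball (0::'a) (R + norm b + 1)) x)"
      by (intro integrable_mult_right integrable_real_indicator)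
         (use emeasure_bounded_finite[OF bounded_cball] in \<open>auto simp: less_top\<close>)
    show "AE x in lborel. norm (q n x) \<le> M * indicator (cball 0 (R + norm b + 1)) x" for n
      using qM q0 by (auto simp: indicator_def)
    show "AE x in lborel. (\<lambda>n. q n x) \<longlonglongrightarrow> D x b"
    proof (intro AE_I2)
      fix x
      have "((\<lambda>h. (g (x + h *\<^sub>R b) - g x) / h) \<longlongrightarrow> D x b) (at 0)"
        using line[of x 0] by (simp add: DERIV_def)
      moreover have "filterlim t (at 0) sequentially"
        using t0 t(1) by (intro filterlim_atI) (auto intro!: always_eventually simp: less_imp_neq[symmetric])
      ultimately show "(\<lambda>n. q n x) \<longlonglongrightarrow> D x b"
        unfolding q_def by (rule filterlim_compose)
    qed
  qed
  then show ?thesis using qint by (simp add: LIMSEQ_const_iff)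
qed

lemma integration_by_parts:
  fixes u \<phi> :: "'a::euclidean_space \<Rightarrow> real"
  assumes u: "\<And>x. (u has_derivative Du x) (at x)" "continuous_on UNIV (\<lambda>x. Du x b)"
    and \<phi>: "\<And>x. (\<phi> has_derivative D\<phi> x) (at x)" "continuous_on UNIV (\<lambda>x. D\<phi> x b)"
    and zero: "\<And>x. R \<le> norm x \<Longrightarrow> \<phi> x = 0"
  shows "(LINT x|lborel. u x * D\<phi> x b) = - (LINT x|lborel. Du x b * \<phi> x)"
proof -
  have cu: "continuous_on UNIV u" and c\<phi>: "continuous_on UNIV \<phi>"
    using has_derivative_continuous[OF u(1)] has_derivative_continuous[OF \<phi>(1)]
    by (simp_all add: continuous_on_eq_continuous_at)
  have D0: "D\<phi> x b = 0" if x: "R + 1 \<le> norm x" for x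
  proof -
    have "D\<phi> x = (\<lambda>h. 0)" by (rule derivative_eq_0_outside[where R=R, OF \<phi>(1)]) (use zero x in auto)
    then show ?thesis by simp
  qed
  have "((\<lambda>x. u x * \<phi> x) has_derivative (\<lambda>h. u x * D\<phi> x h + Du x h * \<phi> x)) (at x)" for x
    by (rule has_derivative_mult[OF u(1) \<phi>(1)])
  then have "(LINT x|lborel. u x * D\<phi> x b + Du x b * \<phi> x) = 0"
    by (rule integral_derivative_eq_0[where R=R])
       (auto intro!: continuous_intros cu c\<phi> u \<phi> simp: zero)
  moreover have "integrable lborel (\<lambda>x. u x * D\<phi> x b)"
    by (rule continuous_vanishing_integrable[where r="R+1"]) (auto intro!: continuous_intros cu \<phi> simp: D0)
  moreover have "integrable lborel (\<lambda>x. Du x b * \<phi> x)"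
    by (rule continuous_vanishing_integrable[where r="R"]) (auto intro!: continuous_intros c\<phi> u simp: zero)
  ultimately show ?thesis by simp
qed

lemma compact_support_vanishes:
  fixes \<phi> :: "'a::euclidean_space \<Rightarrow> 'b::real_vector"
  assumes "compact_support_in \<phi> U"
  obtains R where "0 < R" "\<And>x. R \<le> norm x \<Longrightarrow> \<phi> x = 0"
proof -
  have "bounded {x. \<phi> x \<noteq> 0}"
    using assms unfolding compact_support_in_def
    by (meson bounded_subset closure_subset compact_imp_bounded)
  then obtain B where B: "0 < B" "\<And>x. \<phi> x \<noteq> 0 \<Longrightarrow> norm x \<le> B"
    unfolding bounded_pos by blast
  then show thesis using that[of "B + 1"] by fastforce
qed

text \<open>
  Access to the recursive predicate \<open>Ck\<close> at order one.
\<close>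

lemma Ck1_derivative:
  assumes "Ck 1 \<phi>"
  shows "(\<phi> has_derivative frechet_derivative \<phi> (at x)) (at x)"
    and "continuous_on UNIV (\<lambda>x. frechet_derivative \<phi> (at x) v)"
    and "\<phi> differentiable (at x)" "continuous_on UNIV \<phi>"
proof -
  have d: "\<phi> differentiable (at x)" for x using assms by simp
  then show "(\<phi> has_derivative frechet_derivative \<phi> (at x)) (at x)" "\<phi> differentiable (at x)"
    using frechet_derivative_works by blast+
  show "continuous_on UNIV (\<lambda>x. frechet_derivative \<phi> (at x) v)" using assms by simp
  show "continuous_on UNIV \<phi>"
    using d differentiable_imp_continuous_within by (auto simp: continuous_on_eq_continuous_at)
qed

lemma has_derivative_inner_Basis:
  assumes "Ck 1 \<Phi>"
  shows "((\<lambda>x. \<Phi> x \<bullet> b) has_derivative (\<lambda>h. frechet_derivative \<Phi> (at x) h \<bullet> b)) (at x)"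
  by (rule has_derivative_inner_left[OF Ck1_derivative(1)[OF assms]])

lemma divergence_Ck1:
  assumes "Ck 1 \<Phi>"
  shows "divergence \<Phi> x = (\<Sum>b\<in>Basis. frechet_derivative \<Phi> (at x) b \<bullet> b)"
  using Ck1_derivative(3)[OF assms] by (simp add: divergence_def)

lemma continuous_divergence:
  assumes "Ck 1 \<Phi>" shows "continuous_on UNIV (divergence \<Phi>)"
  unfolding divergence_Ck1[OF assms, abs_def]
  by (intro continuous_intros Ck1_derivative(2)[OF assms])

lemma divergence_vanishes:
  fixes \<Phi> :: "'a::euclidean_space \<Rightarrow> 'a"
  assumes "Ck 1 \<Phi>" "\<And>x. R \<le> norm x \<Longrightarrow> \<Phi> x = 0" "R + 1 \<le> norm x"
  shows "divergence \<Phi> x = 0"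
proof -
  have "frechet_derivative \<Phi> (at x) b \<bullet> b = 0" for b
  proof -
    have "(\<lambda>h. frechet_derivative \<Phi> (at x) h \<bullet> b) = (\<lambda>h. 0)"
      by (rule derivative_eq_0_outside[where R=R, OF has_derivative_inner_Basis[OF assms(1)]]) (use assms in auto)
    then show ?thesis by meson
  qed
  then show ?thesis by (simp add: divergence_Ck1[OF assms(1)])
qed

section \<open>The pairing of a function with the divergence of a field\<close>

text \<open>
  The distributional derivative of \<open>f\<close>, up to sign, applied to the field \<open>\<Phi>\<close>. The two lemmas
  \<open>pairing_mollified_function\<close> and \<open>pairing_mollified_field\<close> express one and the same integral in two
  ways: mollification may be moved from the function to the field.
\<close>

definition pairing :: "('a::euclidean_space \<Rightarrow> real) \<Rightarrow> ('a \<Rightarrow> 'a) \<Rightarrow> real" where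
  "pairing f \<Phi> = (LINT x|lborel. f x * divergence \<Phi> x)"

lemma pairing_integrable:
  fixes \<Phi> :: "'a::euclidean_space \<Rightarrow> 'a"
  assumes f: "loc_int f" and \<Phi>: "Ck 1 \<Phi>" "compact_support_in \<Phi> U"
  shows "integrable lborel (\<lambda>x. f x * divergence \<Phi> x)"
proof -
  obtain R where R: "\<And>x. R \<le> norm x \<Longrightarrow> \<Phi> x = 0" using compact_support_vanishes[OF \<Phi>(2)] by blast
  have z: "divergence \<Phi> x = 0" if "R + 1 \<le> norm x" for x
    by (rule divergence_vanishes[OF \<Phi>(1) R that])
  obtain M where M: "\<And>x. norm (divergence \<Phi> x) \<le> M"
    using continuous_vanishing_bounded[OF continuous_divergence[OF \<Phi>(1)], where r="R+1"] z by blast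
  note [measurable] = loc_int_measurable[OF f] borel_measurable_continuous_onI[OF continuous_divergence[OF \<Phi>(1)]]
  show ?thesis
  proof (rule loc_int_dominated(1)[OF f, where r="R+1" and x=0 and M=M])
    fix y
    show "norm (f y * divergence \<Phi> y) \<le> M * norm (f y)"
      using mult_right_mono[OF M[of y], of "norm (f y)"] by (simp add: abs_mult mult.commute)
    show "R + 1 < dist 0 y \<Longrightarrow> f y * divergence \<Phi> y = 0" using z[of y] by simp
  qed measurable
qed

lemma pairing_mollified_function:
  fixes \<Phi> :: "'a::euclidean_space \<Rightarrow> 'a"
  assumes e: "0 < e" and f: "loc_int f" and \<Phi>: "Ck 1 \<Phi>" "compact_support_in \<Phi> U"
  shows "pairing (conv (mollifier e) f) \<Phi> = - (LINT x|lborel. \<Phi> x \<bullet> moll_gradient e f x)"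
proof -
  obtain R where R: "\<And>x. R \<le> norm x \<Longrightarrow> \<Phi> x = 0" using compact_support_vanishes[OF \<Phi>(2)] by blast
  let ?u = "conv (mollifier e) f" and ?G = "moll_gradient e f" and ?D = "\<lambda>x. frechet_derivative \<Phi> (at x)"
  have cG: "continuous_on UNIV ?G" by (rule continuous_moll_gradient[OF e f])
  have cu: "continuous_on UNIV ?u" by (rule continuous_conv[OF kernel_mollifier[OF e] f])
  have D0: "?D x b \<bullet> b = 0" if "R + 1 \<le> norm x" for x b
  proof -
    have "(\<lambda>h. ?D x h \<bullet> b) = (\<lambda>h. 0)"
      by (rule derivative_eq_0_outside[where R=R, OF has_derivative_inner_Basis[OF \<Phi>(1)]]) (use R that in auto)
    then show ?thesis by meson
  qed
  have parts: "(LINT x|lborel. ?u x * (?D x b \<bullet> b)) = - (LINT x|lborel. (?G x \<bullet> b) * (\<Phi> x \<bullet> b))" for b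
    by (rule integration_by_parts[OF conv_has_derivative_moll_gradient[OF e f] _ has_derivative_inner_Basis[OF \<Phi>(1)], where R=R])
       (auto intro!: continuous_intros cG Ck1_derivative(2)[OF \<Phi>(1)] simp: R)
  have "pairing ?u \<Phi> = (LINT x|lborel. (\<Sum>b\<in>Basis. ?u x * (?D x b \<bullet> b)))"
    by (simp add: pairing_def divergence_Ck1[OF \<Phi>(1)] sum_distrib_left)
  also have "\<dots> = (\<Sum>b\<in>Basis. LINT x|lborel. ?u x * (?D x b \<bullet> b))"
    by (rule Bochner_Integration.integral_sum)
       (rule continuous_vanishing_integrable[where r="R+1"],
         auto intro!: continuous_intros cu Ck1_derivative(2)[OF \<Phi>(1)] simp: D0)
  also have "\<dots> = - (\<Sum>b\<in>Basis. LINT x|lborel. (?G x \<bullet> b) * (\<Phi> x \<bullet> b))"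
    by (simp add: parts sum_negf)
  also have "(\<Sum>b\<in>Basis. LINT x|lborel. (?G x \<bullet> b) * (\<Phi> x \<bullet> b)) = (LINT x|lborel. (\<Sum>b\<in>Basis. (?G x \<bullet> b) * (\<Phi> x \<bullet> b)))"
    by (rule Bochner_Integration.integral_sum[symmetric])
       (rule continuous_vanishing_integrable[where r="R"],
         auto intro!: continuous_intros cG Ck1_derivative(4)[OF \<Phi>(1)] simp: R)
  also have "\<dots> = (LINT x|lborel. \<Phi> x \<bullet> ?G x)"
    by (rule Bochner_Integration.integral_cong[OF refl])
       (simp add: euclidean_inner[of "\<Phi> _" "?G _"] mult.commute)
  finally show ?thesis .
qed

text \<open>
  Fubini's theorem, together with the oddness of the gradient of the even mollifier. The field
  \<open>\<psi>\<close> is merely bounded and measurable here, which permits the discontinuous fields that are used in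
  \<open>mollified_gradient_duality\<close>.
\<close>

lemma pairing_mollified_field:
  fixes \<psi> :: "'a::euclidean_space \<Rightarrow> 'a"
  assumes e: "0 < e" and f: "loc_int f" and [measurable]: "\<psi> \<in> borel_measurable borel"
    and M: "\<And>x. norm (\<psi> x) \<le> M" and zero: "\<And>x. R < norm x \<Longrightarrow> \<psi> x = 0"
  shows "pairing f (conv (mollifier e) \<psi>) = - (LINT x|lborel. \<psi> x \<bullet> moll_gradient e f x)"
proof -
  have l\<psi>: "loc_int \<psi>" by (rule loc_int_bounded_measurable[OF assms(3) M])
  note [measurable] = loc_int_measurable[OF f]
  have M0: "0 \<le> M" using M[of 0] norm_ge_zero order_trans by blast
  obtain N where N: "0 \<le> N" "\<And>z::'a. norm (mollifier_grad e z) \<le> N"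
    using continuous_vanishing_bounded[of "mollifier_grad e :: 'a \<Rightarrow> 'a" e, OF continuous_mollifier_grad mollifier_grad_eq_0[OF e]]
    by blast
  define F where "F x y = f y * (mollifier_grad e (y - x) \<bullet> \<psi> x)" for x y
  let ?a = "\<lambda>x. N * M * indicator (cball (0::'a) R) x" and ?b = "\<lambda>y. norm (indicator (cball 0 (R + e)) y *\<^sub>R f y)"
  have Fab: "norm (F x y) \<le> ?a x * ?b y" for x y
  proof (cases "norm x \<le> R \<and> norm (y - x) < e")
    case True
    then have "norm y \<le> R + e" using norm_triangle_ineq2[of y x] by simp
    moreover have "\<bar>mollifier_grad e (y - x) \<bullet> \<psi> x\<bar> \<le> N * M"
      using Cauchy_Schwarz_ineq2 mult_mono[OF N(2) M N(1) norm_ge_zero] order_trans by blast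
    then have "\<bar>f y\<bar> * \<bar>mollifier_grad e (y - x) \<bullet> \<psi> x\<bar> \<le> \<bar>f y\<bar> * (N * M)"
      by (intro mult_left_mono) auto
    ultimately show ?thesis using True by (simp add: F_def abs_mult mult.commute)
  next
    case False
    then have "F x y = 0" using zero[of x] mollifier_grad_eq_0[OF e, of "y - x"] by (force simp: F_def)
    then show ?thesis using N M0 by simp
  qed
  have Fm[measurable]: "case_prod F \<in> borel_measurable (lborel \<Otimes>\<^sub>M lborel)" unfolding F_def by measurable
  have b: "integrable lborel ?b" by (intro integrable_norm loc_int_integrable_cball f)
  have a: "integrable lborel ?a"
    by (intro integrable_mult_right integrable_real_indicator)
       (use emeasure_bounded_finite[OF bounded_cball] in \<open>auto simp: less_top\<close>)
  have Fy: "integrable lborel (F x)" for x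
  proof (rule Bochner_Integration.integrable_bound)
    show "integrable lborel (\<lambda>y. ?a x * ?b y)" using b by (intro integrable_mult_right)
    show "AE y in lborel. norm (F x y) \<le> norm (?a x * ?b y)"
      unfolding real_norm_def by (intro AE_I2) (rule order_trans[OF Fab[unfolded real_norm_def] abs_ge_self])
  qed (simp add: F_def)
  have "integrable (lborel \<Otimes>\<^sub>M lborel) (case_prod F)"
  proof (rule lborel_pair.Fubini_integrable)
    show "integrable lborel (\<lambda>x. LINT y|lborel. norm (case (x, y) of (x, y) \<Rightarrow> F x y))"
    proof (rule Bochner_Integration.integrable_bound)
      show "integrable lborel (\<lambda>x. ?a x * (LINT y|lborel. ?b y))" using a by (intro integrable_mult_left)
      show "AE x in lborel. norm (LINT y|lborel. norm (case (x, y) of (x, y) \<Rightarrow> F x y)) \<le> norm (?a x * (LINT y|lborel. ?b y))"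
      proof (intro AE_I2)
        fix x
        have "norm (LINT y|lborel. norm (F x y)) = (LINT y|lborel. norm (F x y))"
          by (simp add: integral_nonneg_AE)
        also have "\<dots> \<le> (LINT y|lborel. ?a x * ?b y)"
          by (rule integral_mono[OF integrable_norm[OF Fy] integrable_mult_right Fab]) (use b in simp)
        also have "\<dots> = ?a x * (LINT y|lborel. ?b y)" by simp
        finally show "norm (LINT y|lborel. norm (case (x, y) of (x, y) \<Rightarrow> F x y)) \<le> norm (?a x * (LINT y|lborel. ?b y))"
          by (simp add: abs_if)
      qed
    qed measurable
    show "AE x in lborel. integrable lborel (\<lambda>y. case (x, y) of (x, y) \<Rightarrow> F x y)" using Fy by simp
  qed measurable
  then have fub: "(LINT y|lborel. (LINT x|lborel. F x y)) = (LINT x|lborel. (LINT y|lborel. F x y))"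
    by (rule lborel_pair.Fubini_integral)
  have "pairing f (conv (mollifier e) \<psi>) = (LINT y|lborel. (LINT x|lborel. F x y))"
    unfolding pairing_def F_def divergence_conv[OF e l\<psi>] by simp
  also have "\<dots> = (LINT x|lborel. - (\<psi> x \<bullet> moll_gradient e f x))"
    unfolding fub
  proof (rule Bochner_Integration.integral_cong[OF refl])
    fix x
    have "(LINT y|lborel. F x y) = (LINT y|lborel. - (\<psi> x \<bullet> (f y *\<^sub>R mollifier_grad e (x - y))))"
      by (rule Bochner_Integration.integral_cong[OF refl])
         (use mollifier_grad_minus[of e "x - _"] in \<open>simp add: F_def inner_commute\<close>)
    also have "\<dots> = - (\<psi> x \<bullet> moll_gradient e f x)"
      unfolding moll_gradient_def integral_minus
      by (subst integral_inner_right) (use moll_gradient_integrable[OF e f, of x] in simp_all)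
    finally show "(LINT y|lborel. F x y) = - (\<psi> x \<bullet> moll_gradient e f x)" .
  qed
  finally show ?thesis by simp
qed

section \<open>Domination of mollifications by ball averages\<close>

text \<open>
  The mollifier is a decreasing function of \<open>\<bar>z\<bar>\<^sup>2\<close>; the threshold for \<open>\<bar>z\<bar>\<^sup>2\<close> is \<open>e\<^sup>2 - sqrt (t I)\<close> with the
  normalising constant \<open>I\<close>.
\<close>

lemma mollifier_superlevel_ball:
  fixes x :: "'a::euclidean_space"
  assumes e: "0 < e" and t: "0 \<le> t"
  shows "{y. t < mollifier e (x - y)} = {} \<or> (\<exists>r>0. {y. t < mollifier e (x - y)} = ball x r)"
proof -
  let ?I = "LINT y|(lborel::'a measure). (max 0 (e\<^sup>2 - (norm y)\<^sup>2))\<^sup>2"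
  have I: "0 < ?I" using bump_mass(2)[OF e] .
  define s where "s = sqrt (t * ?I)"
  have s: "0 \<le> s" "s\<^sup>2 = t * ?I" using t I by (auto simp: s_def)
  have "t < mollifier e z \<longleftrightarrow> (norm z)\<^sup>2 < e\<^sup>2 - s" for z :: 'a
  proof -
    have "t < mollifier e z \<longleftrightarrow> s\<^sup>2 < (max 0 (e\<^sup>2 - (norm z)\<^sup>2))\<^sup>2"
      using I by (simp add: mollifier_def less_divide_eq s(2))
    also have "\<dots> \<longleftrightarrow> s < max 0 (e\<^sup>2 - (norm z)\<^sup>2)"
      using s(1) by (metis max.cobounded1 pos2 power_mono_iff linorder_not_le)
    also have "\<dots> \<longleftrightarrow> (norm z)\<^sup>2 < e\<^sup>2 - s" using s(1) by linarith
    finally show ?thesis .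
  qed
  then have eq: "{y. t < mollifier e (x - y)} = {y. (norm (x - y))\<^sup>2 < e\<^sup>2 - s}" by blast
  show ?thesis
  proof (cases "0 < e\<^sup>2 - s")
    case False
    then have "\<not> (norm (x - y))\<^sup>2 < e\<^sup>2 - s" for y using zero_le_power2[of "norm (x - y)"] by linarith
    then show ?thesis unfolding eq by blast
  next
    case True
    then have "(norm (x - y))\<^sup>2 < e\<^sup>2 - s \<longleftrightarrow> norm (x - y) < sqrt (e\<^sup>2 - s)" for y
      by (subst real_sqrt_less_iff[symmetric]) simp
    then have "{y. t < mollifier e (x - y)} = ball x (sqrt (e\<^sup>2 - s))"
      unfolding eq by (simp only: ball_def dist_norm)
    then show ?thesis using True by (intro disjI2 exI[of _ "sqrt (e\<^sup>2 - s)"]) simp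
  qed
qed

lemma mollifier_layer_cake:
  fixes u :: "'a::euclidean_space \<Rightarrow> ennreal"
  assumes [measurable]: "u \<in> borel_measurable borel"
  shows "(\<integral>\<^sup>+y. ennreal (mollifier e (x - y)) * u y \<partial>lborel)
    = (\<integral>\<^sup>+t\<in>{0..}. (\<integral>\<^sup>+y\<in>{y. t < mollifier e (x - y)}. u y \<partial>lborel) \<partial>lborel)"
proof -
  have "(\<integral>\<^sup>+t. indicator {0..} t * indicator {y. t < mollifier e (x - y)} y * u y \<partial>lborel)
     = ennreal (mollifier e (x - y)) * u y" for y
  proof -
    have "(\<integral>\<^sup>+t. indicator {0..} t * indicator {y. t < mollifier e (x - y)} y * u y \<partial>lborel)
       = (\<integral>\<^sup>+t. indicator {0..<mollifier e (x - y)} t * u y \<partial>lborel)"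
      by (intro nn_integral_cong) (simp add: indicator_def)
    also have "\<dots> = ennreal (mollifier e (x - y)) * u y"
      by (subst nn_integral_multc) (auto simp: mollifier_nonneg)
    finally show ?thesis .
  qed
  then have "(\<integral>\<^sup>+y. ennreal (mollifier e (x - y)) * u y \<partial>lborel)
    = (\<integral>\<^sup>+y. (\<integral>\<^sup>+t. indicator {0..} t * indicator {y. t < mollifier e (x - y)} y * u y \<partial>lborel) \<partial>lborel)"
    by simp
  also have "\<dots> = (\<integral>\<^sup>+t. (\<integral>\<^sup>+y. indicator {0..} t * indicator {y. t < mollifier e (x - y)} y * u y \<partial>lborel) \<partial>lborel)"
  proof (rule lborel_pair.Fubini')
    have "(\<lambda>(t, y). indicator {0..} t * (if t < mollifier e (x - y) then 1 else 0) * u y) \<in> borel_measurable (lborel \<Otimes>\<^sub>M lborel)"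
      by measurable
    then show "(\<lambda>(t, y). indicator {0..} t * indicator {y. t < mollifier e (x - y)} y * u y) \<in> borel_measurable (lborel \<Otimes>\<^sub>M lborel)"
      by (simp add: indicator_def of_bool_def)
  qed
  also have "\<dots> = (\<integral>\<^sup>+t\<in>{0..}. (\<integral>\<^sup>+y\<in>{y. t < mollifier e (x - y)}. u y \<partial>lborel) \<partial>lborel)"
    by (intro nn_integral_cong) (auto simp: indicator_def mult.commute split: if_splits)
  finally show ?thesis .
qed

text \<open>
  By the layer cake formula the mollified value is an integral of integrals of \<open>u\<close> over balls
  centred at \<open>x\<close>. Replacing each by its bound gives the mollification of the constant \<open>c\<close>. This
  keeps the constant of the ball averages, which the sharp power of the \<open>A\<^sub>1\<close> constant requires.
\<close>

theorem mollified_le_of_ball_bound: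
  fixes u :: "'a::euclidean_space \<Rightarrow> ennreal"
  assumes e: "0 < e" and u[measurable]: "u \<in> borel_measurable borel"
    and c: "\<And>r. 0 < r \<Longrightarrow> (\<integral>\<^sup>+y\<in>ball x r. u y \<partial>lborel) \<le> c * emeasure lborel (ball x r)"
  shows "(\<integral>\<^sup>+y. ennreal (mollifier e (x - y)) * u y \<partial>lborel) \<le> c"
proof -
  let ?S = "\<lambda>t. {y. t < mollifier e (x - y)}"
  have "(\<integral>\<^sup>+y. ennreal (mollifier e (x - y)) * u y \<partial>lborel) = (\<integral>\<^sup>+t\<in>{0..}. (\<integral>\<^sup>+y\<in>?S t. u y \<partial>lborel) \<partial>lborel)"
    by (rule mollifier_layer_cake[OF u])
  also have "\<dots> \<le> (\<integral>\<^sup>+t\<in>{0..}. (\<integral>\<^sup>+y\<in>?S t. c \<partial>lborel) \<partial>lborel)"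
  proof (rule nn_integral_mono)
    fix t :: real
    show "(\<integral>\<^sup>+y\<in>?S t. u y \<partial>lborel) * indicator {0..} t \<le> (\<integral>\<^sup>+y\<in>?S t. c \<partial>lborel) * indicator {0..} t"
    proof (cases "0 \<le> t")
      case True
      from mollifier_superlevel_ball[OF e True, of x]
      have "(\<integral>\<^sup>+y\<in>?S t. u y \<partial>lborel) \<le> (\<integral>\<^sup>+y\<in>?S t. c \<partial>lborel)"
      proof
        assume "\<exists>r>0. ?S t = ball x r"
        then obtain r where r: "0 < r" "?S t = ball x r" by blast
        show ?thesis unfolding r(2) using c[OF r(1)] by (simp add: nn_integral_cmult_indicator)
      qed simp
      then show ?thesis by (simp add: mult_right_mono)
    qed simp
  qed
  also have "\<dots> = (\<integral>\<^sup>+y. ennreal (mollifier e (x - y)) * c \<partial>lborel)"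
    by (rule mollifier_layer_cake[symmetric]) simp
  also have "\<dots> = c"
    by (subst nn_integral_multc) (simp_all add: nn_integral_mollifier_reflect[OF e])
  finally show ?thesis .
qed

section \<open>Test fields and variations\<close>

text \<open>
  Fatou's lemma in the form in which it is used repeatedly.
\<close>

lemma nn_integral_le_of_tendsto:
  assumes [measurable]: "\<And>k. g k \<in> borel_measurable M"
    and lim: "AE x in M. (\<lambda>k. g k x) \<longlonglongrightarrow> h x"
    and le: "\<And>k::nat. (\<integral>\<^sup>+x. g k x \<partial>M) \<le> K k" and K: "K \<longlonglongrightarrow> (L::ennreal)"
  shows "(\<integral>\<^sup>+x. h x \<partial>M) \<le> L"
proof -
  have "(\<integral>\<^sup>+x. h x \<partial>M) = (\<integral>\<^sup>+x. liminf (\<lambda>k. g k x) \<partial>M)"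
    by (rule nn_integral_cong_AE) (use lim in eventually_elim, simp add: lim_imp_Liminf)
  also have "\<dots> \<le> liminf (\<lambda>k. \<integral>\<^sup>+x. g k x \<partial>M)" by (rule nn_integral_liminf) simp
  also have "\<dots> \<le> liminf K" by (rule Liminf_mono) (simp add: le)
  also have "\<dots> = L" using K by (simp add: lim_imp_Liminf)
  finally show ?thesis .
qed

definition test_field :: "'a set \<Rightarrow> ('a::euclidean_space \<Rightarrow> 'a) \<Rightarrow> bool" where
  "test_field U \<Phi> \<longleftrightarrow> Ck 1 \<Phi> \<and> compact_support_in \<Phi> U"

lemma compact_support_in_zero: "compact_support_in (\<lambda>x. 0) U"
  by (simp add: compact_support_in_def)

lemma compact_support_in_mono: "compact_support_in \<Phi> U \<Longrightarrow> U \<subseteq> V \<Longrightarrow> compact_support_in \<Phi> V"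
  by (auto simp: compact_support_in_def)

text \<open>
  The support is taken as a closure, so it suffices to exhibit any compact superset in \<open>U\<close>.
\<close>

lemma compact_support_in_subset:
  fixes \<Phi> :: "'a::euclidean_space \<Rightarrow> 'b::real_vector"
  assumes "compact K" "K \<subseteq> U" "\<And>x. \<Phi> x \<noteq> 0 \<Longrightarrow> x \<in> K"
  shows "compact_support_in \<Phi> U"
proof -
  have sub: "closure {x. \<Phi> x \<noteq> 0} \<subseteq> K"
    using assms by (intro closure_minimal compact_imp_closed) auto
  have "compact (closure {x. \<Phi> x \<noteq> 0})"
    using bounded_subset[OF compact_imp_bounded[OF assms(1)] sub] by (simp add: compact_eq_bounded_closed)
  then show ?thesis using sub assms by (auto simp: compact_support_in_def)
qed

lemma compact_support_in_sum:
  fixes \<Phi> :: "'i \<Rightarrow> 'a::euclidean_space \<Rightarrow> 'b::real_vector"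
  assumes "finite I" "\<And>i. i \<in> I \<Longrightarrow> compact_support_in (\<Phi> i) U"
  shows "compact_support_in (\<lambda>x. \<Sum>i\<in>I. \<Phi> i x) U"
proof (rule compact_support_in_subset)
  show "compact (\<Union>i\<in>I. closure {x. \<Phi> i x \<noteq> 0})"
    using assms by (intro compact_UN) (auto simp: compact_support_in_def)
  show "(\<Union>i\<in>I. closure {x. \<Phi> i x \<noteq> 0}) \<subseteq> U"
    using assms by (auto simp: compact_support_in_def)
  fix x assume "(\<Sum>i\<in>I. \<Phi> i x) \<noteq> 0"
  then obtain i where i: "i \<in> I" "\<Phi> i x \<noteq> 0" by (meson sum.neutral)
  have "x \<in> closure {x. \<Phi> i x \<noteq> 0}" by (rule subsetD[OF closure_subset]) (simp add: i)
  then show "x \<in> (\<Union>i\<in>I. closure {x. \<Phi> i x \<noteq> 0})" using i by blast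
qed

lemma Ck1_sum:
  assumes "\<And>i. i \<in> I \<Longrightarrow> Ck 1 (\<Phi> i)"
  shows "Ck 1 (\<lambda>x. \<Sum>i\<in>I. \<Phi> i x)"
    and "\<And>x h. frechet_derivative (\<lambda>x. \<Sum>i\<in>I. \<Phi> i x) (at x) h = (\<Sum>i\<in>I. frechet_derivative (\<Phi> i) (at x) h)"
proof -
  have d: "((\<lambda>x. \<Sum>i\<in>I. \<Phi> i x) has_derivative (\<lambda>h. \<Sum>i\<in>I. frechet_derivative (\<Phi> i) (at x) h)) (at x)" for x
    by (intro has_derivative_sum Ck1_derivative(1) assms)
  show eq: "frechet_derivative (\<lambda>x. \<Sum>i\<in>I. \<Phi> i x) (at x) h = (\<Sum>i\<in>I. frechet_derivative (\<Phi> i) (at x) h)" for x h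
    using frechet_derivative_at[OF d, of x, symmetric] by simp
  have "continuous_on UNIV (\<lambda>x. \<Sum>i\<in>I. frechet_derivative (\<Phi> i) (at x) v)" for v
    by (intro continuous_on_sum Ck1_derivative(2) assms)
  then show "Ck 1 (\<lambda>x. \<Sum>i\<in>I. \<Phi> i x)"
    using differentiableI[OF d] by (simp add: eq)
qed

lemma Ck1_scaleR:
  assumes "Ck 1 \<Phi>"
  shows "Ck 1 (\<lambda>x. c *\<^sub>R \<Phi> x)"
    and "\<And>x h. frechet_derivative (\<lambda>x. c *\<^sub>R \<Phi> x) (at x) h = c *\<^sub>R frechet_derivative \<Phi> (at x) h"
proof -
  have d: "((\<lambda>x. c *\<^sub>R \<Phi> x) has_derivative (\<lambda>h. c *\<^sub>R frechet_derivative \<Phi> (at x) h)) (at x)" for x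
    by (intro has_derivative_scaleR_right Ck1_derivative(1) assms)
  show eq: "frechet_derivative (\<lambda>x. c *\<^sub>R \<Phi> x) (at x) h = c *\<^sub>R frechet_derivative \<Phi> (at x) h" for x h
    using frechet_derivative_at[OF d, of x, symmetric] by simp
  have "continuous_on UNIV (\<lambda>x. c *\<^sub>R frechet_derivative \<Phi> (at x) v)" for v
    by (intro continuous_intros Ck1_derivative(2) assms)
  then show "Ck 1 (\<lambda>x. c *\<^sub>R \<Phi> x)"
    using differentiableI[OF d] by (simp add: eq)
qed

lemma test_field_sum:
  assumes "finite I" "\<And>i. i \<in> I \<Longrightarrow> test_field U (\<Phi> i)"
  shows "test_field U (\<lambda>x. \<Sum>i\<in>I. \<Phi> i x)"
  using assms Ck1_sum(1)[of I \<Phi>] compact_support_in_sum[of I \<Phi> U] by (simp add: test_field_def)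

lemma test_field_scaleR:
  assumes "test_field U \<Phi>"
  shows "test_field U (\<lambda>x. c *\<^sub>R \<Phi> x)"
proof -
  have "compact_support_in (\<lambda>x. c *\<^sub>R \<Phi> x) U"
  proof (rule compact_support_in_subset)
    show "compact (closure {x. \<Phi> x \<noteq> 0})" "closure {x. \<Phi> x \<noteq> 0} \<subseteq> U"
      using assms by (auto simp: test_field_def compact_support_in_def)
    show "c *\<^sub>R \<Phi> x \<noteq> 0 \<Longrightarrow> x \<in> closure {x. \<Phi> x \<noteq> 0}" for x
      by (rule subsetD[OF closure_subset]) simp
  qed
  then show ?thesis using assms Ck1_scaleR(1)[of \<Phi> c] by (simp add: test_field_def)
qed

lemma test_field_mono: "test_field U \<Phi> \<Longrightarrow> U \<subseteq> V \<Longrightarrow> test_field V \<Phi>"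
  by (auto simp: test_field_def intro: compact_support_in_mono)

lemma test_field_eq_0:
  assumes "test_field U \<Phi>" "x \<notin> U" shows "\<Phi> x = 0"
proof (rule ccontr)
  assume "\<Phi> x \<noteq> 0"
  then have "x \<in> closure {x. \<Phi> x \<noteq> 0}" by (intro subsetD[OF closure_subset]) simp
  then show False using assms unfolding test_field_def compact_support_in_def by blast
qed

lemma test_field_zero: "test_field U (\<lambda>x. 0)"
  using Ck1_sum(1)[of "{}"] by (simp add: test_field_def compact_support_in_zero)

lemma pairing_sum:
  assumes f: "loc_int f" and \<Phi>: "\<And>i. i \<in> I \<Longrightarrow> test_field U (\<Phi> i)"
  shows "pairing f (\<lambda>x. \<Sum>i\<in>I. \<Phi> i x) = (\<Sum>i\<in>I. pairing f (\<Phi> i))"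
proof -
  have C: "Ck 1 (\<Phi> i)" if "i \<in> I" for i using \<Phi>[OF that] by (simp add: test_field_def)
  have T: "compact_support_in (\<Phi> i) U" if "i \<in> I" for i using \<Phi>[OF that] by (simp add: test_field_def)
  have S: "Ck 1 (\<lambda>x. \<Sum>i\<in>I. \<Phi> i x)" by (rule Ck1_sum(1)[OF C])
  have D: "frechet_derivative (\<lambda>x. \<Sum>i\<in>I. \<Phi> i x) (at x) h = (\<Sum>i\<in>I. frechet_derivative (\<Phi> i) (at x) h)" for x h
    by (rule Ck1_sum(2)[OF C])
  have "divergence (\<lambda>x. \<Sum>i\<in>I. \<Phi> i x) x = (\<Sum>i\<in>I. divergence (\<Phi> i) x)" for x
    unfolding divergence_Ck1[OF S] D inner_sum_left
    by (subst sum.swap) (intro sum.cong refl, simp add: divergence_Ck1[OF C])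
  then have "pairing f (\<lambda>x. \<Sum>i\<in>I. \<Phi> i x) = (LINT x|lborel. (\<Sum>i\<in>I. f x * divergence (\<Phi> i) x))"
    by (simp add: pairing_def sum_distrib_left)
  also have "\<dots> = (\<Sum>i\<in>I. pairing f (\<Phi> i))"
    unfolding pairing_def
    by (rule Bochner_Integration.integral_sum) (rule pairing_integrable[OF f C T])
  finally show ?thesis .
qed

lemma pairing_scaleR:
  assumes "Ck 1 \<Phi>" shows "pairing f (\<lambda>x. c *\<^sub>R \<Phi> x) = c * pairing f \<Phi>"
proof -
  have "divergence (\<lambda>x. c *\<^sub>R \<Phi> x) x = c * divergence \<Phi> x" for x
    unfolding divergence_Ck1[OF Ck1_scaleR(1)[OF assms]] divergence_Ck1[OF assms]
    by (simp add: Ck1_scaleR(2)[OF assms] sum_distrib_left)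
  then show ?thesis by (simp add: pairing_def mult.left_commute)
qed

text \<open>
  The weighted variation is defined with Lipschitz fields and the classical one with \<open>C\<^sup>1\<close> fields;
  this makes every test field admissible for both.
\<close>

lemma test_field_lipschitz:
  fixes \<Phi> :: "'a::euclidean_space \<Rightarrow> 'a"
  assumes "test_field U \<Phi>"
  shows "\<exists>L. L-lipschitz_on UNIV \<Phi>"
proof -
  have C: "Ck 1 \<Phi>" and S: "compact_support_in \<Phi> U" using assms by (auto simp: test_field_def)
  obtain R where R: "\<And>x. R \<le> norm x \<Longrightarrow> \<Phi> x = 0" using compact_support_vanishes[OF S] by blast
  let ?D = "\<lambda>x. frechet_derivative \<Phi> (at x)"
  have "\<exists>M. \<forall>x. norm (?D x b) \<le> M" for b
  proof -
    have "?D x b = 0" if x: "R + 1 \<le> norm x" for x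
    proof (rule euclidean_eqI)
      fix c :: 'a
      have "(\<lambda>h. ?D x h \<bullet> c) = (\<lambda>h. 0)"
        by (rule derivative_eq_0_outside[where R=R, OF has_derivative_inner_Basis[OF C]]) (use R x in auto)
      then show "?D x b \<bullet> c = 0 \<bullet> c" using fun_cong by fastforce
    qed
    then obtain M where "\<And>x. norm (?D x b) \<le> M"
      using continuous_vanishing_bounded[OF Ck1_derivative(2)[OF C, of b], where r="R+1"] by blast
    then show ?thesis by blast
  qed
  then obtain M where M: "\<And>b x. norm (?D x b) \<le> M b" by metis
  define L where "L = (\<Sum>b\<in>Basis. M b)"
  have M0: "0 \<le> M b" for b using M[of 0 b] norm_ge_zero order_trans by blast
  have "onorm (?D x) \<le> L" for x
  proof (rule onorm_bound)
    show "0 \<le> L" unfolding L_def by (intro sum_nonneg M0)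
    fix h
    have lin: "linear (?D x)" using Ck1_derivative(1)[OF C] has_derivative_linear by blast
    have "?D x h = ?D x (\<Sum>b\<in>Basis. (h \<bullet> b) *\<^sub>R b)" by (simp add: euclidean_representation)
    also have "\<dots> = (\<Sum>b\<in>Basis. (h \<bullet> b) *\<^sub>R ?D x b)"
      using lin by (simp add: linear_sum linear_scale)
    also have "norm \<dots> \<le> (\<Sum>b\<in>Basis. norm h * M b)"
      by (rule sum_norm_le) (auto intro!: mult_mono Basis_le_norm M)
    also have "\<dots> = L * norm h" unfolding L_def sum_distrib_right by (simp only: mult.commute)
    finally show "norm (?D x h) \<le> L * norm h" .
  qed
  moreover have "0 \<le> L" unfolding L_def by (intro sum_nonneg M0)
  ultimately have "L-lipschitz_on UNIV \<Phi>"
    by (intro bounded_derivative_imp_lipschitz[where f'="?D"]) (auto intro: Ck1_derivative(1)[OF C])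
  then show ?thesis ..
qed

text \<open>
  For Borel functions the integrals in the definitions of both variations are Borel integrals.
\<close>

lemma lebesgue_integral_divergence:
  assumes "f \<in> borel_measurable borel" "Ck 1 \<Phi>"
  shows "(LINT x|lebesgue. f x * divergence \<Phi> x) = pairing f \<Phi>"
  unfolding pairing_def
  by (rule integral_completion)
     (use assms borel_measurable_continuous_onI[OF continuous_divergence[OF assms(2)]] in simp)

lemma pairing_le_classical_variation:
  assumes f: "f \<in> borel_measurable borel" and \<Phi>: "test_field U \<Phi>" "\<And>x. norm (\<Phi> x) \<le> 1"
  shows "ennreal (pairing f \<Phi>) \<le> classical_variation f U"
  unfolding classical_variation_def
  by (rule SUP_upper2[of \<Phi>])
     (use \<Phi> lebesgue_integral_divergence[OF f, of \<Phi>] in \<open>auto simp: test_field_def\<close>)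

lemma pairing_le_weighted_variation:
  assumes f: "f \<in> borel_measurable borel" and \<Phi>: "test_field U \<Phi>" "\<And>x. ennreal (norm (\<Phi> x)) \<le> v x"
  shows "ennreal (pairing f \<Phi>) \<le> weighted_variation v f"
  unfolding weighted_variation_def
  by (rule SUP_upper2[of \<Phi>])
     (use \<Phi> test_field_lipschitz[OF \<Phi>(1)] lebesgue_integral_divergence[OF f, of \<Phi>] in \<open>auto simp: test_field_def compact_support_in_def\<close>)

lemma scaled_pairing_le_weighted_variation:
  assumes f: "f \<in> borel_measurable borel" and \<Phi>: "test_field U \<Phi>"
    and c: "0 < c" "\<And>x. ennreal (norm (\<Phi> x)) \<le> ennreal c * v x"
  shows "ennreal (pairing f \<Phi>) \<le> ennreal c * weighted_variation v f"
proof -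
  have "ennreal (norm (inverse c *\<^sub>R \<Phi> x)) \<le> v x" for x
  proof -
    have "ennreal (norm (inverse c *\<^sub>R \<Phi> x)) = ennreal (inverse c) * ennreal (norm (\<Phi> x))"
      using c by (simp add: ennreal_mult')
    also have "\<dots> \<le> ennreal (inverse c) * (ennreal c * v x)" using c(2) by (intro mult_left_mono) auto
    also have "\<dots> = v x" using c(1) by (simp add: mult.assoc[symmetric] ennreal_mult'[symmetric])
    finally show ?thesis .
  qed
  then have "ennreal (inverse c * pairing f \<Phi>) \<le> weighted_variation v f"
    using pairing_le_weighted_variation[OF f test_field_scaleR[OF \<Phi>], of "inverse c" v]
      \<Phi> by (simp add: pairing_scaleR test_field_def)
  then have "ennreal c * ennreal (inverse c * pairing f \<Phi>) \<le> ennreal c * weighted_variation v f"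
    by (intro mult_left_mono) auto
  then show ?thesis using c(1) by (simp add: ennreal_mult'[symmetric] mult.assoc[symmetric])
qed

lemma scaled_pairing_le_classical_variation:
  assumes f: "f \<in> borel_measurable borel" and \<Phi>: "test_field U \<Phi>"
    and c: "0 \<le> c" "\<And>x. norm (\<Phi> x) \<le> c"
  shows "ennreal (pairing f \<Phi>) \<le> ennreal c * classical_variation f U"
proof (cases "c = 0")
  case True
  then have "\<Phi> = (\<lambda>x. 0)" using c(2) by (intro ext) (metis norm_le_zero_iff)
  then have "pairing f \<Phi> = pairing f (\<lambda>x. 0 *\<^sub>R \<Phi> x)" by simp
  also have "\<dots> = 0" using \<Phi> by (subst pairing_scaleR) (auto simp: test_field_def)
  finally show ?thesis by simp
next
  case False
  then have c0: "0 < c" using c by simp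
  have "norm (inverse c *\<^sub>R \<Phi> x) \<le> 1" for x
    using c(2)[of x] c0 by (simp add: field_simps)
  then have "ennreal (inverse c * pairing f \<Phi>) \<le> classical_variation f U"
    using pairing_le_classical_variation[OF f test_field_scaleR[OF \<Phi>], of "inverse c"]
      \<Phi> by (simp add: pairing_scaleR test_field_def)
  then have "ennreal c * ennreal (inverse c * pairing f \<Phi>) \<le> ennreal c * classical_variation f U"
    by (intro mult_left_mono) auto
  then show ?thesis using c0 by (simp add: ennreal_mult'[symmetric] mult.assoc[symmetric])
qed

section \<open>Localisation and duality\<close>

lemma continuous_compact_support_bounded:
  fixes \<psi> :: "'a::euclidean_space \<Rightarrow> 'b::euclidean_space"
  assumes "continuous_on UNIV \<psi>" "compact_support_in \<psi> U"
  obtains M R where "\<And>x. norm (\<psi> x) \<le> M" "\<And>x. R < norm x \<Longrightarrow> \<psi> x = 0"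
proof -
  obtain R where R: "\<And>x. R \<le> norm x \<Longrightarrow> \<psi> x = 0" using compact_support_vanishes[OF assms(2)] by blast
  obtain M where "\<And>x. norm (\<psi> x) \<le> M"
    using continuous_vanishing_bounded[OF assms(1), where r=R] R by blast
  then show thesis using that[of M R] R by auto
qed

text \<open>
  Moving the mollifier to \<open>f\<close> turns the claim into the local \<open>L\<^sup>1\<close> convergence of \<open>\<rho>\<^sub>\<epsilon> * f\<close>, tested with
  the bounded compactly supported function \<open>div \<Phi>\<close>.
\<close>

lemma pairing_mollified_tendsto:
  fixes \<Phi> :: "'a::euclidean_space \<Rightarrow> 'a"
  assumes f: "loc_int f" and \<Phi>: "test_field U \<Phi>" and e: "\<And>m. 0 < e m" "e \<longlonglongrightarrow> 0"
  shows "(\<lambda>m. pairing f (conv (mollifier (e m)) \<Phi>)) \<longlonglongrightarrow> pairing f \<Phi>"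
proof -
  have C: "Ck 1 \<Phi>" and S: "compact_support_in \<Phi> U" using \<Phi> by (auto simp: test_field_def)
  have c\<Phi>: "continuous_on UNIV \<Phi>" by (rule Ck1_derivative(4)[OF C])
  obtain M0 R0 where MR: "\<And>x. norm (\<Phi> x) \<le> M0" "\<And>x. R0 < norm x \<Longrightarrow> \<Phi> x = 0"
    using continuous_compact_support_bounded[OF c\<Phi> S] by blast
  let ?f = "\<lambda>m. conv (mollifier (e m)) f"
  have lf: "loc_int (?f m)" for m
    by (intro loc_int_continuous continuous_conv[OF kernel_mollifier] e f)
  have eq: "pairing f (conv (mollifier (e m)) \<Phi>) = pairing (?f m) \<Phi>" for m
    unfolding pairing_mollified_function[OF e(1) f C S]
    by (rule pairing_mollified_field[OF e(1) f borel_measurable_continuous_onI[OF c\<Phi>] MR])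
  obtain R where R: "\<And>x. R \<le> norm x \<Longrightarrow> \<Phi> x = 0" using compact_support_vanishes[OF S] by blast
  have z: "divergence \<Phi> x = 0" if "R + 1 \<le> norm x" for x
    by (rule divergence_vanishes[OF C R that])
  obtain M where M: "0 \<le> M" "\<And>x. norm (divergence \<Phi> x) \<le> M"
    using continuous_vanishing_bounded[OF continuous_divergence[OF C], where r="R+1"] z by blast
  have bd: "ennreal (norm (pairing (?f m) \<Phi> - pairing f \<Phi>))
      \<le> ennreal M * (\<integral>\<^sup>+x\<in>cball 0 (R+1). norm (?f m x - f x) \<partial>lborel)" for m
  proof -
    note [measurable] = loc_int_measurable[OF f] loc_int_measurable[OF lf]
    have [measurable]: "cball (0::'a) (R + 1) \<in> sets borel" by simp
    have i: "integrable lborel (\<lambda>x. ?f m x * divergence \<Phi> x)" "integrable lborel (\<lambda>x. f x * divergence \<Phi> x)"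
      by (rule pairing_integrable[OF lf C S] pairing_integrable[OF f C S])+
    have "pairing (?f m) \<Phi> - pairing f \<Phi> = (LINT x|lborel. ?f m x * divergence \<Phi> x - f x * divergence \<Phi> x)"
      unfolding pairing_def by (rule Bochner_Integration.integral_diff[OF i, symmetric])
    also have "ennreal (norm \<dots>) \<le> (\<integral>\<^sup>+x. norm (?f m x * divergence \<Phi> x - f x * divergence \<Phi> x) \<partial>lborel)"
      by (intro integral_norm_bound_ennreal Bochner_Integration.integrable_diff i)
    also have "\<dots> \<le> (\<integral>\<^sup>+x. ennreal M * (ennreal (norm (?f m x - f x)) * indicator (cball 0 (R+1)) x) \<partial>lborel)"
    proof (rule nn_integral_mono)
      fix x
      show "ennreal (norm (?f m x * divergence \<Phi> x - f x * divergence \<Phi> x))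
        \<le> ennreal M * (ennreal (norm (?f m x - f x)) * indicator (cball 0 (R+1)) x)"
      proof (cases "x \<in> cball 0 (R+1)")
        case True
        have "norm (?f m x * divergence \<Phi> x - f x * divergence \<Phi> x) = norm (divergence \<Phi> x) * norm (?f m x - f x)"
          by (simp add: abs_mult[symmetric] algebra_simps)
        also have "\<dots> \<le> M * norm (?f m x - f x)" by (intro mult_right_mono M) auto
        finally show ?thesis using True M(1) by (simp add: ennreal_mult[symmetric] ennreal_leI)
      next
        case False then show ?thesis using z[of x] by simp
      qed
    qed
    also have "\<dots> = ennreal M * (\<integral>\<^sup>+x\<in>cball 0 (R+1). norm (?f m x - f x) \<partial>lborel)"
      by (rule nn_integral_cmult) simp
    finally show ?thesis .
  qed
  have "(\<lambda>m. ennreal M * (\<integral>\<^sup>+x\<in>cball 0 (R+1). norm (?f m x - f x) \<partial>lborel)) \<longlonglongrightarrow> ennreal M * 0"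
    by (intro ennreal_tendsto_cmult conv_tendsto_L1_loc f e) simp
  then have up: "(\<lambda>m. ennreal M * (\<integral>\<^sup>+x\<in>cball 0 (R+1). norm (?f m x - f x) \<partial>lborel)) \<longlonglongrightarrow> 0"
    by simp
  have "(\<lambda>m. ennreal (norm (pairing (?f m) \<Phi> - pairing f \<Phi>))) \<longlonglongrightarrow> 0"
    by (rule tendsto_sandwich[OF always_eventually always_eventually tendsto_const up]) (simp_all only: bd zero_le simp_thms)
  then have "(\<lambda>m. norm (pairing (?f m) \<Phi> - pairing f \<Phi>)) \<longlonglongrightarrow> 0"
    by (subst (asm) ennreal_tendsto_0_iff) simp_all
  then show ?thesis unfolding eq by (rule LIM_zero_cancel[OF tendsto_norm_zero_cancel])
qed

lemma conv_sum:
  fixes \<psi> :: "'i \<Rightarrow> 'a::euclidean_space \<Rightarrow> 'b::euclidean_space"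
  assumes "kernel k e" "\<And>i. i \<in> I \<Longrightarrow> loc_int (\<psi> i)"
  shows "conv k (\<lambda>y. \<Sum>i\<in>I. \<psi> i y) x = (\<Sum>i\<in>I. conv k (\<psi> i) x)"
  unfolding conv_def scaleR_sum_right
  by (rule Bochner_Integration.integral_sum) (rule kernel_integrable[OF assms(1) assms(2)])

text \<open>
  A smooth field may be cut into pieces that are only continuous: mollifying the pieces makes them
  admissible for the variations on the open sets \<open>U i\<close>, since compact supports in \<open>U i\<close> stay in \<open>U i\<close> for
  small parameters, and their sum is the mollified field, whose pairing converges.
\<close>

theorem pairing_le_sum_variations:
  fixes \<Phi> :: "'a::euclidean_space \<Rightarrow> 'a" and \<psi> :: "'i \<Rightarrow> 'a \<Rightarrow> 'a"
  assumes f: "loc_int f" and \<Phi>: "test_field UNIV \<Phi>" and I: "finite I"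
    and sum: "\<And>x. \<Phi> x = (\<Sum>i\<in>I. \<psi> i x)"
    and cont: "\<And>i. i \<in> I \<Longrightarrow> continuous_on UNIV (\<psi> i)"
    and supp: "\<And>i. i \<in> I \<Longrightarrow> open (U i) \<and> compact_support_in (\<psi> i) (U i)"
    and c: "\<And>i x. i \<in> I \<Longrightarrow> norm (\<psi> i x) \<le> c i"
  shows "ennreal (pairing f \<Phi>) \<le> (\<Sum>i\<in>I. ennreal (c i) * classical_variation f (U i))"
proof -
  define e where "e m = inverse (real (Suc m))" for m
  have e: "0 < e m" for m by (simp add: e_def)
  have e0: "e \<longlonglongrightarrow> 0" unfolding e_def by (rule LIMSEQ_inverse_real_of_nat)
  have l\<psi>: "loc_int (\<psi> i)" if "i \<in> I" for i by (rule loc_int_continuous[OF cont[OF that]])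
  have "\<forall>i\<in>I. \<forall>\<^sub>F m in sequentially. test_field (U i) (conv (mollifier (e m)) (\<psi> i))"
  proof
    fix i assume i: "i \<in> I"
    let ?K = "closure {x. \<psi> i x \<noteq> 0}"
    have K: "compact ?K" "?K \<subseteq> U i" "open (U i)"
      using supp[OF i] by (auto simp: compact_support_in_def)
    obtain r where r: "0 < r" "(\<Union>x\<in>?K. cball x r) \<subseteq> U i"
      using compact_subset_open_imp_cball_epsilon_subset[OF K(1,3,2)] .
    have "\<forall>\<^sub>F m in sequentially. e m < r" using e0 r(1) by (intro order_tendstoD) auto
    then show "\<forall>\<^sub>F m in sequentially. test_field (U i) (conv (mollifier (e m)) (\<psi> i))"
    proof eventually_elim
      case (elim m)
      have "(\<Union>x\<in>?K. cball x (e m)) \<subseteq> U i" using r(2) elim by fastforce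
      then have "compact_support_in (conv (mollifier (e m)) (\<psi> i)) (U i)"
        by (intro compact_support_in_conv[OF K(1) _ e]) (rule subsetD[OF closure_subset], simp)
      then show ?case unfolding test_field_def using Ck1_conv[OF e l\<psi>[OF i]] by blast
    qed
  qed
  then have "\<forall>\<^sub>F m in sequentially. \<forall>i\<in>I. test_field (U i) (conv (mollifier (e m)) (\<psi> i))"
    using I by (simp add: eventually_ball_finite_distrib)
  then have ev: "\<forall>\<^sub>F m in sequentially. ennreal (pairing f (conv (mollifier (e m)) \<Phi>))
      \<le> (\<Sum>i\<in>I. ennreal (c i) * classical_variation f (U i))"
  proof eventually_elim
    case (elim m)
    have \<Phi>eq: "\<Phi> = (\<lambda>x. \<Sum>i\<in>I. \<psi> i x)" using sum by blast
    have "conv (mollifier (e m)) \<Phi> = (\<lambda>x. \<Sum>i\<in>I. conv (mollifier (e m)) (\<psi> i) x)"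
      unfolding \<Phi>eq by (rule ext, rule conv_sum[OF kernel_mollifier[OF e] l\<psi>])
    then have "pairing f (conv (mollifier (e m)) \<Phi>) = (\<Sum>i\<in>I. pairing f (conv (mollifier (e m)) (\<psi> i)))"
      using pairing_sum[OF f, of I UNIV] elim test_field_mono[OF _ subset_UNIV] by metis
    also have "ennreal \<dots> \<le> ennreal (\<Sum>i\<in>I. max 0 (pairing f (conv (mollifier (e m)) (\<psi> i))))"
      by (intro ennreal_leI sum_mono) simp
    also have "\<dots> = (\<Sum>i\<in>I. ennreal (pairing f (conv (mollifier (e m)) (\<psi> i))))"
    proof -
      have "ennreal (max 0 r) = ennreal r" for r :: real by (simp add: max_def ennreal_neg)
      moreover have "(\<Sum>i\<in>I. ennreal (max 0 (pairing f (conv (mollifier (e m)) (\<psi> i)))))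
          = ennreal (\<Sum>i\<in>I. max 0 (pairing f (conv (mollifier (e m)) (\<psi> i))))"
        by (rule sum_ennreal) simp
      ultimately show ?thesis by simp
    qed
    also have "\<dots> \<le> (\<Sum>i\<in>I. ennreal (c i) * classical_variation f (U i))"
    proof (rule sum_mono)
      fix i assume i: "i \<in> I"
      have "0 \<le> c i" using c[OF i] norm_ge_zero order_trans by blast
      then show "ennreal (pairing f (conv (mollifier (e m)) (\<psi> i))) \<le> ennreal (c i) * classical_variation f (U i)"
        using elim i conv_norm_le_const[OF e l\<psi>[OF i] c[OF i]] loc_int_measurable[OF f]
        by (intro scaled_pairing_le_classical_variation) auto
    qed
    finally show ?case .
  qed
  have "(\<lambda>m. ennreal (pairing f (conv (mollifier (e m)) \<Phi>))) \<longlonglongrightarrow> ennreal (pairing f \<Phi>)"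
    by (intro tendsto_ennrealI pairing_mollified_tendsto[OF f \<Phi> e e0])
  then show ?thesis using ev by (rule tendsto_upperbound) simp
qed

text \<open>
  The extremal field is \<open>-u \<nabla>f\<^sub>\<epsilon> / \<bar>\<nabla>f\<^sub>\<epsilon>\<bar>\<close>, made bounded and compactly supported by truncating
  \<open>u\<close> at height \<open>k\<close> and the space at radius \<open>k\<close>.
\<close>

theorem mollified_gradient_duality:
  fixes u :: "'a::euclidean_space \<Rightarrow> ennreal"
  assumes e: "0 < e" and f: "loc_int f" and u[measurable]: "u \<in> borel_measurable borel"
    and K: "\<And>\<Phi>. test_field UNIV \<Phi> \<Longrightarrow>
      (\<And>x. ennreal (norm (\<Phi> x)) \<le> (\<integral>\<^sup>+y. ennreal (mollifier e (x - y)) * u y \<partial>lborel)) \<Longrightarrow>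
      ennreal (pairing f \<Phi>) \<le> K"
  shows "(\<integral>\<^sup>+x. ennreal (norm (moll_gradient e f x)) * u x \<partial>lborel) \<le> K"
proof -
  let ?G = "moll_gradient e f"
  have cG: "continuous_on UNIV ?G" by (rule continuous_moll_gradient[OF e f])
  have [measurable]: "?G \<in> borel_measurable borel" by (rule borel_measurable_continuous_onI[OF cG])
  \<comment> \<open>the truncated size of the extremal field; \<open>enn2real\<close> is harmless since the minimum is finite\<close>
  define c where "c k x = (if norm x \<le> real k then enn2real (min (u x) (of_nat k)) else 0)" for k x
  have [measurable]: "c k \<in> borel_measurable borel" for k unfolding c_def[abs_def] by measurable
  have c: "ennreal (c k x) = (if norm x \<le> real k then min (u x) (of_nat k) else 0)" for k x
    unfolding c_def by (auto simp: min_def ennreal_enn2real_if top_unique of_nat_less_top[THEN less_imp_neq])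
  have c0: "0 \<le> c k x" for k x by (simp add: c_def)
  have ck: "c k x \<le> real k" for k x
  proof -
    have "ennreal (c k x) \<le> ennreal (real k)" unfolding c by (auto simp: ennreal_of_nat_eq_real_of_nat)
    then show ?thesis by simp
  qed
  have cu: "ennreal (c k x) \<le> u x" for k x unfolding c by auto
  define \<psi> where "\<psi> k x = (- c k x / norm (?G x)) *\<^sub>R ?G x" for k x
  have [measurable]: "\<psi> k \<in> borel_measurable borel" for k unfolding \<psi>_def[abs_def] by measurable
  have n\<psi>: "norm (\<psi> k x) \<le> c k x" for k x using c0[of k x] by (simp add: \<psi>_def)
  have l\<psi>: "loc_int (\<psi> k)" for k
    by (rule loc_int_bounded_measurable[where M="real k"]) (simp, rule order_trans[OF n\<psi> ck])
  have \<psi>G: "\<psi> k x \<bullet> ?G x = - (c k x * norm (?G x))" for k x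
    by (cases "?G x = 0") (auto simp: \<psi>_def dot_square_norm power2_eq_square)
  have \<psi>0: "\<psi> k x = 0" if "real k < norm x" for k x using that unfolding \<psi>_def c_def by simp
  have le: "(\<integral>\<^sup>+x. ennreal (norm (?G x)) * ennreal (c k x) \<partial>lborel) \<le> K" for k
  proof -
    have "integrable lborel (\<lambda>x. c k x * norm (?G x))"
    proof (rule loc_int_dominated(1)[OF loc_int_continuous[OF cG], where M="real k" and r="real k" and x=0])
      show "norm (c k y * norm (?G y)) \<le> real k * norm (?G y)" for y
        using mult_right_mono[OF ck[of k y] norm_ge_zero] c0[of k y] by (simp add: abs_mult)
      show "real k < dist 0 y \<Longrightarrow> c k y * norm (?G y) = 0" for y
        by (simp add: c_def)
    qed measurable
    then have "(\<integral>\<^sup>+x. ennreal (c k x * norm (?G x)) \<partial>lborel) = ennreal (LINT x|lborel. c k x * norm (?G x))"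
      by (rule nn_integral_eq_integral) (simp add: c0)
    also have "(LINT x|lborel. c k x * norm (?G x)) = pairing f (conv (mollifier e) (\<psi> k))"
      using pairing_mollified_field[OF e f, of "\<psi> k" "real k" "real k"] \<psi>0 order_trans[OF n\<psi> ck]
      by (simp add: \<psi>G)
    also have "ennreal \<dots> \<le> K"
    proof (rule K)
      have "compact_support_in (conv (mollifier e) (\<psi> k)) UNIV"
        by (rule compact_support_in_conv[OF compact_cball[of 0 "real k"] _ e]) (use \<psi>0 in \<open>force simp: not_le[symmetric]\<close>)+
      then show "test_field UNIV (conv (mollifier e) (\<psi> k))"
        unfolding test_field_def using Ck1_conv[OF e l\<psi>] by blast
      show "ennreal (norm (conv (mollifier e) (\<psi> k) x)) \<le> (\<integral>\<^sup>+y. ennreal (mollifier e (x - y)) * u y \<partial>lborel)" for x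
        by (rule conv_norm_bound[OF _ u e l\<psi>]) (simp, rule order_trans[OF ennreal_leI[OF n\<psi>] cu])
    qed
    finally show ?thesis by (simp add: ennreal_mult[OF c0] mult.commute)
  qed
  show ?thesis
  proof (rule nn_integral_le_of_tendsto[OF _ _ le tendsto_const])
    show "AE x in lborel. (\<lambda>k. ennreal (norm (?G x)) * ennreal (c k x)) \<longlonglongrightarrow> ennreal (norm (?G x)) * u x"
    proof (intro AE_I2 ennreal_tendsto_cmult)
      fix x
      have "(\<lambda>k. min (u x) (of_nat k)) \<longlonglongrightarrow> min (u x) top"
        by (intro tendsto_min tendsto_const of_nat_tendsto_top_ennreal)
      moreover have "\<forall>\<^sub>F k in sequentially. min (u x) (of_nat k) = ennreal (c k x)"
        using eventually_ge_at_top[of "nat \<lceil>norm x\<rceil>"]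
        by eventually_elim (auto simp: c nat_ceiling_le_eq)
      ultimately show "(\<lambda>k. ennreal (c k x)) \<longlonglongrightarrow> u x"
        using Lim_transform_eventually by fastforce
    qed simp
  qed simp
qed

section \<open>The total variation measure\<close>

lemma classical_variation_eq:
  assumes f: "f \<in> borel_measurable borel"
  shows "classical_variation f U = (SUP \<Phi>\<in>{\<Phi>. test_field U \<Phi> \<and> (\<forall>x. norm (\<Phi> x) \<le> 1)}. ennreal (pairing f \<Phi>))"
proof -
  have "{\<Phi>. Ck 1 \<Phi> \<and> compact_support_in \<Phi> U \<and> (\<forall>x. norm (\<Phi> x) \<le> 1)} = {\<Phi>. test_field U \<Phi> \<and> (\<forall>x. norm (\<Phi> x) \<le> 1)}"
    unfolding test_field_def by blast
  then show ?thesis unfolding classical_variation_def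
    by (intro SUP_cong) (simp_all add: lebesgue_integral_divergence[OF f] test_field_def)
qed

lemma classical_variation_mono:
  "U \<subseteq> V \<Longrightarrow> classical_variation f U \<le> classical_variation f V"
  unfolding classical_variation_def
  by (rule SUP_subset_mono) (use compact_support_in_mono in blast)+

text \<open>
  Because \<open>ennreal\<close> sends negative numbers to \<open>0\<close>, a sum of truncated pairings is the pairing of the sum
  over those fields whose pairing is nonnegative.
\<close>

lemma sum_ennreal_pairing:
  assumes f: "loc_int f" and I: "finite I" "\<And>i. i \<in> I \<Longrightarrow> test_field U (\<Phi> i)"
  obtains J where "J \<subseteq> I" "(\<Sum>i\<in>I. ennreal (pairing f (\<Phi> i))) = ennreal (pairing f (\<lambda>x. \<Sum>i\<in>J. \<Phi> i x))"
proof -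
  let ?J = "{i\<in>I. 0 \<le> pairing f (\<Phi> i)}"
  have "(\<Sum>i\<in>I. ennreal (pairing f (\<Phi> i))) = (\<Sum>i\<in>?J. ennreal (pairing f (\<Phi> i)))"
    using I(1) by (intro sum.mono_neutral_right) (auto, meson ennreal_neg linear)
  also have "\<dots> = ennreal (\<Sum>i\<in>?J. pairing f (\<Phi> i))" by (rule sum_ennreal) simp
  also have "\<dots> = ennreal (pairing f (\<lambda>x. \<Sum>i\<in>?J. \<Phi> i x))"
    by (subst pairing_sum[OF f, of ?J U]) (use I(2) in auto)
  finally show thesis using that[of ?J] by blast
qed

lemma classical_variation_empty: "f \<in> borel_measurable borel \<Longrightarrow> classical_variation f {} = 0"
proof -
  assume f: "f \<in> borel_measurable borel"
  have "ennreal (pairing f \<Phi>) \<le> 0" if "test_field {} \<Phi>" for \<Phi>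
  proof -
    have "norm (\<Phi> x) \<le> 0" for x using test_field_eq_0[OF that, of x] by simp
    then show ?thesis using scaled_pairing_le_classical_variation[OF f that, of 0] by simp
  qed
  then show ?thesis unfolding classical_variation_eq[OF f] by (auto intro!: antisym SUP_least)
qed

text \<open>
  Let \<open>K\<close> be the support of \<open>\<Phi>\<close>. The compact set \<open>K - V\<close> lies in \<open>U\<close>, and a cutoff \<open>g\<close> that is \<open>1\<close> near \<open>K - V\<close>
  and \<open>0\<close> away from it splits \<open>\<Phi>\<close> into \<open>g \<Phi>\<close>, supported in \<open>U\<close>, and \<open>(1 - g) \<Phi>\<close>, supported in \<open>V\<close>.
\<close>

lemma classical_variation_Un:
  fixes f :: "'a::euclidean_space \<Rightarrow> real"
  assumes f: "loc_int f" and UV: "open U" "open V"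
  shows "classical_variation f (U \<union> V) \<le> classical_variation f U + classical_variation f V"
  unfolding classical_variation_eq[OF loc_int_measurable[OF f], of "U \<union> V"]
proof (rule SUP_least, clarify)
  fix \<Phi> :: "'a \<Rightarrow> 'a" assume \<Phi>: "test_field (U \<union> V) \<Phi>" and n1: "\<forall>x. norm (\<Phi> x) \<le> 1"
  let ?K = "closure {x. \<Phi> x \<noteq> 0}"
  have K: "compact ?K" "?K \<subseteq> U \<union> V" using \<Phi> by (auto simp: test_field_def compact_support_in_def)
  have inK: "\<Phi> x \<noteq> 0 \<Longrightarrow> x \<in> ?K" for x by (rule subsetD[OF closure_subset]) simp
  have c\<Phi>: "continuous_on UNIV \<Phi>" using \<Phi> Ck1_derivative(4) unfolding test_field_def by blast
  let ?A = "?K - V"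
  show "ennreal (pairing f \<Phi>) \<le> classical_variation f U + classical_variation f V"
  proof (cases "?A = {}")
    case True
    then have "test_field V \<Phi>" using \<Phi> K by (auto simp: test_field_def compact_support_in_def simp del: Ck.simps)
    then have "ennreal (pairing f \<Phi>) \<le> classical_variation f V"
      using n1 by (intro pairing_le_classical_variation loc_int_measurable[OF f]) auto
    then show ?thesis by (simp add: add_increasing)
  next
    case False
    have A: "compact ?A" "?A \<subseteq> U" using K compact_diff[OF K(1) UV(2)] by auto
    obtain r where r: "0 < r" "(\<Union>x\<in>?A. cball x r) \<subseteq> U"
      using compact_subset_open_imp_cball_epsilon_subset[OF A(1) UV(1) A(2)] .
    \<comment> \<open>equal to \<open>1\<close> within distance \<open>r/2\<close> of \<open>K - V\<close> and to \<open>0\<close> beyond distance \<open>r\<close>\<close>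
    define g where "g x = max 0 (min 1 (2 - 2 * infdist x ?A / r))" for x
    have g: "continuous_on UNIV g" "\<And>x. 0 \<le> g x" "\<And>x. g x \<le> 1"
      unfolding g_def using r(1) by (auto intro!: continuous_intros)
    define \<psi> where "\<psi> b x = (if b then g x else 1 - g x) *\<^sub>R \<Phi> x" for b x
    have "ennreal (pairing f \<Phi>) \<le> (\<Sum>b\<in>UNIV. ennreal 1 * classical_variation f (if b then U else V))"
    proof (rule pairing_le_sum_variations[OF f test_field_mono[OF \<Phi> subset_UNIV], where \<psi>=\<psi>])
      show "\<Phi> x = (\<Sum>b\<in>UNIV. \<psi> b x)" for x
        by (simp add: UNIV_bool \<psi>_def scaleR_left.add[symmetric])
      show "continuous_on UNIV (\<psi> b)" for b
        unfolding \<psi>_def[abs_def] by (cases b) (auto intro!: continuous_intros g c\<Phi>)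
      show "norm (\<psi> b x) \<le> 1" for b x
        using g(2,3)[of x] n1[rule_format, of x] mult_le_one[of "g x" "norm (\<Phi> x)"] mult_le_one[of "1 - g x" "norm (\<Phi> x)"]
        by (simp add: \<psi>_def)
      have "compact_support_in (\<psi> True) U"
      proof (rule compact_support_in_subset)
        show "compact (?K \<inter> {x. infdist x ?A \<le> r})"
          by (intro compact_Int_closed K closed_Collect_le continuous_intros)
        show "?K \<inter> {x. infdist x ?A \<le> r} \<subseteq> U"
        proof
          fix x assume "x \<in> ?K \<inter> {x. infdist x ?A \<le> r}"
          moreover obtain y where y: "y \<in> ?A" "infdist x ?A = dist x y"
            using infdist_attains_inf[OF compact_imp_closed[OF A(1)] False] by blast
          ultimately have "x \<in> cball y r" by (simp add: dist_commute)
          then show "x \<in> U" using r(2) y(1) by blast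
        qed
        fix x assume x: "\<psi> True x \<noteq> 0"
        then have "g x \<noteq> 0" "\<Phi> x \<noteq> 0" by (auto simp: \<psi>_def)
        then have "infdist x ?A \<le> r" using r(1) by (auto simp: g_def max_def field_simps split: if_splits)
        then show "x \<in> ?K \<inter> {x. infdist x ?A \<le> r}" using inK \<open>\<Phi> x \<noteq> 0\<close> by blast
      qed
      moreover have "compact_support_in (\<psi> False) V"
      proof (rule compact_support_in_subset)
        show "compact (?K \<inter> {x. r/2 \<le> infdist x ?A})"
          by (intro compact_Int_closed K closed_Collect_le continuous_intros)
        show "?K \<inter> {x. r/2 \<le> infdist x ?A} \<subseteq> V"
        proof
          fix x assume x: "x \<in> ?K \<inter> {x. r/2 \<le> infdist x ?A}"
          show "x \<in> V"
          proof (rule ccontr)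
            assume "x \<notin> V"
            then have "x \<in> ?A" using x by blast
            then have "infdist x ?A = 0" by (rule infdist_zero)
            then show False using x r(1) by simp
          qed
        qed
        fix x assume x: "\<psi> False x \<noteq> 0"
        then have "g x \<noteq> 1" "\<Phi> x \<noteq> 0" by (auto simp: \<psi>_def)
        then have "r/2 \<le> infdist x ?A" using r(1) by (auto simp: g_def max_def min_def field_simps split: if_splits)
        then show "x \<in> ?K \<inter> {x. r/2 \<le> infdist x ?A}" using inK \<open>\<Phi> x \<noteq> 0\<close> by blast
      qed
      ultimately show "open (if b then U else V) \<and> compact_support_in (\<psi> b) (if b then U else V)" for b
        using UV by (cases b) auto
    qed simp
    then show ?thesis by (simp add: UNIV_bool add.commute)
  qed
qed

lemma classical_variation_UN_lessThan:
  fixes f :: "'a::euclidean_space \<Rightarrow> real"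
  assumes f: "loc_int f" and U: "\<And>i. open (U i)"
  shows "classical_variation f (\<Union>i<n. U i) \<le> (\<Sum>i<n::nat. classical_variation f (U i))"
proof (induction n)
  case 0
  then show ?case by (simp add: classical_variation_empty loc_int_measurable[OF f])
next
  case (Suc n)
  have "classical_variation f (\<Union>i<Suc n. U i) = classical_variation f ((\<Union>i<n. U i) \<union> U n)"
    by (simp add: lessThan_Suc Un_commute)
  also have "\<dots> \<le> classical_variation f (\<Union>i<n. U i) + classical_variation f (U n)"
    by (rule classical_variation_Un[OF f]) (use U in auto)
  also have "\<dots> \<le> (\<Sum>i<Suc n. classical_variation f (U i))" using Suc by (simp add: add_mono)
  finally show ?case .
qed

text \<open>
  The support of a test field is compact, so finitely many of the open sets suffice.
\<close>

lemma classical_variation_UN: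
  fixes f :: "'a::euclidean_space \<Rightarrow> real"
  assumes f: "loc_int f" and U: "\<And>i::nat. open (U i)"
  shows "classical_variation f (\<Union>i. U i) \<le> (\<Sum>i. classical_variation f (U i))"
  unfolding classical_variation_eq[OF loc_int_measurable[OF f], of "\<Union>i. U i"]
proof (rule SUP_least, clarify)
  fix \<Phi> :: "'a \<Rightarrow> 'a" assume \<Phi>: "test_field (\<Union>i. U i) \<Phi>" and n1: "\<forall>x. norm (\<Phi> x) \<le> 1"
  let ?K = "closure {x. \<Phi> x \<noteq> 0}"
  have K: "compact ?K" "?K \<subseteq> (\<Union>i. U i)" using \<Phi> by (auto simp: test_field_def compact_support_in_def)
  obtain I where I: "finite I" "?K \<subseteq> (\<Union>i\<in>I. U i)"
    using compactE_image[OF K(1), of UNIV U] U K(2) by auto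
  then obtain n where "I \<subseteq> {..<n}" by (meson finite_nat_bounded)
  then have "?K \<subseteq> (\<Union>i<n. U i)" using I(2) by blast
  then have "test_field (\<Union>i<n. U i) \<Phi>" using \<Phi> by (simp add: test_field_def compact_support_in_def del: Ck.simps)
  then have "ennreal (pairing f \<Phi>) \<le> classical_variation f (\<Union>i<n. U i)"
    using n1 by (intro pairing_le_classical_variation loc_int_measurable[OF f]) auto
  also have "\<dots> \<le> (\<Sum>i<n. classical_variation f (U i))" by (rule classical_variation_UN_lessThan[OF f U])
  also have "\<dots> \<le> (\<Sum>i. classical_variation f (U i))" by (rule sum_le_suminf) auto
  finally show "ennreal (pairing f \<Phi>) \<le> (\<Sum>i. classical_variation f (U i))" .
qed

text \<open>
  The set function that occurs in the definition of \<open>variation_measure\<close>.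
\<close>

definition outer_variation :: "('a::euclidean_space \<Rightarrow> real) \<Rightarrow> 'a set \<Rightarrow> ennreal" where
  "outer_variation f A = (INF U \<in> {U. open U \<and> A \<subseteq> U}. classical_variation f U)"

lemma outer_variation_le: "open U \<Longrightarrow> A \<subseteq> U \<Longrightarrow> outer_variation f A \<le> classical_variation f U"
  unfolding outer_variation_def by (rule INF_lower) simp

lemma outer_variation_open: "open U \<Longrightarrow> outer_variation f U = classical_variation f U"
  unfolding outer_variation_def
  by (intro antisym INF_greatest INF_lower classical_variation_mono) auto

lemma outer_variation_mono: "A \<subseteq> B \<Longrightarrow> outer_variation f A \<le> outer_variation f B"
  unfolding outer_variation_def by (rule INF_superset_mono) auto

text \<open>
  A field supported in a compact \<open>K \<subseteq> V \<inter> U\<close> and one supported in the open set \<open>V - K\<close>, which contains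
  \<open>V - U\<close>, have disjoint supports, so their sum is still bounded by \<open>1\<close>.
\<close>

lemma classical_variation_superadditive:
  fixes f :: "'a::euclidean_space \<Rightarrow> real"
  assumes f: "loc_int f" and UV: "open U" "open V"
  shows "classical_variation f (V \<inter> U) + outer_variation f (V - U) \<le> classical_variation f V"
proof -
  note fb = loc_int_measurable[OF f]
  have key: "ennreal (pairing f \<Phi>) + outer_variation f (V - U) \<le> classical_variation f V"
    if \<Phi>: "test_field (V \<inter> U) \<Phi>" "\<forall>x. norm (\<Phi> x) \<le> 1" for \<Phi>
  proof -
    let ?K = "closure {x. \<Phi> x \<noteq> 0}"
    have K: "compact ?K" "?K \<subseteq> V \<inter> U" using \<Phi> by (auto simp: test_field_def compact_support_in_def)
    have inK: "\<Phi> x \<noteq> 0 \<Longrightarrow> x \<in> ?K" for x by (rule subsetD[OF closure_subset]) simp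
    have W: "open (V - ?K)" "V - U \<subseteq> V - ?K" using UV K by auto
    have "ennreal (pairing f \<Phi>) + ennreal (pairing f \<Psi>) \<le> classical_variation f V"
      if \<Psi>: "test_field (V - ?K) \<Psi>" "\<forall>x. norm (\<Psi> x) \<le> 1" for \<Psi>
    proof -
      have \<Psi>0: "\<Psi> x = 0" if "x \<in> ?K" for x
        by (rule test_field_eq_0[OF \<Psi>(1)]) (use that in blast)
      let ?F = "\<lambda>b::bool. if b then \<Phi> else \<Psi>"
      have t: "test_field V (?F b)" for b
        using test_field_mono[OF \<Phi>(1), of V] test_field_mono[OF \<Psi>(1), of V] by auto
      obtain J where J: "(\<Sum>b\<in>UNIV. ennreal (pairing f (?F b))) = ennreal (pairing f (\<lambda>x. \<Sum>b\<in>J. ?F b x))"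
        using sum_ennreal_pairing[OF f, of UNIV V ?F] t by auto
      have "ennreal (pairing f \<Phi>) + ennreal (pairing f \<Psi>) = ennreal (pairing f (\<lambda>x. \<Sum>b\<in>J. ?F b x))"
        unfolding J[symmetric] by (simp add: UNIV_bool add.commute)
      also have "\<dots> \<le> classical_variation f V"
      proof (rule pairing_le_classical_variation[OF fb])
        show "test_field V (\<lambda>x. \<Sum>b\<in>J. ?F b x)" by (rule test_field_sum) (use t in auto)
        fix x
        have "norm (\<Sum>b\<in>J. ?F b x) \<le> (\<Sum>b\<in>J. norm (?F b x))" by (rule norm_sum)
        also have "\<dots> \<le> (\<Sum>b\<in>UNIV. norm (?F b x))" by (rule sum_mono2) auto
        also have "\<dots> = norm (\<Phi> x) + norm (\<Psi> x)" by (simp add: UNIV_bool)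
        also have "\<dots> \<le> 1" using inK[of x] \<Psi>0[of x] \<Phi>(2) \<Psi>(2) by (cases "\<Phi> x = 0") auto
        finally show "norm (\<Sum>b\<in>J. ?F b x) \<le> 1" .
      qed
      finally show ?thesis .
    qed
    note * = this
    have "ennreal (pairing f \<Phi>) + classical_variation f (V - ?K) \<le> classical_variation f V"
      unfolding classical_variation_eq[OF fb, of "V - ?K"]
      by (subst ennreal_SUP_add_right)
         (use * test_field_zero in \<open>auto intro!: SUP_least exI[of _ "\<lambda>x. 0"]\<close>)
    moreover have "outer_variation f (V - U) \<le> classical_variation f (V - ?K)"
      by (rule outer_variation_le[OF W])
    ultimately show ?thesis using add_left_mono order_trans by blast
  qed
  have "classical_variation f (V \<inter> U) + outer_variation f (V - U)
     = (SUP \<Phi>\<in>{\<Phi>. test_field (V \<inter> U) \<Phi> \<and> (\<forall>x. norm (\<Phi> x) \<le> 1)}. ennreal (pairing f \<Phi>) + outer_variation f (V - U))"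
    unfolding classical_variation_eq[OF fb, of "V \<inter> U"]
    by (rule ennreal_SUP_add_left[symmetric]) (use test_field_zero in \<open>auto intro!: exI[of _ "\<lambda>x. 0"]\<close>)
  also have "\<dots> \<le> classical_variation f V" using key by (intro SUP_least) auto
  finally show ?thesis .
qed

lemma outer_variation_countably_subadditive:
  fixes f :: "'a::euclidean_space \<Rightarrow> real"
  assumes f: "loc_int f"
  shows "outer_variation f (\<Union>i::nat. A i) \<le> (\<Sum>i. outer_variation f (A i))"
proof (rule ennreal_le_epsilon)
  fix e :: real assume fin: "(\<Sum>i. outer_variation f (A i)) < top" and e: "0 < e"
  have "\<exists>U. open U \<and> A i \<subseteq> U \<and> classical_variation f U \<le> outer_variation f (A i) + ennreal (e * (1/2)^Suc i)" for i
  proof -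
    have "outer_variation f (A i) < top" using ennreal_suminf_lessD[OF fin] .
    then have "outer_variation f (A i) < outer_variation f (A i) + ennreal (e * (1/2)^Suc i)"
      using e by (cases "outer_variation f (A i)") (auto simp: ennreal_less_iff simp flip: ennreal_plus)
    then have "\<exists>U\<in>{U. open U \<and> A i \<subseteq> U}. classical_variation f U < outer_variation f (A i) + ennreal (e * (1/2)^Suc i)"
      unfolding outer_variation_def[of f "A i"] INF_less_iff .
    then show ?thesis using less_imp_le by blast
  qed
  then obtain U where U: "\<And>i. open (U i)" "\<And>i. A i \<subseteq> U i"
      "\<And>i. classical_variation f (U i) \<le> outer_variation f (A i) + ennreal (e * (1/2)^Suc i)"
    by metis
  have "outer_variation f (\<Union>i. A i) \<le> classical_variation f (\<Union>i. U i)"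
    by (rule outer_variation_le) (use U in blast)+
  also have "\<dots> \<le> (\<Sum>i. classical_variation f (U i))" by (rule classical_variation_UN[OF f U(1)])
  also have "\<dots> \<le> (\<Sum>i. outer_variation f (A i) + ennreal (e * (1/2)^Suc i))"
    by (intro suminf_le U summableI)
  also have "\<dots> = (\<Sum>i. outer_variation f (A i)) + (\<Sum>i. ennreal (e * (1/2)^Suc i))"
    by (rule suminf_add[symmetric]) (intro summableI)+
  also have "(\<Sum>i. ennreal (e * (1/2)^Suc i)) = ennreal (e * 1)"
    by (rule suminf_ennreal_eq) (use e sums_mult[OF power_half_series, of e] in auto)
  finally show "outer_variation f (\<Union>i. A i) \<le> (\<Sum>i. outer_variation f (A i)) + ennreal e" by simp
qed

text \<open>
  \<open>classical_variation_superadditive\<close> says that open sets satisfy Caratheodory's criterion for the outer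
  measure. Hence so do all Borel sets, and \<open>measure_of\<close> is given a genuine measure.
\<close>

theorem emeasure_variation_measure:
  fixes f :: "'a::euclidean_space \<Rightarrow> real"
  assumes f: "loc_int f" and A: "A \<in> sets borel"
  shows "emeasure (variation_measure f) A = outer_variation f A"
proof -
  let ?P = "Pow (UNIV :: 'a set)" and ?\<mu> = "outer_variation f"
  interpret P: sigma_algebra UNIV ?P by (rule sigma_algebra_Pow)
  have oms: "outer_measure_space ?P ?\<mu>"
    unfolding outer_measure_space_def positive_def increasing_def countably_subadditive_def
    using outer_variation_open[OF open_empty, of f] classical_variation_empty[OF loc_int_measurable[OF f]]
      outer_variation_mono outer_variation_countably_subadditive[OF f]
    by auto
  have ms: "measure_space UNIV (lambda_system UNIV ?P ?\<mu>) ?\<mu>"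
    by (rule P.caratheodory_lemma[OF oms])
  then interpret L: sigma_algebra UNIV "lambda_system UNIV ?P ?\<mu>"
    by (simp add: measure_space_def)
  have "U \<in> lambda_system UNIV ?P ?\<mu>" if U: "open U" for U
  proof -
    have "?\<mu> (X \<inter> U) + ?\<mu> (X - U) = ?\<mu> X" for X
    proof (rule antisym)
      show "?\<mu> (X \<inter> U) + ?\<mu> (X - U) \<le> ?\<mu> X"
        unfolding outer_variation_def[of f X]
      proof (rule INF_greatest, clarify)
        fix V assume V: "open V" "X \<subseteq> V"
        have "?\<mu> (X \<inter> U) + ?\<mu> (X - U) \<le> classical_variation f (V \<inter> U) + ?\<mu> (V - U)"
          by (intro add_mono outer_variation_le outer_variation_mono) (use U V in auto)
        also have "\<dots> \<le> classical_variation f V" by (rule classical_variation_superadditive[OF f U V(1)])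
        finally show "?\<mu> (X \<inter> U) + ?\<mu> (X - U) \<le> classical_variation f V" .
      qed
      \<comment> \<open>finite subadditivity, from the countable one with empty sets appended\<close>
      let ?A = "\<lambda>i::nat. if i = 0 then X \<inter> U else if i = 1 then X - U else {}"
      have "X = (\<Union>i. ?A i)"
      proof
        show "X \<subseteq> (\<Union>i. ?A i)"
        proof
          fix x assume "x \<in> X"
          then have "x \<in> ?A 0 \<or> x \<in> ?A 1" by auto
          then show "x \<in> (\<Union>i. ?A i)" by blast
        qed
      qed (auto split: if_splits)
      then have "?\<mu> X \<le> (\<Sum>i. ?\<mu> (?A i))" using outer_variation_countably_subadditive[OF f, of ?A] by simp
      also have "\<dots> = (\<Sum>i\<in>{0,1}. ?\<mu> (?A i))"
        by (rule suminf_finite) (use outer_variation_open[OF open_empty, of f] classical_variation_empty[OF loc_int_measurable[OF f]] in auto)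
      finally show "?\<mu> X \<le> ?\<mu> (X \<inter> U) + ?\<mu> (X - U)" by simp
    qed
    then show ?thesis unfolding P.lambda_system_eq by auto
  qed
  then have sub: "sets borel \<subseteq> lambda_system UNIV ?P ?\<mu>"
    unfolding sets_borel by (intro L.sigma_sets_subset) auto
  have "measure_space UNIV (sets borel) ?\<mu>"
    by (rule measure_down[OF ms _ sub]) (use sets.sigma_algebra_axioms[of "borel :: 'a measure"] in simp)
  then have pc: "positive (sets borel) ?\<mu>" "countably_additive (sets borel) ?\<mu>"
    by (auto simp: measure_space_def)
  have eq: "variation_measure f = measure_of UNIV (sets borel) ?\<mu>"
    unfolding variation_measure_def outer_variation_def ..
  have sets: "sets (measure_of UNIV (sets borel) ?\<mu>) = sets borel"
    by (metis sets.sets_measure_of_eq space_borel)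
  show ?thesis
    by (rule emeasure_measure_of[OF eq]) (use pc A sets in \<open>auto simp: eq\<close>)
qed

lemma sets_variation_measure: "sets (variation_measure f) = sets borel"
  unfolding variation_measure_def by (metis sets.sets_measure_of_eq space_borel)

lemma emeasure_variation_measure_open:
  "loc_int f \<Longrightarrow> open U \<Longrightarrow> emeasure (variation_measure f) U = classical_variation f U"
  by (simp add: emeasure_variation_measure outer_variation_open)

section \<open>Integration with respect to the total variation measure\<close>

text \<open>
  The staircase below \<open>s\<close> with \<open>n\<close> steps of height \<open>\<delta>\<close>.
\<close>

definition layers :: "real \<Rightarrow> nat \<Rightarrow> ennreal \<Rightarrow> ennreal" where
  "layers \<delta> n s = (\<Sum>j\<in>{1..n}. if ennreal (real j * \<delta>) < s then ennreal \<delta> else 0)"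

lemma layers_eq: "0 \<le> \<delta> \<Longrightarrow> layers \<delta> n s = ennreal (real (card {j\<in>{1..n}. ennreal (real j * \<delta>) < s}) * \<delta>)"
  unfolding layers_def
  by (subst sum.inter_filter[symmetric]) (auto simp: ennreal_mult ennreal_of_nat_eq_real_of_nat)

text \<open>
  Among the levels \<open>\<delta>, 2\<delta>, \<dots>, n\<delta>\<close> those below \<open>s\<close> form an initial segment, and the staircase has the height
  of the last of them.
\<close>

lemma layers_le:
  assumes \<delta>: "0 \<le> \<delta>" shows "layers \<delta> n s \<le> s"
proof (cases "{j\<in>{1..n}. ennreal (real j * \<delta>) < s} = {}")
  case True
  show ?thesis by (simp only: layers_eq[OF \<delta>] True) simp
next
  case False
  let ?S = "{j\<in>{1..n}. ennreal (real j * \<delta>) < s}"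
  have m: "Max ?S \<in> ?S" using False by (intro Max_in) auto
  have "?S \<subseteq> {1..Max ?S}" by (auto intro!: Max_ge)
  then have "card ?S \<le> Max ?S" using card_mono[of "{1..Max ?S}" ?S] by simp
  then have "real (card ?S) * \<delta> \<le> real (Max ?S) * \<delta>" using \<delta> by (intro mult_right_mono) auto
  then have "layers \<delta> n s \<le> ennreal (real (Max ?S) * \<delta>)"
    unfolding layers_eq[OF \<delta>] by (rule ennreal_leI)
  also have "\<dots> \<le> s" using m by (auto intro: less_imp_le)
  finally show ?thesis .
qed

lemma layers_ge:
  assumes \<delta>: "0 \<le> \<delta>" shows "min s (ennreal (real n * \<delta>)) \<le> layers \<delta> n s + ennreal \<delta>"
proof (cases "\<forall>j\<in>{1..n}. ennreal (real j * \<delta>) < s")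
  case True
  then have "{j\<in>{1..n}. ennreal (real j * \<delta>) < s} = {1..n}" by auto
  then have "layers \<delta> n s = ennreal (real n * \<delta>)" unfolding layers_eq[OF \<delta>] by simp
  then show ?thesis by (simp add: min.coboundedI2 add_increasing2)
next
  case False
  let ?S = "{j\<in>{1..n}. ennreal (real j * \<delta>) < s}"
  let ?P = "\<lambda>j. j \<in> {1..n} \<and> s \<le> ennreal (real j * \<delta>)"
  define j where "j = (LEAST j. ?P j)"
  have ex: "\<exists>j. ?P j" using False by (auto simp: not_less)
  then have j: "?P j" unfolding j_def by (rule LeastI_ex)
  have "{1..<j} \<subseteq> ?S"
  proof
    fix i assume i: "i \<in> {1..<j}"
    then have "\<not> ?P i" unfolding j_def using not_less_Least by auto
    then show "i \<in> ?S" using i j by (auto simp: not_le)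
  qed
  then have "j - 1 \<le> card ?S" using card_mono[of ?S "{1..<j}"] by simp
  then have "real j \<le> real (card ?S) + 1" by linarith
  then have "real j * \<delta> \<le> (real (card ?S) + 1) * \<delta>" using \<delta> by (rule mult_right_mono)
  then have "ennreal (real j * \<delta>) \<le> ennreal (real (card ?S) * \<delta> + \<delta>)"
    by (intro ennreal_leI) (simp add: algebra_simps)
  also have "\<dots> = layers \<delta> n s + ennreal \<delta>" unfolding layers_eq[OF \<delta>] using \<delta> by (simp add: ennreal_plus)
  finally show ?thesis using j by (auto intro: min.coboundedI1)
qed

text \<open>
  With height \<open>1/(k+1)\<close> and \<open>(k+1)\<^sup>2\<close> steps the staircase reaches up to \<open>k+1\<close>, which also covers \<open>s = \<infinity>\<close>.
\<close>

lemma layers_tendsto: "(\<lambda>k. layers (inverse (real (Suc k))) (Suc k * Suc k) s) \<longlonglongrightarrow> s"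
proof -
  let ?d = "\<lambda>k. inverse (real (Suc k))" and ?l = "\<lambda>k. layers (inverse (real (Suc k))) (Suc k * Suc k) s"
  have d0: "0 \<le> ?d k" for k by simp
  have "(\<lambda>k. ennreal (?d k)) \<longlonglongrightarrow> ennreal 0" by (intro tendsto_ennrealI LIMSEQ_inverse_real_of_nat)
  then have d: "(\<lambda>k. ennreal (?d k)) \<longlonglongrightarrow> 0" by simp
  have "(\<lambda>k. min s (of_nat (Suc k))) \<longlonglongrightarrow> min s top"
    by (intro tendsto_min tendsto_const LIMSEQ_Suc of_nat_tendsto_top_ennreal)
  then have m: "(\<lambda>k. min s (of_nat (Suc k))) \<longlonglongrightarrow> s" by simp
  have "min s (of_nat (Suc k)) \<le> ?l k + ennreal (?d k)" for k
  proof -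
    have "real (Suc k * Suc k) * inverse (real (Suc k)) = real (Suc k)"
      by (simp only: of_nat_mult) simp
    then show ?thesis
      using layers_ge[OF d0[of k], of s "Suc k * Suc k"] by (simp only: ennreal_of_nat_eq_real_of_nat)
  qed
  then have low: "min s (of_nat (Suc k)) - ennreal (?d k) \<le> ?l k" for k
    by (simp add: ennreal_minus_le_iff add.commute)
  show ?thesis
  proof (rule tendsto_sandwich[OF _ _ _ tendsto_const])
    show "(\<lambda>k. min s (of_nat (Suc k)) - ennreal (?d k)) \<longlonglongrightarrow> s"
      using tendsto_diff_ennreal_general[OF m d] by simp
  qed (use low layers_le[OF d0] in auto)
qed

lemma nn_integral_layers:
  assumes f: "loc_int f" and lsc: "lower_semicontinuous v"
  shows "(\<integral>\<^sup>+x. layers \<delta> n (v x) \<partial>variation_measure f)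
    = (\<Sum>j\<in>{1..n}. ennreal \<delta> * classical_variation f {x. ennreal (real j * \<delta>) < v x})"
proof -
  have op: "open {x. a < v x}" for a using lsc by (simp add: lower_semicontinuous_def)
  then have [measurable]: "{x. a < v x} \<in> sets (variation_measure f)" for a
    by (simp add: sets_variation_measure)
  have "(\<integral>\<^sup>+x. layers \<delta> n (v x) \<partial>variation_measure f)
      = (\<integral>\<^sup>+x. (\<Sum>j\<in>{1..n}. ennreal \<delta> * indicator {x. ennreal (real j * \<delta>) < v x} x) \<partial>variation_measure f)"
    unfolding layers_def by (intro nn_integral_cong sum.cong) (auto simp: indicator_def)
  also have "\<dots> = (\<Sum>j\<in>{1..n}. \<integral>\<^sup>+x. ennreal \<delta> * indicator {x. ennreal (real j * \<delta>) < v x} x \<partial>variation_measure f)"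
    by (rule nn_integral_sum) simp
  also have "\<dots> = (\<Sum>j\<in>{1..n}. ennreal \<delta> * classical_variation f {x. ennreal (real j * \<delta>) < v x})"
    by (intro sum.cong refl) (simp add: nn_integral_cmult_indicator emeasure_variation_measure_open[OF f op])
  finally show ?thesis .
qed

text \<open>
  If \<open>\<Phi>\<^sub>j\<close> is nearly optimal for the superlevel set \<open>{v > j\<delta>}\<close>, then the sum of the \<open>\<delta> \<Phi>\<^sub>j\<close> is bounded by the
  staircase below \<open>v\<close> and thus admissible for the weighted variation. Nearly optimal fields are
  taken along increasing sequences, so that the sum of the suprema is a limit of such sums.
\<close>

lemma sum_layer_variations_le:
  fixes f :: "'a::euclidean_space \<Rightarrow> real"
  assumes f: "loc_int f" and \<delta>: "0 \<le> \<delta>"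
  shows "(\<Sum>j\<in>{1..n}. ennreal \<delta> * classical_variation f {x. ennreal (real j * \<delta>) < v x}) \<le> weighted_variation v f"
proof -
  note fb = loc_int_measurable[OF f]
  let ?U = "\<lambda>j::nat. {x. ennreal (real j * \<delta>) < v x}"
  let ?F = "\<lambda>j. {\<Phi>. test_field (?U j) \<Phi> \<and> (\<forall>x. norm (\<Phi> x) \<le> 1)}"
  have ne: "(\<lambda>\<Phi>. ennreal (pairing f \<Phi>)) ` ?F j \<noteq> {}" for j
  proof -
    have "(\<lambda>x. 0) \<in> ?F j" using test_field_zero by simp
    then show ?thesis by blast
  qed
  define a where "a j = (SOME a::nat \<Rightarrow> ennreal. incseq a \<and> range a \<subseteq> (\<lambda>\<Phi>. ennreal (pairing f \<Phi>)) ` ?F j \<and>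
      Sup ((\<lambda>\<Phi>. ennreal (pairing f \<Phi>)) ` ?F j) = (SUP i. a i))" for j :: nat
  have a': "incseq (a j) \<and> range (a j) \<subseteq> (\<lambda>\<Phi>. ennreal (pairing f \<Phi>)) ` ?F j \<and>
      Sup ((\<lambda>\<Phi>. ennreal (pairing f \<Phi>)) ` ?F j) = (SUP i. a j i)" for j
    unfolding a_def by (rule someI_ex[OF ennreal_Sup_countable_SUP[OF ne]])
  have a: "incseq (a j)" "classical_variation f (?U j) = (SUP i. a j i)"
      "range (a j) \<subseteq> (\<lambda>\<Phi>. ennreal (pairing f \<Phi>)) ` ?F j" for j
    using a'[of j] by (simp_all only: classical_variation_eq[OF fb])
  have "\<exists>\<Phi>. \<Phi> \<in> ?F j \<and> a j i = ennreal (pairing f \<Phi>)" for j i using a(3)[of j] by blast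
  note ex = this
  define \<Phi> where "\<Phi> j i = (SOME \<Phi>. \<Phi> \<in> ?F j \<and> a j i = ennreal (pairing f \<Phi>))" for j i
  have \<Phi>: "\<Phi> j i \<in> ?F j" "a j i = ennreal (pairing f (\<Phi> j i))" for j i
    using someI_ex[OF ex[of j i]] unfolding \<Phi>_def by blast+
  have lim: "(\<lambda>i. \<Sum>j\<in>{1..n}. ennreal \<delta> * a j i) \<longlonglongrightarrow> (\<Sum>j\<in>{1..n}. ennreal \<delta> * classical_variation f (?U j))"
    unfolding a(2) by (intro tendsto_sum ennreal_tendsto_cmult LIMSEQ_SUP a(1)) simp
  have "(\<Sum>j\<in>{1..n}. ennreal \<delta> * a j i) \<le> weighted_variation v f" for i
  proof -
    let ?G = "\<lambda>j x. \<delta> *\<^sub>R \<Phi> j i x"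
    have C: "Ck 1 (\<Phi> j i)" for j using \<Phi>(1)[of j i] unfolding test_field_def by blast
    have t: "test_field (?U j) (?G j)" for j using \<Phi>(1)[of j i] test_field_scaleR by blast
    have "(\<Sum>j\<in>{1..n}. ennreal \<delta> * a j i) = (\<Sum>j\<in>{1..n}. ennreal (pairing f (?G j)))"
      using \<delta> by (simp only: pairing_scaleR[OF C] \<Phi>(2) ennreal_mult')
    also obtain J where J: "J \<subseteq> {1..n}" "(\<Sum>j\<in>{1..n}. ennreal (pairing f (?G j))) = ennreal (pairing f (\<lambda>x. \<Sum>j\<in>J. ?G j x))"
      using sum_ennreal_pairing[OF f, of "{1..n}" UNIV ?G] test_field_mono[OF t subset_UNIV] by blast
    note J(2)
    also have "ennreal (pairing f (\<lambda>x. \<Sum>j\<in>J. ?G j x)) \<le> weighted_variation v f"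
    proof (rule pairing_le_weighted_variation[OF fb])
      show "test_field UNIV (\<lambda>x. \<Sum>j\<in>J. ?G j x)"
        using J(1) finite_subset by (intro test_field_sum test_field_mono[OF t subset_UNIV]) blast
      fix x
      have le: "norm (?G j x) \<le> (if ennreal (real j * \<delta>) < v x then \<delta> else 0)" for j
      proof -
        have "\<Phi> j i x = 0" if "x \<notin> ?U j"
          by (rule test_field_eq_0[OF _ that]) (use \<Phi>(1)[of j i] in blast)
        moreover have "norm (\<Phi> j i x) \<le> 1" using \<Phi>(1)[of j i] by blast
        ultimately show ?thesis using \<delta> mult_left_mono[of "norm (\<Phi> j i x)" 1 \<delta>] by auto
      qed
      have "norm (\<Sum>j\<in>J. ?G j x) \<le> (\<Sum>j\<in>J. norm (?G j x))" by (rule norm_sum)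
      also have "\<dots> \<le> (\<Sum>j\<in>{1..n}. norm (?G j x))" using J(1) by (intro sum_mono2) auto
      also have "\<dots> \<le> (\<Sum>j\<in>{1..n}. if ennreal (real j * \<delta>) < v x then \<delta> else 0)" by (intro sum_mono le)
      finally have "ennreal (norm (\<Sum>j\<in>J. ?G j x)) \<le> ennreal (\<Sum>j\<in>{1..n}. if ennreal (real j * \<delta>) < v x then \<delta> else 0)"
        by (rule ennreal_leI)
      also have "\<dots> = layers \<delta> n (v x)"
      proof -
        have "layers \<delta> n (v x) = (\<Sum>j\<in>{1..n}. ennreal (if ennreal (real j * \<delta>) < v x then \<delta> else 0))"
          unfolding layers_def by (rule sum.cong) auto
        also have "\<dots> = ennreal (\<Sum>j\<in>{1..n}. if ennreal (real j * \<delta>) < v x then \<delta> else 0)"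
          by (rule sum_ennreal) (use \<delta> in auto)
        finally show ?thesis ..
      qed
      also have "\<dots> \<le> v x" by (rule layers_le[OF \<delta>])
      finally show "ennreal (norm (\<Sum>j\<in>J. ?G j x)) \<le> v x" .
    qed
    finally show ?thesis .
  qed
  then show ?thesis by (intro LIMSEQ_le_const2[OF lim]) auto
qed

lemma lower_semicontinuous_measurable:
  fixes v :: "'a::euclidean_space \<Rightarrow> ennreal"
  assumes "lower_semicontinuous v" shows "v \<in> borel_measurable borel"
proof (rule borel_measurableI_greater)
  fix a show "{x \<in> space borel. a < v x} \<in> sets borel"
    using assms by (simp add: lower_semicontinuous_def)
qed

theorem nn_integral_variation_le_weighted_variation:
  fixes f :: "'a::euclidean_space \<Rightarrow> real"
  assumes f: "loc_int f" and lsc: "lower_semicontinuous v"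
  shows "(\<integral>\<^sup>+x. v x \<partial>variation_measure f) \<le> weighted_variation v f"
proof (rule nn_integral_le_of_tendsto[OF _ _ _ tendsto_const])
  let ?g = "\<lambda>k x. layers (inverse (real (Suc k))) (Suc k * Suc k) (v x)"
  show "AE x in variation_measure f. (\<lambda>k. ?g k x) \<longlonglongrightarrow> v x" by (intro AE_I2 layers_tendsto)
  have [measurable]: "v \<in> borel_measurable (variation_measure f)"
    using lower_semicontinuous_measurable[OF lsc] measurable_cong_sets[OF sets_variation_measure refl] by blast
  show "?g k \<in> borel_measurable (variation_measure f)" for k unfolding layers_def by measurable
  show "(\<integral>\<^sup>+x. ?g k x \<partial>variation_measure f) \<le> weighted_variation v f" for k
    unfolding nn_integral_layers[OF f lsc] by (rule sum_layer_variations_le[OF f]) simp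
qed

text \<open>
  The nearest-point retraction onto the closed ball of radius \<open>t\<close>; for \<open>t = 0\<close> it is the constant \<open>0\<close>, also
  at \<open>y = 0\<close> where the quotient is \<open>0 / 0\<close>.
\<close>

definition truncate :: "real \<Rightarrow> 'a::euclidean_space \<Rightarrow> 'a" where
  "truncate t y = (t / max t (norm y)) *\<^sub>R y"

lemma continuous_truncate: "0 \<le> t \<Longrightarrow> continuous_on UNIV g \<Longrightarrow> continuous_on UNIV (\<lambda>x. truncate t (g x))"
proof (cases "t = 0")
  case False
  assume "0 \<le> t" and g: "continuous_on UNIV g"
  then have "max t (norm (g x)) \<noteq> 0" for x using False by linarith
  then show ?thesis unfolding truncate_def by (intro continuous_intros g) auto
qed (simp add: truncate_def)

lemma truncate_id: "0 \<le> t \<Longrightarrow> norm y \<le> t \<Longrightarrow> truncate t y = y"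
  unfolding truncate_def by (cases "t = 0") (auto simp: max_def)

lemma norm_truncate_diff_le:
  assumes "0 \<le> s" "s \<le> t" shows "norm (truncate t y - truncate s y) \<le> t - s"
proof (cases "norm y \<le> s")
  case True then show ?thesis using assms by (simp add: truncate_id)
next
  case False
  then have y: "0 < norm y" using assms(1) by linarith
  have "norm (truncate t y - truncate s y) = \<bar>t / max t (norm y) - s / max s (norm y)\<bar> * norm y"
    unfolding truncate_def scaleR_diff_left[symmetric] by simp
  also have "\<dots> = \<bar>t / max t (norm y) * norm y - s\<bar>"
  proof -
    have "s / max s (norm y) * norm y = s" using False y by (simp add: max_def)
    then show ?thesis using y
      by (metis abs_mult abs_norm_cancel left_diff_distrib)
  qed
  also have "\<dots> \<le> t - s"
  proof (cases "norm y \<le> t")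
    case True
    moreover have "0 < t" using y True by linarith
    ultimately have "t / max t (norm y) * norm y = norm y" by (simp add: max_def)
    then show ?thesis using True False by simp
  next
    case F: False
    then have "t / max t (norm y) * norm y = t" using y by (simp add: max_def)
    then show ?thesis using assms by simp
  qed
  finally show ?thesis .
qed

text \<open>
  The radial layers of \<open>\<Phi>\<close>, differences of successive retractions onto balls of radii \<open>j\<delta>\<close>, are bounded by \<open>\<delta>\<close>
  and supported in \<open>{\<bar>\<Phi>\<bar> \<ge> j\<delta>}\<close>, a subset of the open set \<open>{\<bar>\<Phi>\<bar> > (j-1)\<delta>}\<close>. Localisation bounds the pairing by the
  integral of a staircase below \<open>\<bar>\<Phi>\<bar>\<close>, up to the two lowest layers, whose contribution is of order \<open>\<delta>\<close>.
\<close>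

theorem pairing_le_nn_integral_variation:
  fixes f :: "'a::euclidean_space \<Rightarrow> real"
  assumes f: "loc_int f" and fin: "\<And>r. classical_variation f (ball 0 r) < top" and \<Phi>: "test_field UNIV \<Phi>"
  shows "ennreal (pairing f \<Phi>) \<le> (\<integral>\<^sup>+x. ennreal (norm (\<Phi> x)) \<partial>variation_measure f)"
proof (rule ennreal_le_epsilon)
  fix e :: real assume e: "0 < e"
  have S: "compact_support_in \<Phi> UNIV" and c\<Phi>: "continuous_on UNIV \<Phi>"
    using \<Phi> Ck1_derivative(4) unfolding test_field_def by blast+
  obtain R where R: "\<And>x. R \<le> norm x \<Longrightarrow> \<Phi> x = 0" using compact_support_vanishes[OF S] by blast
  obtain M where M: "\<And>x. norm (\<Phi> x) \<le> M" using continuous_compact_support_bounded[OF c\<Phi> S] by blast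
  let ?B = "ball (0::'a) (R + 1)"
  obtain b where b: "0 \<le> b" "classical_variation f ?B = ennreal b"
    using fin[of "R + 1"] by (cases "classical_variation f ?B") auto
  \<comment> \<open>the two lowest layers contribute \<open>2 \<delta> b \<le> e\<close>\<close>
  define \<delta> where "\<delta> = e / (b + 1) / 2"
  have \<delta>: "0 < \<delta>" using e b by (simp add: \<delta>_def)
  obtain n :: nat where n: "M / \<delta> \<le> real n" using real_arch_simple by blast
  define \<psi> where "\<psi> j x = truncate (real (Suc j) * \<delta>) (\<Phi> x) - truncate (real j * \<delta>) (\<Phi> x)" for j x
  \<comment> \<open>the two lowest layers are localised in a ball around the support only\<close>
  define U where "U j = (if j \<le> 1 then ?B else {x. ennreal (real (j - 1) * \<delta>) < ennreal (norm (\<Phi> x))})" for j :: nat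
  have opU: "open {x. a < ennreal (norm (\<Phi> x))}" for a
    by (intro open_Collect_less continuous_intros continuous_on_ennreal c\<Phi>)
  have "ennreal (pairing f \<Phi>) \<le> (\<Sum>j<n + 2. ennreal \<delta> * classical_variation f (U j))"
  proof (rule pairing_le_sum_variations[OF f \<Phi>, where \<psi>=\<psi>])
    fix x
    have "norm (\<Phi> x) \<le> real n * \<delta>" using M[of x] n \<delta> by (simp add: field_simps)
    also have "\<dots> \<le> real (n + 2) * \<delta>" using \<delta> by (intro mult_right_mono) auto
    finally have "truncate (real (n + 2) * \<delta>) (\<Phi> x) = \<Phi> x" using \<delta> by (intro truncate_id) auto
    moreover have "(\<Sum>j<n+2. \<psi> j x) = truncate (real (n+2) * \<delta>) (\<Phi> x) - truncate (real 0 * \<delta>) (\<Phi> x)"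
      unfolding \<psi>_def by (rule sum_lessThan_telescope)
    ultimately show "\<Phi> x = (\<Sum>j<n+2. \<psi> j x)" by (simp add: truncate_def)
  next
    fix j :: nat
    show "continuous_on UNIV (\<psi> j)"
      unfolding \<psi>_def[abs_def] using \<delta> by (intro continuous_on_diff continuous_truncate c\<Phi>) auto
    show "norm (\<psi> j x) \<le> \<delta>" for x
      using norm_truncate_diff_le[of "real j * \<delta>" "real (Suc j) * \<delta>" "\<Phi> x"] \<delta>
      unfolding \<psi>_def by (simp add: algebra_simps)
    have big: "real j * \<delta> \<le> norm (\<Phi> x) \<and> \<Phi> x \<noteq> 0" if "\<psi> j x \<noteq> 0" for x
    proof (rule ccontr)
      assume "\<not> ?thesis"
      then consider "norm (\<Phi> x) \<le> real j * \<delta>" | "\<Phi> x = 0" by linarith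
      then show False
      proof cases
        case 1
        then have "norm (\<Phi> x) \<le> real (Suc j) * \<delta>" using \<delta> by (simp add: algebra_simps)
        then show False using that 1 \<delta> by (simp add: \<psi>_def truncate_id)
      qed (use that in \<open>simp add: \<psi>_def truncate_def\<close>)
    qed
    have "compact_support_in (\<psi> j) (U j)"
    proof (rule compact_support_in_subset)
      show "compact (cball 0 R \<inter> {x. real j * \<delta> \<le> norm (\<Phi> x)})"
        by (intro compact_Int_closed compact_cball closed_Collect_le continuous_intros c\<Phi>)
      show "cball 0 R \<inter> {x. real j * \<delta> \<le> norm (\<Phi> x)} \<subseteq> U j"
      proof
        fix x assume x: "x \<in> cball 0 R \<inter> {x. real j * \<delta> \<le> norm (\<Phi> x)}"
        show "x \<in> U j"
        proof (cases "j \<le> 1")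
          case False
          have "real (j - 1) * \<delta> < real j * \<delta>" using False \<delta> by (intro mult_strict_right_mono) auto
          then have "real (j - 1) * \<delta> < norm (\<Phi> x)" using x by auto
          then show ?thesis using False \<delta> by (simp add: U_def ennreal_less_iff)
        qed (use x in \<open>simp add: U_def\<close>)
      qed
      show "x \<in> cball 0 R \<inter> {x. real j * \<delta> \<le> norm (\<Phi> x)}" if "\<psi> j x \<noteq> 0" for x
        using big[OF that] R[of x] by (cases "R \<le> norm x") auto
    qed
    then show "open (U j) \<and> compact_support_in (\<psi> j) (U j)"
      using opU by (auto simp: U_def)
  qed simp
  also have "\<dots> = ennreal \<delta> * ennreal b + ennreal \<delta> * ennreal b + (\<Sum>j<n. ennreal \<delta> * classical_variation f (U (Suc (Suc j))))"
    by (simp add: sum.lessThan_Suc_shift U_def b(2) add.assoc del: sum.lessThan_Suc)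
  also have "(\<Sum>j<n. ennreal \<delta> * classical_variation f (U (Suc (Suc j))))
      = (\<Sum>j\<in>{1..n}. ennreal \<delta> * classical_variation f {x. ennreal (real j * \<delta>) < ennreal (norm (\<Phi> x))})"
    by (rule sum.reindex_bij_witness[of _ "\<lambda>j. j - 1" Suc]) (auto simp: U_def)
  also have "\<dots> = (\<integral>\<^sup>+x. layers \<delta> n (ennreal (norm (\<Phi> x))) \<partial>variation_measure f)"
    by (rule nn_integral_layers[OF f, symmetric]) (use opU in \<open>simp add: lower_semicontinuous_def\<close>)
  also have "\<dots> \<le> (\<integral>\<^sup>+x. ennreal (norm (\<Phi> x)) \<partial>variation_measure f)"
    using \<delta> by (intro nn_integral_mono layers_le) simp
  also have "ennreal \<delta> * ennreal b + ennreal \<delta> * ennreal b = ennreal (\<delta> * b + \<delta> * b)"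
    using \<delta> b by (simp flip: ennreal_mult ennreal_plus)
  also have "\<dots> \<le> ennreal e"
  proof (rule ennreal_leI)
    have "\<delta> * b + \<delta> * b = (\<delta> + \<delta>) * b" by (simp only: distrib_right)
    also have "\<delta> + \<delta> = e / (b + 1)" unfolding \<delta>_def by (rule field_sum_of_halves)
    also have "e / (b + 1) * b = e * (b / (b + 1))" by simp
    also have "\<dots> \<le> e * 1" using e b by (intro mult_left_mono) auto
    finally show "\<delta> * b + \<delta> * b \<le> e" by simp
  qed
  finally show "ennreal (pairing f \<Phi>) \<le> (\<integral>\<^sup>+x. ennreal (norm (\<Phi> x)) \<partial>variation_measure f) + ennreal e"
    by (simp add: add.commute add_right_mono)
qed

section \<open>Powers of weights\<close>

lemma epowr_ennreal: "0 \<le> r \<Longrightarrow> epowr (ennreal r) q = ennreal (r powr q)"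
  by (simp add: epowr_def)

lemma epowr_top: "epowr top q = top"
  by (simp add: epowr_def)

lemma epowr_mono: "x \<le> y \<Longrightarrow> 0 \<le> q \<Longrightarrow> epowr x q \<le> epowr y q"
  by (cases x; cases y) (auto simp: epowr_ennreal epowr_top top_unique intro!: ennreal_leI powr_mono2)

lemma epowr_mult:
  assumes "0 < c" shows "epowr (ennreal c * x) q = ennreal (c powr q) * epowr x q"
  using assms by (cases x) (auto simp: epowr_ennreal epowr_top powr_mult ennreal_mult_top ennreal_mult simp flip: ennreal_mult)

lemma epowr_1: "epowr x 1 = x"
  by (cases x) (auto simp: epowr_ennreal epowr_top)

lemma epowr_epowr: "epowr (epowr x p) q = epowr x (p * q)"
  by (cases x) (auto simp: epowr_ennreal epowr_top powr_powr)

lemma epowr_le_iff: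
  assumes "0 < q" shows "epowr x q \<le> y \<longleftrightarrow> x \<le> epowr y (1/q)"
proof
  assume "epowr x q \<le> y"
  then have "epowr (epowr x q) (1/q) \<le> epowr y (1/q)" using assms by (intro epowr_mono) auto
  then show "x \<le> epowr y (1/q)" using assms by (simp add: epowr_epowr epowr_1)
next
  assume "x \<le> epowr y (1/q)"
  then have "epowr x q \<le> epowr (epowr y (1/q)) q" using assms by (intro epowr_mono) auto
  then show "epowr x q \<le> y" using assms by (simp add: epowr_epowr epowr_1)
qed

lemma epowr_tendsto:
  assumes X: "X \<longlonglongrightarrow> L" and L: "L < top" and p: "0 < p"
  shows "(\<lambda>m. epowr (X m) p) \<longlonglongrightarrow> epowr L p"
proof -
  obtain l where l: "0 \<le> l" "L = ennreal l" using L by (cases L) auto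
  have "(\<lambda>m. enn2real (X m)) \<longlonglongrightarrow> l" using X l by (intro tendsto_enn2real) auto
  then have lim: "(\<lambda>m. ennreal (enn2real (X m) powr p)) \<longlonglongrightarrow> ennreal (l powr p)"
    using p by (intro tendsto_ennrealI tendsto_powr2 tendsto_const) auto
  have ev: "\<forall>\<^sub>F m in sequentially. ennreal (enn2real (X m) powr p) = epowr (X m) p"
    using order_tendstoD(2)[OF X L] by eventually_elim (auto simp: epowr_def)
  show ?thesis unfolding l(2) epowr_ennreal[OF l(1)] by (rule Lim_transform_eventually[OF lim ev])
qed

lemma lower_semicontinuous_epowr:
  assumes "lower_semicontinuous w" and q: "0 < q"
  shows "lower_semicontinuous (\<lambda>x. epowr (w x) q)"
proof -
  have "a < epowr (w x) q \<longleftrightarrow> epowr a (1/q) < w x" for a x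
    using epowr_le_iff[OF q, of "w x" a] by (simp add: not_le[symmetric])
  then show ?thesis using assms(1) by (simp add: lower_semicontinuous_def)
qed

text \<open>
  A concave function lies below its tangent, here at \<open>a\<close>.
\<close>

lemma tangent_powr_le:
  fixes s a q :: real
  assumes "0 \<le> s" "0 < a" "0 < q" "q < 1"
  shows "s powr q \<le> q * a powr (q - 1) * s + (1 - q) * a powr q"
proof (cases "s = 0")
  case False
  have "s powr q * a powr (1 - q) \<le> q * s + (1 - q) * a"
    using assms False by (intro Youngs_inequality_0) auto
  then have "(s powr q * a powr (1 - q)) * a powr (q - 1) \<le> (q * s + (1 - q) * a) * a powr (q - 1)"
    by (intro mult_right_mono) auto
  moreover have "(s powr q * a powr (1 - q)) * a powr (q - 1) = s powr q"
    using assms(2) by (simp add: mult.assoc powr_add[symmetric])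
  moreover have "a * a powr (q - 1) = a powr q"
    using assms(2) by (simp add: powr_mult_base)
  then have "(q * s + (1 - q) * a) * a powr (q - 1) = q * a powr (q - 1) * s + (1 - q) * a powr q"
    by (simp only: distrib_right mult.assoc mult.commute[of s])
  ultimately show ?thesis by simp
qed (use assms in simp)

section \<open>Muckenhoupt weights\<close>

lemma ball_average_lborel:
  "ball_average u x r = (\<integral>\<^sup>+y\<in>ball x r. u y \<partial>lborel) / emeasure lborel (ball x r)"
  by (simp add: ball_average_def nn_integral_completion)

lemma ball_emeasure:
  assumes "0 < r"
  shows "emeasure lborel (ball x r) = ennreal (measure lborel (ball x r))" "0 < measure lborel (ball (x::'a::euclidean_space) r)"
proof -
  show "emeasure lborel (ball x r) = ennreal (measure lborel (ball x r))"
    using emeasure_bounded_finite[OF bounded_ball, of x r] by (simp add: emeasure_eq_ennreal_measure)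
  show "0 < measure lborel (ball x r)" using assms by (simp add: content_ball)
qed

lemma ball_average_le_iff:
  fixes x :: "'a::euclidean_space"
  assumes "0 < r"
  shows "ball_average u x r \<le> c \<longleftrightarrow> (\<integral>\<^sup>+y\<in>ball x r. u y \<partial>lborel) \<le> c * emeasure lborel (ball x r)"
proof -
  have "X / ennreal b \<le> c \<longleftrightarrow> X \<le> c * ennreal b" if "0 < b" for X b
    using that by (cases X; cases c)
      (auto simp: divide_ennreal divide_le_eq ennreal_top_divide ennreal_top_mult top_unique simp flip: ennreal_mult)
  then show ?thesis
    unfolding ball_average_lborel using ball_emeasure[OF assms, of x] by simp
qed

lemma A1_star_basic:
  assumes "A1_star w"
  shows "lower_semicontinuous w" "w \<in> borel_measurable borel" "compact K \<Longrightarrow> (\<integral>\<^sup>+x\<in>K. w x \<partial>lborel) < \<infinity>"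
  using assms lower_semicontinuous_measurable
  by (auto simp: A1_star_def A1_def locally_integrable_weight_def nn_integral_completion)

text \<open>
  If \<open>w\<close> vanishes at one point, then by the \<open>A\<^sub>1\<close> condition its integral over every ball around this
  point is \<open>0\<close>. Then \<open>w\<close> vanishes almost everywhere, and by lower semicontinuity everywhere.
\<close>

lemma A1_star_pos:
  fixes w :: "'a::euclidean_space \<Rightarrow> ennreal"
  assumes w: "A1_star w" shows "0 < w x"
proof (rule ccontr)
  assume "\<not> 0 < w x"
  then have wx: "w x = 0" by simp
  note [measurable] = A1_star_basic(2)[OF w]
  obtain C where C: "A1_bound w C" using w by (auto simp: A1_star_def A1_def)
  have zero: "(\<integral>\<^sup>+y\<in>ball x r. w y \<partial>lborel) = 0" if r: "0 < r" for r
  proof -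
    have "ball_average w x r \<le> ennreal C * (INF y\<in>ball x r. w y)" using C r by (simp add: A1_bound_def)
    also have "\<dots> \<le> ennreal C * w x" using r by (intro mult_left_mono INF_lower) auto
    finally have "ball_average w x r \<le> 0" using wx by simp
    then show ?thesis using ball_average_le_iff[OF r, of w x 0] by simp
  qed
  obtain y where y: "0 < w y" using w unfolding A1_star_def by (metis ext not_gr_zero)
  define r where "r = dist x y + 1"
  have r: "0 < r" "y \<in> ball x r" by (auto simp: r_def add_nonneg_pos)
  have op: "open ({z. 0 < w z} \<inter> ball x r)" using A1_star_basic(1)[OF w] by (auto simp: lower_semicontinuous_def)
  have yin: "y \<in> {z. 0 < w z} \<inter> ball x r" using y r by simp
  obtain d where d: "0 < d" "ball y d \<subseteq> {z. 0 < w z} \<inter> ball x r"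
    by (rule openE[OF op yin])
  have [measurable]: "ball x r \<in> sets borel" by simp
  have "(\<lambda>z. w z * indicator (ball x r) z) \<in> borel_measurable lborel" by measurable
  from nn_integral_0_iff_AE[OF this] have "AE z in lborel. w z * indicator (ball x r) z = 0"
    using zero[OF r(1)] by simp
  then have "AE z in lborel. z \<notin> ball y d"
    by eventually_elim (use d(2) in \<open>auto simp: indicator_def split: if_splits\<close>)
  then have "ball y d \<in> null_sets lborel" by (subst AE_iff_null_sets) simp_all
  then have "emeasure lborel (ball y d) = 0" by (rule null_setsD1)
  then show False using ball_emeasure[OF d(1), of y] by simp
qed

text \<open>
  A positive lower semicontinuous function is bounded away from \<open>0\<close> on compact sets: the open sets
  \<open>{w > 1/(n+1)}\<close> cover.
\<close>

lemma compact_lower_bound: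
  fixes w :: "'a::euclidean_space \<Rightarrow> ennreal"
  assumes lsc: "lower_semicontinuous w" and pos: "\<And>x. 0 < w x" and K: "compact K"
  obtains c where "0 < c" "\<And>x. x \<in> K \<Longrightarrow> ennreal c \<le> w x"
proof -
  let ?U = "\<lambda>n::nat. {x. ennreal (inverse (real (Suc n))) < w x}"
  have cov: "K \<subseteq> (\<Union>n. ?U n)"
  proof
    fix x
    have "(\<lambda>n. ennreal (inverse (real (Suc n)))) \<longlonglongrightarrow> ennreal 0" by (intro tendsto_ennrealI LIMSEQ_inverse_real_of_nat)
    then have "\<forall>\<^sub>F n in sequentially. ennreal (inverse (real (Suc n))) < w x"
      using pos[of x] by (intro order_tendstoD) auto
    then show "x \<in> (\<Union>n. ?U n)" using eventually_happens'[OF sequentially_bot] by blast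
  qed
  have op: "open (?U n)" for n using lsc by (simp add: lower_semicontinuous_def)
  obtain I where I: "finite I" "K \<subseteq> (\<Union>n\<in>I. ?U n)"
    using compactE_image[OF K, of UNIV ?U] op cov by auto
  then obtain N where N: "I \<subseteq> {..<N}" by (meson finite_nat_bounded)
  have "ennreal (inverse (real (Suc N))) \<le> w x" if x: "x \<in> K" for x
  proof -
    have "x \<in> (\<Union>n\<in>I. ?U n)" using I(2) x by (rule subsetD)
    then obtain n where n: "n \<in> I" "ennreal (inverse (real (Suc n))) < w x" by (elim UN_E CollectE)
    have "ennreal (inverse (real (Suc N))) \<le> ennreal (inverse (real (Suc n)))"
      using N n(1) by (intro ennreal_leI le_imp_inverse_le) auto
    then show ?thesis using n(2) by (meson less_imp_le order_trans)
  qed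
  then show thesis using that[of "inverse (real (Suc N))"] by simp
qed

lemma ball_average_A1_star_finite_pos:
  fixes w :: "'a::euclidean_space \<Rightarrow> ennreal"
  assumes w: "A1_star w" and r: "0 < r"
  obtains a where "0 < a" "ball_average w x r = ennreal a"
proof -
  note [measurable] = A1_star_basic(2)[OF w]
  have "(\<integral>\<^sup>+y\<in>ball x r. w y \<partial>lborel) \<le> (\<integral>\<^sup>+y\<in>cball x r. w y \<partial>lborel)"
    by (intro nn_integral_mono) (auto simp: indicator_def)
  also have "\<dots> < top" using A1_star_basic(3)[OF w compact_cball] by simp
  finally obtain i where i: "0 \<le> i" "(\<integral>\<^sup>+y\<in>ball x r. w y \<partial>lborel) = ennreal i"
    by (cases "(\<integral>\<^sup>+y\<in>ball x r. w y \<partial>lborel)") auto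
  note B = ball_emeasure[OF r, of x]
  have eq: "ball_average w x r = ennreal (i / measure lborel (ball x r))"
    unfolding ball_average_lborel i B(1) using i B by (simp add: divide_ennreal)
  have "i \<noteq> 0"
  proof
    assume "i = 0"
    have [measurable]: "ball x r \<in> sets borel" by simp
    have "(\<lambda>z. w z * indicator (ball x r) z) \<in> borel_measurable lborel" by measurable
    from nn_integral_0_iff_AE[OF this] have "AE z in lborel. w z * indicator (ball x r) z = 0"
      using i(2) \<open>i = 0\<close> by simp
    then have "AE z in lborel. z \<notin> ball x r"
      by eventually_elim (use A1_star_pos[OF w] in \<open>auto simp: indicator_def less_imp_neq[symmetric] split: if_splits\<close>)
    then have "ball x r \<in> null_sets lborel" by (subst AE_iff_null_sets) simp_all
    then have "emeasure lborel (ball x r) = 0" by (rule null_setsD1)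
    then show False using B by simp
  qed
  then show thesis using that[OF _ eq] i B by simp
qed

text \<open>
  The infimum over a ball is at most the average, which is positive and finite.
\<close>

lemma A1_bound_ge_1:
  fixes w :: "'a::euclidean_space \<Rightarrow> ennreal"
  assumes w: "A1_star w" and C: "A1_bound w C" shows "1 \<le> C"
proof -
  obtain a where a: "0 < a" "ball_average w (0::'a) 1 = ennreal a"
    using ball_average_A1_star_finite_pos[OF w, of 1 0] by auto
  let ?I = "INF y\<in>ball (0::'a) 1. w y"
  have "?I * emeasure lborel (ball (0::'a) 1) = (\<integral>\<^sup>+y. ?I * indicator (ball (0::'a) 1) y \<partial>lborel)"
    by (simp add: nn_integral_cmult_indicator)
  also have "\<dots> \<le> (\<integral>\<^sup>+y\<in>ball (0::'a) 1. w y \<partial>lborel)"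
    by (intro nn_integral_mono) (auto simp: indicator_def intro: INF_lower)
  also have "\<dots> \<le> ennreal a * emeasure lborel (ball (0::'a) 1)"
    using ball_average_le_iff[of 1 w 0 "ennreal a"] a(2) by simp
  finally have "?I \<le> ennreal a"
    using ball_emeasure[of 1 "0::'a"] by (simp add: ennreal_mult_le_mult_iff mult.commute[of _ "ennreal (measure lborel (ball 0 1))"])
  have C0: "0 < C" using C by (simp add: A1_bound_def)
  have "ball_average w (0::'a) 1 \<le> ennreal C * ?I" using C zero_less_one unfolding A1_bound_def by blast
  then have "ennreal a \<le> ennreal C * ?I" by (simp only: a(2))
  also have "\<dots> \<le> ennreal C * ennreal a" using \<open>?I \<le> ennreal a\<close> by (intro mult_left_mono) auto
  also have "\<dots> = ennreal (C * a)" using C0 a by (simp add: ennreal_mult)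
  finally have "a \<le> C * a" using C0 a by simp
  then show ?thesis using a(1) by simp
qed

text \<open>
  The infimum that defines the \<open>A\<^sub>1\<close> constant is attained. The lower bound \<open>1\<close> keeps the constants in
  the final estimate positive, which matters when the variation is infinite.
\<close>

lemma A1_const_bound:
  fixes w :: "'a::euclidean_space \<Rightarrow> ennreal"
  assumes w: "A1_star w"
  shows "1 \<le> A1_const w"
    and "0 < r \<Longrightarrow> y \<in> ball x r \<Longrightarrow> ball_average w x r \<le> ennreal (A1_const w) * w y"
proof -
  let ?S = "{C. A1_bound w C}"
  have ne: "?S \<noteq> {}" using w by (auto simp: A1_star_def A1_def)
  have ge1: "C \<in> ?S \<Longrightarrow> 1 \<le> C" for C using A1_bound_ge_1[OF w] by simp
  show K: "1 \<le> A1_const w" unfolding A1_const_def by (rule cInf_greatest[OF ne ge1])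
  assume r: "0 < r" and y: "y \<in> ball x r"
  obtain a where a: "0 < a" "ball_average w x r = ennreal a"
    using ball_average_A1_star_finite_pos[OF w r] .
  show "ball_average w x r \<le> ennreal (A1_const w) * w y"
  proof (cases "w y")
    case top
    then show ?thesis using K by (simp add: ennreal_mult_top)
  next
    case (real s)
    have s: "0 < s" using A1_star_pos[OF w, of y] real by simp
    have "a / s \<le> C" if "C \<in> ?S" for C
    proof -
      have "ball_average w x r \<le> ennreal C * (INF y\<in>ball x r. w y)" using that r unfolding A1_bound_def by blast
      then have "ennreal a \<le> ennreal C * (INF y\<in>ball x r. w y)" by (simp only: a(2))
      also have "\<dots> \<le> ennreal C * w y" using y by (intro mult_left_mono INF_lower) auto
      also have "\<dots> = ennreal (C * s)" using real ge1[OF that] by (simp add: ennreal_mult)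
      finally have "a \<le> C * s" using ge1[OF that] s by (simp add: mult_nonneg_nonneg)
      then show ?thesis using s by (simp add: divide_le_eq)
    qed
    then have "a / s \<le> A1_const w" unfolding A1_const_def by (intro cInf_greatest[OF ne])
    then have "a \<le> A1_const w * s" using s by (simp add: divide_le_eq)
    then show ?thesis unfolding a(2) real(2) using K s by (simp add: ennreal_leI flip: ennreal_mult)
  qed
qed

lemma maximal_fun_le:
  fixes w :: "'a::euclidean_space \<Rightarrow> ennreal"
  assumes w: "A1_star w"
  shows "maximal_fun w x \<le> ennreal (A1_const w) * w x"
  unfolding maximal_fun_def by (rule SUP_least) (use A1_const_bound(2)[OF w] in auto)

lemma ball_integral_A1:
  fixes w :: "'a::euclidean_space \<Rightarrow> ennreal"
  assumes w: "A1_star w" and r: "0 < r"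
  shows "(\<integral>\<^sup>+y\<in>ball x r. w y \<partial>lborel) \<le> (ennreal (A1_const w) * w x) * emeasure lborel (ball x r)"
  using A1_const_bound(2)[OF w r, of x x] r by (simp add: ball_average_le_iff)

text \<open>
  Jensen's inequality for the power \<open>q\<close>, obtained by integrating the tangent line at the average
  of \<open>w\<close>; written with tangents, it also holds where \<open>w = \<infinity>\<close>.
\<close>

lemma ball_integral_epowr_A1:
  fixes w :: "'a::euclidean_space \<Rightarrow> ennreal"
  assumes w: "A1_star w" and r: "0 < r" and q: "0 < q" "q < 1"
  shows "(\<integral>\<^sup>+y\<in>ball x r. epowr (w y) q \<partial>lborel) \<le> (ennreal (A1_const w powr q) * epowr (w x) q) * emeasure lborel (ball x r)"
proof -
  note [measurable] = A1_star_basic(2)[OF w]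
  obtain a where a: "0 < a" "ball_average w x r = ennreal a"
    using ball_average_A1_star_finite_pos[OF w r] .
  let ?B = "emeasure lborel (ball x r)"
  have tangent: "epowr (w y) q \<le> ennreal (q * a powr (q - 1)) * w y + ennreal ((1 - q) * a powr q)" for y
  proof (cases "w y")
    case (real s)
    then show ?thesis using tangent_powr_le[of s a q] a q
      by (simp add: epowr_ennreal ennreal_leI flip: ennreal_mult ennreal_plus)
  next
    case top
    have "0 < q * a powr (q - 1)" using a q by simp
    then show ?thesis by (simp only: top ennreal_mult_top ennreal_eq_0_iff not_le) (simp add: ennreal_mult_top)
  qed
  have "(\<integral>\<^sup>+y\<in>ball x r. epowr (w y) q \<partial>lborel)
     \<le> (\<integral>\<^sup>+y. ennreal (q * a powr (q - 1)) * (w y * indicator (ball x r) y) + ennreal ((1 - q) * a powr q) * indicator (ball x r) y \<partial>lborel)"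
    by (intro nn_integral_mono) (use tangent in \<open>auto simp: indicator_def\<close>)
  also have "\<dots> = ennreal (q * a powr (q - 1)) * (\<integral>\<^sup>+y\<in>ball x r. w y \<partial>lborel) + ennreal ((1 - q) * a powr q) * ?B"
  proof -
    have [measurable]: "ball x r \<in> sets borel" by simp
    show ?thesis
      by (subst nn_integral_add, measurable, subst nn_integral_cmult, measurable) (simp add: nn_integral_cmult_indicator)
  qed
  also have "\<dots> \<le> ennreal (q * a powr (q - 1)) * (ennreal a * ?B) + ennreal ((1 - q) * a powr q) * ?B"
    using ball_average_le_iff[OF r, of w x "ennreal a"] a(2) by (intro add_right_mono mult_left_mono) auto
  also have "\<dots> = (ennreal (q * a powr (q - 1) * a) + ennreal ((1 - q) * a powr q)) * ?B"
    using a q by (simp add: ennreal_mult' distrib_right mult.assoc)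
  also have "ennreal (q * a powr (q - 1) * a) + ennreal ((1 - q) * a powr q) = ennreal (q * (a * a powr (q - 1)) + (1 - q) * a powr q)"
    using a q by (subst ennreal_plus[symmetric]) (auto simp: mult_ac)
  also have "q * (a * a powr (q - 1)) + (1 - q) * a powr q = a powr q"
    using a by (simp add: powr_mult_base algebra_simps)
  also have "ennreal (a powr q) = epowr (ball_average w x r) q" using a by (simp add: epowr_ennreal)
  also have "\<dots> \<le> epowr (ennreal (A1_const w) * w x) q"
    using A1_const_bound(2)[OF w r, of x x] r q by (intro epowr_mono) auto
  also have "\<dots> = ennreal (A1_const w powr q) * epowr (w x) q"
    using A1_const_bound(1)[OF w] by (intro epowr_mult) simp
  finally show ?thesis by (simp add: mult_right_mono)
qed

section \<open>Mollification at points of approximability\<close>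

lemma ennreal_le_add_diff: "(a::ennreal) \<le> b + (a - b)"
proof (cases "a \<le> b")
  case False
  then show ?thesis by (simp add: add_diff_inverse_ennreal)
qed (simp add: add_increasing2)

text \<open>
  The mollification of \<open>h = \<bar>v - v x\<bar>\<close> at \<open>x\<close> is at most a constant times a ball average of \<open>h\<close>.
\<close>

lemma mollified_tendsto_of_approximable:
  fixes v :: "'a::euclidean_space \<Rightarrow> ennreal"
  assumes v[measurable]: "v \<in> borel_measurable borel" and e: "\<And>m. 0 < e m" "e \<longlonglongrightarrow> 0"
    and lim: "((\<lambda>\<epsilon>. ball_average (\<lambda>y. (v y - v x) + (v x - v y)) x \<epsilon>) \<longlongrightarrow> 0) (at_right 0)"
  shows "(\<lambda>m. \<integral>\<^sup>+y. ennreal (mollifier (e m) (x - y)) * v y \<partial>lborel) \<longlonglongrightarrow> v x"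
proof -
  let ?h = "\<lambda>y. (v y - v x) + (v x - v y)"
  let ?I = "\<lambda>m u. \<integral>\<^sup>+y. ennreal (mollifier (e m) (x - y)) * u y \<partial>lborel"
  \<comment> \<open>the numerator in \<open>mollifier_le\<close>\<close>
  define c :: real where "c = 2 * 2 ^ DIM('a)"
  define err where "err m = ennreal c * ball_average ?h x (e m)" for m
  have "filterlim e (at_right 0) sequentially"
    using e by (intro filterlim_atI tendsto_imp_filterlim_at_right) auto
  then have "(\<lambda>m. ball_average ?h x (e m)) \<longlonglongrightarrow> 0" by (rule filterlim_compose[OF lim])
  then have "err \<longlonglongrightarrow> ennreal c * 0" unfolding err_def[abs_def] by (intro ennreal_tendsto_cmult) auto
  then have err0: "err \<longlonglongrightarrow> 0" by simp
  have Ih: "?I m ?h \<le> err m" for m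
  proof -
    let ?B = "measure lborel (ball (0::'a) (e m))"
    have B: "emeasure lborel (ball x (e m)) = ennreal ?B" "0 < ?B"
      using ball_emeasure[OF e(1), of x m] ball_emeasure[OF e(1), of 0 m] e(1)[of m]
      by (auto simp: content_ball)
    have "?I m ?h \<le> (\<integral>\<^sup>+y. ennreal (c / ?B) * (?h y * indicator (ball x (e m)) y) \<partial>lborel)"
    proof (rule nn_integral_mono)
      fix y
      show "ennreal (mollifier (e m) (x - y)) * ?h y \<le> ennreal (c / ?B) * (?h y * indicator (ball x (e m)) y)"
      proof (cases "y \<in> ball x (e m)")
        case True
        then show ?thesis using mollifier_le[OF e(1)[of m], of "x - y"]
          by (auto simp: c_def intro!: mult_right_mono ennreal_leI)
      next
        case False
        then have "mollifier (e m) (x - y) = 0" by (intro mollifier_eq_0 e) (auto simp: dist_norm)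
        then show ?thesis by simp
      qed
    qed
    also have "\<dots> = ennreal (c / ?B) * (\<integral>\<^sup>+y\<in>ball x (e m). ?h y \<partial>lborel)"
    proof (rule nn_integral_cmult)
      have [measurable]: "ball x (e m) \<in> sets borel" by simp
      show "(\<lambda>y. ?h y * indicator (ball x (e m)) y) \<in> borel_measurable lborel" by measurable
    qed
    also have "\<dots> = err m"
      unfolding err_def ball_average_lborel B(1)
      using B(2) by (simp add: divide_ennreal_def inverse_ennreal ennreal_mult' c_def divide_inverse mult_ac)
    finally show ?thesis .
  qed
  have meas: "(\<lambda>y. ennreal (mollifier (e m) (x - y)) * u y) \<in> borel_measurable lborel"
    if [measurable]: "u \<in> borel_measurable borel" for u m by measurable
  have Icst: "?I m (\<lambda>_. s) = s" for m s
    by (subst nn_integral_multc) (simp_all add: nn_integral_mollifier_reflect[OF e(1)])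
  have up: "?I m v \<le> v x + err m" for m
  proof -
    have "?I m v \<le> (\<integral>\<^sup>+y. ennreal (mollifier (e m) (x - y)) * v x + ennreal (mollifier (e m) (x - y)) * ?h y \<partial>lborel)"
    proof (rule nn_integral_mono)
      fix y
      have "v y \<le> v x + (v y - v x)" by (rule ennreal_le_add_diff)
      also have "\<dots> \<le> v x + ?h y" by (intro add_left_mono) simp
      finally show "ennreal (mollifier (e m) (x - y)) * v y \<le> ennreal (mollifier (e m) (x - y)) * v x + ennreal (mollifier (e m) (x - y)) * ?h y"
        unfolding distrib_left[symmetric] by (rule mult_left_mono) simp
    qed
    also have "\<dots> = ?I m (\<lambda>_. v x) + ?I m ?h" by (rule nn_integral_add) (simp_all add: meas)
    also have "\<dots> \<le> v x + err m" unfolding Icst by (intro add_left_mono Ih)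
    finally show ?thesis .
  qed
  have low: "v x \<le> ?I m v + err m" for m
  proof -
    have "v x = ?I m (\<lambda>_. v x)" by (rule Icst[symmetric])
    also have "\<dots> \<le> (\<integral>\<^sup>+y. ennreal (mollifier (e m) (x - y)) * v y + ennreal (mollifier (e m) (x - y)) * ?h y \<partial>lborel)"
    proof (rule nn_integral_mono)
      fix y
      have "v x \<le> v y + (v x - v y)" by (rule ennreal_le_add_diff)
      also have "\<dots> \<le> v y + ?h y" by (intro add_left_mono) simp
      finally show "ennreal (mollifier (e m) (x - y)) * v x \<le> ennreal (mollifier (e m) (x - y)) * v y + ennreal (mollifier (e m) (x - y)) * ?h y"
        unfolding distrib_left[symmetric] by (rule mult_left_mono) simp
    qed
    also have "\<dots> = ?I m v + ?I m ?h" by (rule nn_integral_add) (simp_all add: meas)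
    also have "\<dots> \<le> ?I m v + err m" by (intro add_left_mono Ih)
    finally show ?thesis .
  qed
  show ?thesis
  proof (rule tendsto_sandwich)
    show "(\<lambda>m. v x - err m) \<longlonglongrightarrow> v x" using tendsto_diff_ennreal_general[OF tendsto_const[of "v x"] err0] by simp
    show "(\<lambda>m. v x + err m) \<longlonglongrightarrow> v x" using tendsto_add[OF tendsto_const[of "v x"] err0] by simp
    show "\<forall>\<^sub>F m in sequentially. v x - err m \<le> ?I m v"
    proof -
      have "\<forall>\<^sub>F m in sequentially. err m < top" using err0 by (intro order_tendstoD) auto
      then show ?thesis
        by eventually_elim (use low in \<open>auto simp: ennreal_minus_le_iff add.commute\<close>)
    qed
  qed (use up in simp)
qed

section \<open>Mollifications of functions of weighted bounded variation\<close>

lemma wLp_norm_lborel: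
  "wLp_norm p v f = epowr (\<integral>\<^sup>+x. ennreal (norm (f x) powr p) * v x \<partial>lborel) (1 / p)"
  by (simp add: wLp_norm_def nn_integral_completion)

lemma wLp_norm_1: "wLp_norm 1 v f = (\<integral>\<^sup>+x. ennreal (norm (f x)) * v x \<partial>lborel)"
  by (simp add: wLp_norm_lborel epowr_1)

text \<open>
  The weight is bounded away from \<open>0\<close> on balls.
\<close>

lemma loc_int_wL1:
  fixes w :: "'a::euclidean_space \<Rightarrow> ennreal" and f :: "'a \<Rightarrow> real"
  assumes lsc: "lower_semicontinuous w" and pos: "\<And>x. 0 < w x"
    and f[measurable]: "f \<in> borel_measurable borel"
    and fin: "(\<integral>\<^sup>+x. ennreal (norm (f x)) * w x \<partial>lborel) < \<infinity>"
  shows "loc_int f"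
  unfolding loc_int_def
proof (intro conjI allI f)
  fix r :: real
  obtain c where c: "0 < c" "\<And>x. x \<in> cball 0 r \<Longrightarrow> ennreal c \<le> w x"
    using compact_lower_bound[OF lsc pos compact_cball[of 0 r]] by blast
  have "(\<integral>\<^sup>+x. ennreal (norm (indicator (cball 0 r) x *\<^sub>R f x)) \<partial>lborel)
     \<le> (\<integral>\<^sup>+x. ennreal (inverse c) * (ennreal (norm (f x)) * w x) \<partial>lborel)"
  proof (rule nn_integral_mono)
    fix x
    show "ennreal (norm (indicator (cball 0 r) x *\<^sub>R f x)) \<le> ennreal (inverse c) * (ennreal (norm (f x)) * w x)"
    proof (cases "x \<in> cball 0 r")
      case True
      have "ennreal (norm (f x)) = ennreal (inverse c) * (ennreal (norm (f x)) * ennreal c)"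
        using c(1) by (simp add: ennreal_mult'[symmetric] mult.left_commute)
      also have "\<dots> \<le> ennreal (inverse c) * (ennreal (norm (f x)) * w x)"
        by (intro mult_left_mono c(2) True) auto
      finally show ?thesis using True by simp
    qed simp
  qed
  also have "\<dots> = ennreal (inverse c) * (\<integral>\<^sup>+x. ennreal (norm (f x)) * w x \<partial>lborel)"
  proof (rule nn_integral_cmult)
    have [measurable]: "w \<in> borel_measurable borel" by (rule lower_semicontinuous_measurable[OF lsc])
    show "(\<lambda>x. ennreal (norm (f x)) * w x) \<in> borel_measurable lborel" by measurable
  qed
  also have "\<dots> < \<infinity>" using fin by (simp add: ennreal_mult_less_top)
  finally have "(\<integral>\<^sup>+x. ennreal (norm (indicator (cball 0 r) x *\<^sub>R f x)) \<partial>lborel) < \<infinity>" .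
  moreover have "(\<lambda>x. indicator (cball 0 r) x *\<^sub>R f x) \<in> borel_measurable lborel"
    by (intro borel_measurable_scaleR borel_measurable_indicator) simp_all
  ultimately show "integrable lborel (\<lambda>x. indicator (cball 0 r) x *\<^sub>R f x)"
    unfolding integrable_iff_bounded by blast
qed

text \<open>
  On the ball \<open>w \<ge> c > 0\<close>, so a field bounded by \<open>1\<close> and supported there is dominated by \<open>w / c\<close>.
\<close>

lemma classical_variation_ball_finite:
  fixes w :: "'a::euclidean_space \<Rightarrow> ennreal" and f :: "'a \<Rightarrow> real"
  assumes lsc: "lower_semicontinuous w" and pos: "\<And>x. 0 < w x"
    and f: "f \<in> borel_measurable borel" and fin: "weighted_variation w f < \<infinity>"
  shows "classical_variation f (ball 0 r) < top"
proof -
  obtain c where c: "0 < c" "\<And>x. x \<in> cball 0 r \<Longrightarrow> ennreal c \<le> w x"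
    using compact_lower_bound[OF lsc pos compact_cball[of 0 r]] by blast
  have "classical_variation f (ball 0 r) \<le> ennreal (inverse c) * weighted_variation w f"
    unfolding classical_variation_eq[OF f]
  proof (rule SUP_least, clarify)
    fix \<Phi> :: "'a \<Rightarrow> 'a" assume \<Phi>: "test_field (ball 0 r) \<Phi>" "\<forall>x. norm (\<Phi> x) \<le> 1"
    show "ennreal (pairing f \<Phi>) \<le> ennreal (inverse c) * weighted_variation w f"
    proof (rule scaled_pairing_le_weighted_variation[OF f \<Phi>(1)])
      fix x
      show "ennreal (norm (\<Phi> x)) \<le> ennreal (inverse c) * w x"
      proof (cases "x \<in> ball 0 r")
        case True
        have "ennreal (norm (\<Phi> x)) \<le> ennreal 1" using \<Phi>(2) by (intro ennreal_leI) auto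
        also have "\<dots> = ennreal (inverse c) * ennreal c" using c(1) by (simp add: ennreal_mult'[symmetric])
        also have "\<dots> \<le> ennreal (inverse c) * w x" using True by (intro mult_left_mono c(2)) auto
        finally show ?thesis .
      next
        case False
        then show ?thesis using test_field_eq_0[OF \<Phi>(1), of x] by simp
      qed
    qed (use c in simp)
  qed
  also have "\<dots> < top" using fin by (simp add: ennreal_mult_less_top)
  finally show ?thesis .
qed

lemma A1_star_AE_finite:
  fixes w :: "'a::euclidean_space \<Rightarrow> ennreal"
  assumes w: "A1_star w" shows "AE x in lborel. w x < top"
proof -
  note [measurable] = A1_star_basic(2)[OF w]
  have "AE x in lborel. w x * indicator (cball 0 (real n)) x \<noteq> \<infinity>" for n
  proof (rule nn_integral_PInf_AE)
    have [measurable]: "cball (0::'a) (real n) \<in> sets borel" by simp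
    show "(\<lambda>x. w x * indicator (cball 0 (real n)) x) \<in> borel_measurable lborel" by measurable
    show "(\<integral>\<^sup>+x\<in>cball 0 (real n). w x \<partial>lborel) \<noteq> \<infinity>"
      using A1_star_basic(3)[OF w compact_cball, of 0 "real n"] by simp
  qed
  then have "AE x in lborel. \<forall>n. w x * indicator (cball 0 (real n)) x \<noteq> \<infinity>"
    by (simp add: AE_all_countable)
  then show ?thesis
  proof eventually_elim
    case (elim x)
    obtain n :: nat where "norm x \<le> real n" using real_arch_simple by blast
    then show ?case using elim[rule_format, of n] by (simp add: less_top)
  qed
qed

lemma locally_integrable_continuous:
  fixes g :: "'a::euclidean_space \<Rightarrow> 'b::euclidean_space"
  assumes "continuous_on UNIV g" shows "locally_integrable g"
  unfolding locally_integrable_def set_integrable_def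
proof (intro allI impI)
  fix K :: "'a set" assume K: "compact K"
  have i: "integrable lborel (\<lambda>x. indicator K x *\<^sub>R g x)"
    by (rule borel_integrable_compact[OF K continuous_on_subset[OF assms subset_UNIV]])
  show "integrable lebesgue (\<lambda>x. indicator K x *\<^sub>R g x)"
    using i by (subst integrable_completion) (auto dest: borel_measurable_integrable)
qed

lemma has_weak_gradient_conv:
  fixes f :: "'a::euclidean_space \<Rightarrow> real"
  assumes e: "0 < e" and f: "loc_int f"
  shows "has_weak_gradient (conv (mollifier e) f) (moll_gradient e f)"
  unfolding has_weak_gradient_def
proof (intro conjI allI ballI impI)
  have cu: "continuous_on UNIV (conv (mollifier e) f)" by (rule continuous_conv[OF kernel_mollifier[OF e] f])
  have cG: "continuous_on UNIV (moll_gradient e f)" by (rule continuous_moll_gradient[OF e f])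
  show "locally_integrable (conv (mollifier e) f)" "locally_integrable (moll_gradient e f)"
    by (rule locally_integrable_continuous[OF cu] locally_integrable_continuous[OF cG])+
  fix \<phi> :: "'a \<Rightarrow> real" and b :: 'a
  assume \<phi>: "(\<forall>k. Ck k \<phi>) \<and> compact_support_in \<phi> UNIV"
  then have C: "Ck 1 \<phi>" and S: "compact_support_in \<phi> UNIV" by blast+
  obtain R where R: "\<And>x. R \<le> norm x \<Longrightarrow> \<phi> x = 0" using compact_support_vanishes[OF S] by blast
  note meas = borel_measurable_continuous_onI[OF cu] borel_measurable_continuous_onI[OF cG]
    borel_measurable_continuous_onI[OF Ck1_derivative(2)[OF C, of b]]
    borel_measurable_continuous_onI[OF Ck1_derivative(4)[OF C]]
  have "(LINT x|lborel. conv (mollifier e) f x * frechet_derivative \<phi> (at x) b)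
     = - (LINT x|lborel. (moll_gradient e f x \<bullet> b) * \<phi> x)"
    by (rule integration_by_parts[OF conv_has_derivative_moll_gradient[OF e f] _ Ck1_derivative(1)[OF C] Ck1_derivative(2)[OF C]])
       (auto intro!: continuous_intros cG R)
  moreover have "(LINT x|lebesgue. conv (mollifier e) f x * frechet_derivative \<phi> (at x) b)
      = (LINT x|lborel. conv (mollifier e) f x * frechet_derivative \<phi> (at x) b)"
    by (rule integral_completion) (use meas in simp)
  moreover have "(LINT x|lebesgue. (moll_gradient e f x \<bullet> b) * \<phi> x) = (LINT x|lborel. (moll_gradient e f x \<bullet> b) * \<phi> x)"
    by (rule integral_completion) (use meas in simp)
  ultimately show "(LINT x|lebesgue. conv (mollifier e) f x * frechet_derivative \<phi> (at x) b)
     = - (LINT x|lebesgue. (moll_gradient e f x \<bullet> b) * \<phi> x)" by simp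
qed

text \<open>
  The route to the estimate without approximability: the admissible fields of the duality are at
  most \<open>C u\<close>. It is applied to \<open>u = w\<close>, to place mollifications in \<open>W\<^sup>1\<^sup>,\<^sup>1(w)\<close>, and to \<open>u = w\<^sup>1\<^sup>/\<^sup>p\<close>.
\<close>

lemma mollified_gradient_bound:
  fixes u :: "'a::euclidean_space \<Rightarrow> ennreal"
  assumes e: "0 < e" and f: "loc_int f" and u: "u \<in> borel_measurable borel" and C: "0 < C"
    and ball: "\<And>x r. 0 < r \<Longrightarrow> (\<integral>\<^sup>+y\<in>ball x r. u y \<partial>lborel) \<le> (ennreal C * u x) * emeasure lborel (ball x r)"
  shows "(\<integral>\<^sup>+x. ennreal (norm (moll_gradient e f x)) * u x \<partial>lborel) \<le> ennreal C * weighted_variation u f"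
proof (rule mollified_gradient_duality[OF e f u])
  fix \<Phi> :: "'a \<Rightarrow> 'a" assume \<Phi>: "test_field UNIV \<Phi>"
    "\<And>x. ennreal (norm (\<Phi> x)) \<le> (\<integral>\<^sup>+y. ennreal (mollifier e (x - y)) * u y \<partial>lborel)"
  show "ennreal (pairing f \<Phi>) \<le> ennreal C * weighted_variation u f"
    by (rule scaled_pairing_le_weighted_variation[OF loc_int_measurable[OF f] \<Phi>(1) C])
       (rule order_trans[OF \<Phi>(2) mollified_le_of_ball_bound[OF e u ball]])
qed

text \<open>
  By Tonelli and the symmetry of the mollifier, mollification moves from \<open>f\<close> to the weight.
\<close>

lemma mollified_wL1_bound:
  fixes u :: "'a::euclidean_space \<Rightarrow> ennreal"
  assumes e: "0 < e" and f: "loc_int f" and u[measurable]: "u \<in> borel_measurable borel"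
    and ball: "\<And>x r. 0 < r \<Longrightarrow> (\<integral>\<^sup>+y\<in>ball x r. u y \<partial>lborel) \<le> (ennreal C * u x) * emeasure lborel (ball x r)"
  shows "(\<integral>\<^sup>+x. ennreal (norm (conv (mollifier e) f x)) * u x \<partial>lborel) \<le> ennreal C * (\<integral>\<^sup>+x. ennreal (norm (f x)) * u x \<partial>lborel)"
proof -
  note [measurable] = loc_int_measurable[OF f]
  have "(\<integral>\<^sup>+x. ennreal (norm (conv (mollifier e) f x)) * u x \<partial>lborel)
    \<le> (\<integral>\<^sup>+x. (\<integral>\<^sup>+y. ennreal (mollifier e (x - y)) * ennreal (norm (f y)) * u x \<partial>lborel) \<partial>lborel)"
  proof (rule nn_integral_mono)
    fix x
    have "ennreal (norm (conv (mollifier e) f x)) * u x \<le> (\<integral>\<^sup>+y. ennreal (mollifier e (x - y)) * ennreal (norm (f y)) \<partial>lborel) * u x"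
      by (intro mult_right_mono conv_norm_bound e f) auto
    also have "\<dots> = (\<integral>\<^sup>+y. ennreal (mollifier e (x - y)) * ennreal (norm (f y)) * u x \<partial>lborel)"
      by (rule nn_integral_multc[symmetric]) measurable
    finally show "ennreal (norm (conv (mollifier e) f x)) * u x \<le> (\<integral>\<^sup>+y. ennreal (mollifier e (x - y)) * ennreal (norm (f y)) * u x \<partial>lborel)" .
  qed
  also have "\<dots> = (\<integral>\<^sup>+y. (\<integral>\<^sup>+x. ennreal (mollifier e (x - y)) * ennreal (norm (f y)) * u x \<partial>lborel) \<partial>lborel)"
    by (rule lborel_pair.Fubini') measurable
  also have "\<dots> \<le> (\<integral>\<^sup>+y. ennreal C * (ennreal (norm (f y)) * u y) \<partial>lborel)"
  proof (rule nn_integral_mono)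
    fix y
    have "(\<integral>\<^sup>+x. ennreal (mollifier e (x - y)) * ennreal (norm (f y)) * u x \<partial>lborel)
       = (\<integral>\<^sup>+x. ennreal (norm (f y)) * (ennreal (mollifier e (y - x)) * u x) \<partial>lborel)"
      by (intro nn_integral_cong) (simp add: mollifier_norm_cong[OF norm_minus_commute] mult_ac)
    also have "\<dots> = ennreal (norm (f y)) * (\<integral>\<^sup>+x. ennreal (mollifier e (y - x)) * u x \<partial>lborel)"
      by (rule nn_integral_cmult) measurable
    also have "\<dots> \<le> ennreal (norm (f y)) * (ennreal C * u y)"
      by (intro mult_left_mono mollified_le_of_ball_bound[OF e u ball]) auto
    finally show "(\<integral>\<^sup>+x. ennreal (mollifier e (x - y)) * ennreal (norm (f y)) * u x \<partial>lborel) \<le> ennreal C * (ennreal (norm (f y)) * u y)"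
      by (simp add: mult_ac)
  qed
  also have "\<dots> = ennreal C * (\<integral>\<^sup>+x. ennreal (norm (f x)) * u x \<partial>lborel)"
    by (rule nn_integral_cmult) measurable
  finally show ?thesis .
qed

text \<open>
  On each ball a subsequence of the mollifications converges almost everywhere, so Fatou's lemma
  applies there; the balls then exhaust the space.
\<close>

lemma wLp_norm_le_of_mollified:
  fixes w :: "'a::euclidean_space \<Rightarrow> ennreal" and f :: "'a \<Rightarrow> real"
  assumes f: "loc_int f" and w[measurable]: "w \<in> borel_measurable borel" and wfin: "AE x in lborel. w x < top" and p: "0 < p"
    and e: "\<And>m. 0 < e m" "e \<longlonglongrightarrow> 0"
    and le: "\<And>m. wLp_norm p w (conv (mollifier (e m)) f) \<le> E m" and E: "E \<longlonglongrightarrow> L"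
  shows "wLp_norm p w f \<le> L"
proof (cases "L = top")
  case False
  then have L: "L < top" by (simp add: less_top)
  let ?f = "\<lambda>m. conv (mollifier (e m)) f"
  note [measurable] = loc_int_measurable[OF f]
  have lf: "loc_int (?f m)" for m by (intro loc_int_continuous continuous_conv[OF kernel_mollifier] e f)
  have [measurable]: "?f m \<in> borel_measurable borel" for m by (rule loc_int_measurable[OF lf])
  have le': "(\<integral>\<^sup>+x. ennreal (norm (?f m x) powr p) * w x \<partial>lborel) \<le> epowr (E m) p" for m
    using le[of m] p unfolding wLp_norm_lborel by (subst (asm) epowr_le_iff) auto
  have loc: "(\<integral>\<^sup>+x. ennreal (norm (f x) powr p) * w x * indicator (cball 0 (real k)) x \<partial>lborel) \<le> epowr L p" for k :: nat
  proof -
    have [measurable]: "cball (0::'a) (real k) \<in> sets borel" by simp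
    let ?d = "\<lambda>m x. indicator (cball 0 (real k)) x *\<^sub>R (?f m x - f x)"
    have ld: "loc_int (\<lambda>x. ?f m x - f x)" for m
    proof -
      have "integrable lborel (\<lambda>y. indicator (cball 0 r) y *\<^sub>R ?f m y - indicator (cball 0 r) y *\<^sub>R f y)" for r
        by (intro Bochner_Integration.integrable_diff loc_int_integrable_cball lf f)
      then show ?thesis by (simp add: loc_int_def right_diff_distrib)
    qed
    have id: "integrable lborel (?d m)" for m by (rule loc_int_integrable_cball[OF ld])
    have "ennreal (LINT x|lborel. norm (?d m x)) = (\<integral>\<^sup>+x\<in>cball 0 (real k). norm (?f m x - f x) \<partial>lborel)" for m
    proof -
      have "ennreal (LINT x|lborel. norm (?d m x)) = (\<integral>\<^sup>+x. ennreal (norm (?d m x)) \<partial>lborel)"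
        by (rule nn_integral_eq_integral[symmetric]) (intro integrable_norm id, simp)
      also have "\<dots> = (\<integral>\<^sup>+x\<in>cball 0 (real k). norm (?f m x - f x) \<partial>lborel)"
        by (intro nn_integral_cong) (auto simp: indicator_def)
      finally show ?thesis .
    qed
    then have "(\<lambda>m. ennreal (LINT x|lborel. norm (?d m x))) \<longlonglongrightarrow> 0"
      using conv_tendsto_L1_loc[OF f e, of "real k"] by simp
    then have "(\<lambda>m. LINT x|lborel. norm (?d m x)) \<longlonglongrightarrow> 0"
      by (subst (asm) ennreal_tendsto_0_iff) (auto intro: integral_nonneg_AE)
    then obtain r :: "nat \<Rightarrow> nat" where r: "strict_mono r" "AE x in lborel. (\<lambda>m. ?d (r m) x) \<longlonglongrightarrow> 0"
      using tendsto_L1_AE_subseq[of lborel ?d, OF id] by blast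
    have "(\<lambda>m. epowr (E (r m)) p) \<longlonglongrightarrow> epowr L p"
      using LIMSEQ_subseq_LIMSEQ[OF epowr_tendsto[OF E L p] r(1)] by (simp add: o_def)
    then show ?thesis
    proof (rule nn_integral_le_of_tendsto[rotated 3])
      show "(\<lambda>x. ennreal (norm (?f (r m) x) powr p) * w x * indicator (cball 0 (real k)) x) \<in> borel_measurable lborel" for m
        by measurable
      show "(\<integral>\<^sup>+x. ennreal (norm (?f (r m) x) powr p) * w x * indicator (cball 0 (real k)) x \<partial>lborel) \<le> epowr (E (r m)) p" for m
        by (rule order_trans[OF nn_integral_mono le']) (simp add: indicator_def)
      show "AE x in lborel. (\<lambda>m. ennreal (norm (?f (r m) x) powr p) * w x * indicator (cball 0 (real k)) x)
         \<longlonglongrightarrow> ennreal (norm (f x) powr p) * w x * indicator (cball 0 (real k)) x"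
        using r(2) wfin
      proof eventually_elim
        case (elim x)
        show ?case
        proof (cases "x \<in> cball 0 (real k)")
          case True
          then have "(\<lambda>m. ?f (r m) x) \<longlonglongrightarrow> f x" using elim by (simp add: LIM_zero_iff)
          then have "(\<lambda>m. norm (?f (r m) x) powr p) \<longlonglongrightarrow> norm (f x) powr p"
            using p by (intro tendsto_powr2 tendsto_norm tendsto_const) auto
          then have t: "(\<lambda>m. ennreal (norm (?f (r m) x) powr p)) \<longlonglongrightarrow> ennreal (norm (f x) powr p)"
            by (rule tendsto_ennrealI)
          show ?thesis using True t elim(2) by (simp add: mult.commute[of _ "w x"] ennreal_tendsto_cmult)
        qed simp
      qed
    qed
  qed
  have "(\<integral>\<^sup>+x. ennreal (norm (f x) powr p) * w x \<partial>lborel) \<le> epowr L p"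
  proof (rule nn_integral_le_of_tendsto[OF _ _ loc tendsto_const])
    fix k :: nat
    have [measurable]: "cball (0::'a) (real k) \<in> sets borel" by simp
    show "(\<lambda>x. ennreal (norm (f x) powr p) * w x * indicator (cball 0 (real k)) x) \<in> borel_measurable lborel" by measurable
  next
    show "AE x in lborel. (\<lambda>k. ennreal (norm (f x) powr p) * w x * indicator (cball 0 (real k)) x) \<longlonglongrightarrow> ennreal (norm (f x) powr p) * w x"
    proof (intro AE_I2)
      fix x :: 'a
      have "\<forall>\<^sub>F k in sequentially. ennreal (norm (f x) powr p) * w x = ennreal (norm (f x) powr p) * w x * indicator (cball 0 (real k)) x"
        using eventually_ge_at_top[of "nat \<lceil>norm x\<rceil>"] by eventually_elim (auto simp: nat_ceiling_le_eq)
      then show "(\<lambda>k. ennreal (norm (f x) powr p) * w x * indicator (cball 0 (real k)) x) \<longlonglongrightarrow> ennreal (norm (f x) powr p) * w x"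
        by (rule Lim_transform_eventually[OF tendsto_const])
    qed
  qed
  then show ?thesis unfolding wLp_norm_lborel using p by (subst epowr_le_iff) auto
qed simp

lemma wL1_borel:
  assumes "g \<in> borel_measurable borel" "(\<integral>\<^sup>+x. ennreal (norm (g x)) * w x \<partial>lborel) < \<infinity>"
  shows "g \<in> wL1 w"
proof -
  have "g \<in> borel_measurable lebesgue" using assms(1) by (intro measurable_completion) simp
  then show ?thesis using assms(2) by (simp add: wL1_def wLp_norm_1)
qed

lemma conv_in_W11:
  fixes w :: "'a::euclidean_space \<Rightarrow> ennreal" and f :: "'a \<Rightarrow> real"
  assumes w: "A1_star w" and e: "0 < e" and f: "loc_int f"
    and L1: "(\<integral>\<^sup>+x. ennreal (norm (f x)) * w x \<partial>lborel) < \<infinity>" and var: "weighted_variation w f < \<infinity>"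
  shows "conv (mollifier e) f \<in> W11 w"
proof -
  have K: "0 < A1_const w" using A1_const_bound(1)[OF w] by simp
  note wm = A1_star_basic(2)[OF w] and ball = ball_integral_A1[OF w]
  have "(\<integral>\<^sup>+x. ennreal (norm (conv (mollifier e) f x)) * w x \<partial>lborel) < \<infinity>"
  proof (rule order_le_less_trans[OF mollified_wL1_bound[OF e f wm ball]])
    have "(\<integral>\<^sup>+x. ennreal (norm (f x)) * w x \<partial>lborel) < top" using L1 by (simp only: infinity_ennreal_def)
    then show "ennreal (A1_const w) * (\<integral>\<^sup>+x. ennreal (norm (f x)) * w x \<partial>lborel) < \<infinity>"
      unfolding infinity_ennreal_def ennreal_mult_less_top by (intro disjI2 conjI ennreal_less_top)
  qed
  then have "conv (mollifier e) f \<in> wL1 w"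
    by (rule wL1_borel[OF borel_measurable_continuous_onI[OF continuous_conv[OF kernel_mollifier[OF e] f]]])
  moreover have "(\<integral>\<^sup>+x. ennreal (norm (moll_gradient e f x)) * w x \<partial>lborel) < \<infinity>"
  proof (rule order_le_less_trans[OF mollified_gradient_bound[OF e f wm K ball]])
    have "weighted_variation w f < top" using var by (simp only: infinity_ennreal_def)
    then show "ennreal (A1_const w) * weighted_variation w f < \<infinity>"
      unfolding infinity_ennreal_def ennreal_mult_less_top by (intro disjI2 conjI ennreal_less_top)
  qed
  then have "moll_gradient e f \<in> wL1 w"
    by (rule wL1_borel[OF borel_measurable_continuous_onI[OF continuous_moll_gradient[OF e f]]])
  ultimately show ?thesis unfolding W11_def using has_weak_gradient_conv[OF e f] by blast
qed

section \<open>The weighted Sobolev inequality\<close>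

text \<open>
  The argument for Borel functions in an arbitrary Euclidean space. The bound \<open>main\<close> is common to both
  inequalities; they differ in how the weighted integrals \<open>D\<close> of the gradients are estimated.
\<close>

theorem weighted_sobolev_borel:
  fixes w :: "'a::euclidean_space \<Rightarrow> ennreal" and f :: "'a \<Rightarrow> real" and C1 p :: real
  assumes w: "A1_star w" and p: "1 < p" and C1: "0 < C1"
    and GNS: "\<And>g G. g \<in> W11 w \<Longrightarrow> has_weak_gradient g G \<Longrightarrow>
          wLp_norm p w g \<le> ennreal C1 * wLp_norm 1 (\<lambda>x. epowr (maximal_fun w x) (1 / p)) G"
    and fb: "f \<in> borel_measurable borel"
    and L1: "(\<integral>\<^sup>+x. ennreal (norm (f x)) * w x \<partial>lborel) < \<infinity>" and var: "weighted_variation w f < \<infinity>"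
  defines "v \<equiv> \<lambda>x. epowr (w x) (1 / p)"
  shows "wLp_norm p w f \<le> ennreal (C1 * A1_const w powr (2 / p)) * weighted_variation v f"
    and "approximable v f \<Longrightarrow> wLp_norm p w f \<le> ennreal (C1 * A1_const w powr (1 / p)) * weighted_variation v f"
proof -
  define K where "K = A1_const w"
  define Kq where "Kq = K powr (1 / p)"
  have K1: "1 \<le> K" unfolding K_def by (rule A1_const_bound(1)[OF w])
  have Kq: "0 < Kq" using K1 by (simp add: Kq_def)
  have q: "0 < 1 / p" "1 / p < 1" using p by auto
  note lsc = A1_star_basic(1)[OF w] and wm[measurable] = A1_star_basic(2)[OF w]
  have f: "loc_int f" by (rule loc_int_wL1[OF lsc A1_star_pos[OF w] fb L1])
  have lscv: "lower_semicontinuous v" unfolding v_def by (rule lower_semicontinuous_epowr[OF lsc q(1)])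
  have vm[measurable]: "v \<in> borel_measurable borel" by (rule lower_semicontinuous_measurable[OF lscv])
  have ballv: "(\<integral>\<^sup>+y\<in>ball x r. v y \<partial>lborel) \<le> (ennreal Kq * v x) * emeasure lborel (ball x r)" if "0 < r" for x r
    unfolding v_def Kq_def K_def by (rule ball_integral_epowr_A1[OF w that q])
  define e where "e m = inverse (real (Suc m))" for m
  have e: "0 < e m" for m by (simp add: e_def)
  have e0: "e \<longlonglongrightarrow> 0" unfolding e_def by (rule LIMSEQ_inverse_real_of_nat)
  define D where "D m = (\<integral>\<^sup>+x. ennreal (norm (moll_gradient (e m) f x)) * v x \<partial>lborel)" for m
  have step: "wLp_norm p w (conv (mollifier (e m)) f) \<le> ennreal (C1 * Kq) * D m" for m
  proof -
    let ?G = "moll_gradient (e m) f"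
    have [measurable]: "?G \<in> borel_measurable borel"
      by (intro borel_measurable_continuous_onI continuous_moll_gradient[OF e f])
    have "wLp_norm p w (conv (mollifier (e m)) f) \<le> ennreal C1 * wLp_norm 1 (\<lambda>x. epowr (maximal_fun w x) (1 / p)) ?G"
      by (rule GNS[OF conv_in_W11[OF w e f L1 var] has_weak_gradient_conv[OF e f]])
    also have "wLp_norm 1 (\<lambda>x. epowr (maximal_fun w x) (1 / p)) ?G
        \<le> (\<integral>\<^sup>+x. ennreal Kq * (ennreal (norm (?G x)) * v x) \<partial>lborel)"
      unfolding wLp_norm_1
    proof (rule nn_integral_mono)
      fix x
      have "epowr (maximal_fun w x) (1 / p) \<le> epowr (ennreal K * w x) (1 / p)"
        unfolding K_def using q by (intro epowr_mono maximal_fun_le[OF w]) auto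
      also have "\<dots> = ennreal Kq * v x" unfolding v_def Kq_def using K1 by (intro epowr_mult) simp
      finally have "ennreal (norm (?G x)) * epowr (maximal_fun w x) (1 / p) \<le> ennreal (norm (?G x)) * (ennreal Kq * v x)"
        by (rule mult_left_mono) simp
      then show "ennreal (norm (?G x)) * epowr (maximal_fun w x) (1 / p) \<le> ennreal Kq * (ennreal (norm (?G x)) * v x)"
        by (simp only: mult.left_commute)
    qed
    also have "\<dots> = ennreal Kq * D m" unfolding D_def by (rule nn_integral_cmult) measurable
    finally show ?thesis using C1 Kq by (simp add: ennreal_mult mult.assoc mult_left_mono)
  qed
  have main: "wLp_norm p w f \<le> ennreal (C1 * Kq) * L" if "\<And>m. D m \<le> B m" "B \<longlonglongrightarrow> L" for B L
  proof (rule wLp_norm_le_of_mollified[OF f wm A1_star_AE_finite[OF w] _ e e0])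
    show "wLp_norm p w (conv (mollifier (e m)) f) \<le> ennreal (C1 * Kq) * B m" for m
      by (rule order_trans[OF step]) (intro mult_left_mono that(1) zero_le)
    show "(\<lambda>m. ennreal (C1 * Kq) * B m) \<longlonglongrightarrow> ennreal (C1 * Kq) * L"
      by (intro ennreal_tendsto_cmult that(2)) simp
  qed (use p in simp)
  have "D m \<le> ennreal Kq * weighted_variation v f" for m
    unfolding D_def by (rule mollified_gradient_bound[OF e f vm Kq ballv])
  from main[OF this tendsto_const]
  have "wLp_norm p w f \<le> ennreal (C1 * Kq) * (ennreal Kq * weighted_variation v f)" .
  also have "\<dots> = ennreal (C1 * Kq * Kq) * weighted_variation v f"
    using C1 Kq by (simp add: ennreal_mult mult.assoc)
  also have "C1 * Kq * Kq = C1 * K powr (2 / p)"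
    by (simp add: Kq_def mult.assoc powr_add[symmetric])
  finally show "wLp_norm p w f \<le> ennreal (C1 * A1_const w powr (2 / p)) * weighted_variation v f"
    unfolding K_def .
  assume app: "approximable v f"
  have "wLp_norm p w f \<le> ennreal (C1 * Kq) * weighted_variation v f"
  proof (cases "weighted_variation v f = top")
    case True
    then show ?thesis using C1 Kq by (simp add: ennreal_mult_top)
  next
    case False
    let ?\<mu> = "variation_measure f"
    let ?R = "\<lambda>m x. \<integral>\<^sup>+y. ennreal (mollifier (e m) (x - y)) * v y \<partial>lborel"
    have meas: "h \<in> borel_measurable ?\<mu>" if "h \<in> borel_measurable borel" for h :: "'a \<Rightarrow> ennreal"
      using that measurable_cong_sets[OF sets_variation_measure[of f] refl] by blast
    have int: "(\<integral>\<^sup>+x. v x \<partial>?\<mu>) \<le> weighted_variation v f"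
      by (rule nn_integral_variation_le_weighted_variation[OF f lscv])
    have DB: "D m \<le> (\<integral>\<^sup>+x. ?R m x \<partial>?\<mu>)" for m
      unfolding D_def
    proof (rule mollified_gradient_duality[OF e f vm])
      fix \<Phi> :: "'a \<Rightarrow> 'a" assume \<Phi>: "test_field UNIV \<Phi>" "\<And>x. ennreal (norm (\<Phi> x)) \<le> ?R m x"
      have "ennreal (pairing f \<Phi>) \<le> (\<integral>\<^sup>+x. ennreal (norm (\<Phi> x)) \<partial>?\<mu>)"
        by (rule pairing_le_nn_integral_variation[OF f classical_variation_ball_finite[OF lsc A1_star_pos[OF w] fb var] \<Phi>(1)])
      also have "\<dots> \<le> (\<integral>\<^sup>+x. ?R m x \<partial>?\<mu>)" by (intro nn_integral_mono \<Phi>(2))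
      finally show "ennreal (pairing f \<Phi>) \<le> (\<integral>\<^sup>+x. ?R m x \<partial>?\<mu>)" .
    qed
    have "(\<lambda>m. \<integral>\<^sup>+x. ?R m x \<partial>?\<mu>) \<longlonglongrightarrow> (\<integral>\<^sup>+x. v x \<partial>?\<mu>)"
    proof (rule nn_integral_dominated_convergence)
      show "?R m \<in> borel_measurable ?\<mu>" for m
        by (rule meas) measurable
      show "v \<in> borel_measurable ?\<mu>" by (rule meas[OF vm])
      show "(\<lambda>x. ennreal Kq * v x) \<in> borel_measurable ?\<mu>" by (rule meas) measurable
      show "AE x in ?\<mu>. ?R m x \<le> ennreal Kq * v x" for m
        by (intro AE_I2 mollified_le_of_ball_bound[OF e vm ballv])
      have "(\<integral>\<^sup>+x. ennreal Kq * v x \<partial>?\<mu>) = ennreal Kq * (\<integral>\<^sup>+x. v x \<partial>?\<mu>)"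
        by (rule nn_integral_cmult[OF meas[OF vm]])
      also have "\<dots> < \<infinity>" using int False by (simp add: ennreal_mult_less_top less_top order_le_less_trans)
      finally show "(\<integral>\<^sup>+x. ennreal Kq * v x \<partial>?\<mu>) < \<infinity>" .
      show "AE x in ?\<mu>. (\<lambda>m. ?R m x) \<longlonglongrightarrow> v x"
        using app unfolding approximable_def
        by eventually_elim (rule mollified_tendsto_of_approximable[OF vm e e0])
    qed
    from main[OF DB this] have "wLp_norm p w f \<le> ennreal (C1 * Kq) * (\<integral>\<^sup>+x. v x \<partial>?\<mu>)" .
    also have "\<dots> \<le> ennreal (C1 * Kq) * weighted_variation v f" by (intro mult_left_mono int) simp
    finally show ?thesis .
  qed
  then show "wLp_norm p w f \<le> ennreal (C1 * A1_const w powr (1 / p)) * weighted_variation v f"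
    unfolding Kq_def K_def .
qed

text \<open>
  Measurability is shared by functions that agree almost everywhere, because Lebesgue measure is
  complete; if both fail to be measurable, both integrals are \<open>0\<close> by convention.
\<close>

lemma lebesgue_integral_cong_AE:
  fixes F G :: "'a::euclidean_space \<Rightarrow> real"
  assumes "AE x in lebesgue. F x = G x"
  shows "(LINT x|lebesgue. F x) = (LINT x|lebesgue. G x)"
proof (cases "F \<in> borel_measurable lebesgue")
  case True
  then have "G \<in> borel_measurable lebesgue" using assms by (rule borel_measurable_AE)
  then show ?thesis by (rule integral_cong_AE[OF True _ assms])
next
  case False
  have "G \<notin> borel_measurable lebesgue"
  proof
    assume "G \<in> borel_measurable lebesgue"
    moreover have "AE x in lebesgue. G x = F x" using assms by eventually_elim simp
    ultimately show False using False borel_measurable_AE by blast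
  qed
  then have "\<not> integrable lebesgue F" "\<not> integrable lebesgue G"
    using False borel_measurable_integrable by blast+
  then show ?thesis by (simp add: not_integrable_integral_eq)
qed

text \<open>
  All quantities in the theorem depend on the equivalence class of the function only, so that a
  Borel representative may be chosen.
\<close>

lemma variations_cong_AE:
  fixes f g :: "'a::euclidean_space \<Rightarrow> real"
  assumes "AE x in lborel. f x = g x"
  shows "weighted_variation v f = weighted_variation v g"
    and "wLp_norm p v f = wLp_norm p v g"
    and "approximable v f \<longleftrightarrow> approximable v g"
proof -
  have ae: "AE x in lebesgue. f x = g x" using assms by (rule AE_completion)
  have int: "(LINT x|lebesgue. f x * divergence \<phi> x) = (LINT x|lebesgue. g x * divergence \<phi> x)" for \<phi>
    by (rule lebesgue_integral_cong_AE) (use ae in eventually_elim, simp)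
  show "weighted_variation v f = weighted_variation v g" unfolding weighted_variation_def int ..
  have cv: "classical_variation f = classical_variation g" unfolding classical_variation_def[abs_def] int ..
  have vm: "variation_measure f = variation_measure g" unfolding variation_measure_def cv ..
  then show "approximable v f \<longleftrightarrow> approximable v g" by (simp only: approximable_def)
  have "(\<integral>\<^sup>+x. ennreal (norm (f x) powr p) * v x \<partial>lebesgue) = (\<integral>\<^sup>+x. ennreal (norm (g x) powr p) * v x \<partial>lebesgue)"
    by (rule nn_integral_cong_AE) (use ae in eventually_elim, simp)
  then show "wLp_norm p v f = wLp_norm p v g" unfolding wLp_norm_def by simp
qed

theorem theorem1p3:
  fixes w :: "real ^ 'n \<Rightarrow> ennreal" and C1 :: real and p :: real
  assumes "2 \<le> CARD('n)"
    and p: "p = sobolev_conj CARD('n)"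
    and "A1_star w"
    and "0 < C1"
    and GNS: "\<And>g G. g \<in> W11 w \<Longrightarrow> has_weak_gradient g G \<Longrightarrow>
          wLp_norm p w g
            \<le> ennreal C1 * wLp_norm 1 (\<lambda>x. epowr (maximal_fun w x) (1 / p)) G"
  shows "\<forall>f \<in> BV w.
      wLp_norm p w f
        \<le> ennreal (C1 * A1_const w powr (2 / p)) * weighted_variation (\<lambda>x. epowr (w x) (1 / p)) f
      \<and> (approximable (\<lambda>x. epowr (w x) (1 / p)) f \<longrightarrow>
           wLp_norm p w f
             \<le> ennreal (C1 * A1_const w powr (1 / p)) * weighted_variation (\<lambda>x. epowr (w x) (1 / p)) f)"
proof
  fix f assume f: "f \<in> BV w"
  have p1: "1 < p" using assms(1) unfolding p sobolev_conj_def by (simp add: less_divide_eq)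
  have fm: "f \<in> borel_measurable lebesgue" and f1: "wLp_norm 1 w f < \<infinity>" and fv: "weighted_variation w f < \<infinity>"
    using f by (auto simp: BV_def wL1_def)
  obtain g where g: "g \<in> borel_measurable lborel" "AE x in lborel. f x = g x"
    using completion_ex_borel_measurable_real[OF fm] by blast
  note cong = variations_cong_AE[OF g(2)]
  have gb: "g \<in> borel_measurable borel" using g(1) by simp
  have g1: "(\<integral>\<^sup>+x. ennreal (norm (g x)) * w x \<partial>lborel) < \<infinity>"
    using f1 unfolding cong(2) wLp_norm_1 .
  have gv: "weighted_variation w g < \<infinity>" using fv unfolding cong(1) .
  note bounds = weighted_sobolev_borel[OF assms(3) p1 assms(4) GNS gb g1 gv]
  show "wLp_norm p w f
        \<le> ennreal (C1 * A1_const w powr (2 / p)) * weighted_variation (\<lambda>x. epowr (w x) (1 / p)) f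
      \<and> (approximable (\<lambda>x. epowr (w x) (1 / p)) f \<longrightarrow>
           wLp_norm p w f
             \<le> ennreal (C1 * A1_const w powr (1 / p)) * weighted_variation (\<lambda>x. epowr (w x) (1 / p)) f)"
    unfolding cong using bounds by blast
qed

end
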